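(* Let $\mathbb{K}$ be a field, $S=\mathbb{K}[x_1,\ldots,x_n]$, and let $X$ and $Y$ be simplicial complexes on the vertex set $[n]=\{1,\ldots,n\}$. Then $$\mathrm{reg}(I_X+I_Y)=\mathrm{reg}(I_{X\cap Y})\leq \mathrm{reg}(I_X)+\mathrm{reg}(I_Y)-1$$ and $$\mathrm{reg}(I_X\cap I_Y)=\mathrm{reg}(I_{X\cup Y})\leq \mathrm{reg}(I_X)+\mathrm{reg}(I_Y).$$
   Context: For a simplicial complex $X$ on $[n]$, $I_X$ is the ideal of $S$ generated by the monomials $\prod_{i\in A}x_i$ for all $A\subset[n]$ with $A\notin X$ (the Stanley–Reisner ideal). For a graded $S$-module $M$, $\beta_{ij}(M)=\dim_{\mathbb{K}}\mathrm{Tor}_i^S(\mathbb{K},M)_j$ are the graded Betti numbers, and the regularity $\mathrm{reg}(M)$ is the minimal $\rho$ such that $\beta_{ij}(M)=0$ for all $j>i+\rho$.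
   Formalization: The first inequality is stated only when I_X and I_Y are both zero or both nonzero: reg(0) has no minimal ρ (it is read as −∞), so if exactly one of the ideals is zero the inequality as written is undefined or false. *)

theory Defs
  imports
    Complex_Main
    "HOL-Algebra.Ideal"
    "HOL-Library.Function_Algebras"
    "HOL-Library.Poly_Mapping"
    "HOL-Library.Extended_Real"
begin

section \<open>The polynomial ring\<close>

text \<open>Polynomials over \<open>'k\<close> in variables indexed by the natural numbers; a monomial is its
  exponent vector.  \<open>S = K[x\<^sub>1, \<dots>, x\<^sub>n]\<close> is the subring of those that only involve
  \<open>x\<^sub>1, \<dots>, x\<^sub>n\<close>.\<close>

type_synonym 'k mpoly = "(nat \<Rightarrow>\<^sub>0 nat) \<Rightarrow>\<^sub>0 'k"

definition polys :: "nat \<Rightarrow> 'k::field mpoly set" where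
  "polys n = {p. \<forall>m \<in> Poly_Mapping.keys p. Poly_Mapping.keys m \<subseteq> {1..n}}"

definition poly_ring :: "'k::field itself \<Rightarrow> nat \<Rightarrow> 'k mpoly ring" where
  "poly_ring K n = \<lparr>carrier = polys n, mult = (*), one = 1, zero = 0, add = (+)\<rparr>"

definition Const :: "'k::field \<Rightarrow> 'k mpoly" where
  "Const c = Poly_Mapping.single 0 c"

definition Var :: "nat \<Rightarrow> 'k::field mpoly" where
  "Var i = Poly_Mapping.single (Poly_Mapping.single i 1) 1"

definition total_deg :: "(nat \<Rightarrow>\<^sub>0 nat) \<Rightarrow> nat" where
  "total_deg m = (\<Sum>i \<in> Poly_Mapping.keys m. Poly_Mapping.lookup m i)"

text \<open>Degrees are integers, so that shifts need no case distinction; 0 is homogeneous of every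
  degree, and it is the only polynomial that is homogeneous of a negative degree.\<close>

definition homog :: "int \<Rightarrow> 'k::field mpoly \<Rightarrow> bool" where
  "homog d p \<longleftrightarrow> (\<forall>m \<in> Poly_Mapping.keys p. int (total_deg m) = d)"


section \<open>Graded free resolutions of the residue field\<close>

text \<open>A complex \<open>F\<close> of graded free \<open>S\<close>-modules of finite rank, augmented to \<open>K\<close>, in coordinates:
  \<open>F\<^sub>i\<close> has a basis indexed by \<open>a < rk F i\<close>, with basis element \<open>a\<close> in degree \<open>dg F i a\<close>.
  For \<open>i > 0\<close>, \<open>df F i a b\<close> is the coefficient of basis element \<open>a\<close> of \<open>F\<^bsub>i-1\<^esub>\<close> in the
  image of basis element \<open>b\<close> of \<open>F\<^sub>i\<close>.  The augmentation \<open>F\<^sub>0 \<rightarrow> K\<close> sends basis element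
  \<open>a\<close> to \<open>au F a\<close>.\<close>

record (overloaded) 'k free_complex =
  rk :: "nat \<Rightarrow> nat"
  dg :: "nat \<Rightarrow> nat \<Rightarrow> int"
  df :: "nat \<Rightarrow> nat \<Rightarrow> nat \<Rightarrow> 'k mpoly"
  au :: "nat \<Rightarrow> 'k"

text \<open>For an ideal \<open>M\<close> of \<open>S\<close> (in particular for \<open>M = S\<close>), \<open>F\<^sub>i \<otimes>\<^sub>S M\<close> is a direct sum of
  \<open>rk F i\<close> copies of \<open>M\<close>, and the differential acts by the same matrix as on \<open>F\<close>.\<close>

definition chains :: "'k::field free_complex \<Rightarrow> nat \<Rightarrow> 'k mpoly set \<Rightarrow> (nat \<Rightarrow> 'k mpoly) set" where
  "chains F i M = {v. (\<forall>a < rk F i. v a \<in> M) \<and> (\<forall>a \<ge> rk F i. v a = 0)}"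

definition diff :: "'k::field free_complex \<Rightarrow> nat \<Rightarrow> (nat \<Rightarrow> 'k mpoly) \<Rightarrow> (nat \<Rightarrow> 'k mpoly)" where
  "diff F i v =
     (\<lambda>a. if 0 < i \<and> a < rk F (i - 1) then \<Sum>b < rk F i. df F i a b * v b else 0)"

text \<open>\<open>S\<close> acts on \<open>K = S / (x\<^sub>1, \<dots>, x\<^sub>n)\<close> through the constant coefficient.\<close>

definition augment :: "'k::field free_complex \<Rightarrow> (nat \<Rightarrow> 'k mpoly) \<Rightarrow> 'k" where
  "augment F v = (\<Sum>a < rk F 0. Poly_Mapping.lookup (v a) 0 * au F a)"

definition cycles :: "'k::field free_complex \<Rightarrow> nat \<Rightarrow> 'k mpoly set \<Rightarrow> (nat \<Rightarrow> 'k mpoly) set" where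
  "cycles F i M = {v \<in> chains F i M. diff F i v = 0}"

definition boundaries :: "'k::field free_complex \<Rightarrow> nat \<Rightarrow> 'k mpoly set \<Rightarrow> (nat \<Rightarrow> 'k mpoly) set" where
  "boundaries F i M = diff F (Suc i) ` chains F (Suc i) M"

definition graded_free_resolution :: "nat \<Rightarrow> 'k::field free_complex \<Rightarrow> bool" where
  "graded_free_resolution n F \<longleftrightarrow>
     (\<forall>i > 0. \<forall>a < rk F (i - 1). \<forall>b < rk F i.
        df F i a b \<in> polys n \<and> homog (dg F i b - dg F (i - 1) a) (df F i a b)) \<and>
     (\<forall>a < rk F 0. au F a \<noteq> 0 \<longrightarrow> dg F 0 a = 0) \<and>
     augment F ` chains F 0 (polys n) = UNIV \<and>
     {v \<in> chains F 0 (polys n). augment F v = 0} = boundaries F 0 (polys n) \<and>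
     (\<forall>i > 0. cycles F i (polys n) = boundaries F i (polys n))"


section \<open>Graded Betti numbers and regularity\<close>

text \<open>\<open>Tor\<^sub>i(K, M)\<close> is the \<open>i\<close>-th homology of \<open>F \<otimes>\<^sub>S M\<close> for a graded free resolution \<open>F\<close> of
  \<open>K\<close>; it does not depend on \<open>F\<close> up to isomorphism of graded modules.\<close>

definition resolution :: "nat \<Rightarrow> 'k::field free_complex" where
  "resolution n = (SOME F. graded_free_resolution n F)"

definition degree_part :: "'k::field free_complex \<Rightarrow> nat \<Rightarrow> int \<Rightarrow> (nat \<Rightarrow> 'k mpoly) set" where
  "degree_part F i j = {v. \<forall>a < rk F i. homog (j - dg F i a) (v a)}"

definition scale :: "'k::field \<Rightarrow> (nat \<Rightarrow> 'k mpoly) \<Rightarrow> (nat \<Rightarrow> 'k mpoly)" where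
  "scale c v = (\<lambda>a. Const c * v a)"

text \<open>The dimension of cycles modulo boundaries in degree \<open>j\<close>.  Both spaces are
  finite-dimensional and the second is contained in the first, so the subtraction is exact.\<close>

definition betti :: "nat \<Rightarrow> nat \<Rightarrow> int \<Rightarrow> 'k::field mpoly set \<Rightarrow> nat" where
  "betti n i j M =
     (let F = resolution n in
        vector_space.dim scale (cycles F i M \<inter> degree_part F i j)
        - vector_space.dim scale (boundaries F i M \<inter> degree_part F i j))"

text \<open>An infimum in \<open>ereal\<close>: for \<open>M = 0\<close> every integer \<open>\<rho>\<close> qualifies, and \<open>reg n {0} = -\<infinity>\<close>.\<close>

definition reg :: "nat \<Rightarrow> 'k::field mpoly set \<Rightarrow> ereal" where
  "reg n M = Inf {ereal (of_int \<rho>) | \<rho>::int. \<forall>i j. j > int i + \<rho> \<longrightarrow> betti n i j M = 0}"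


section \<open>Simplicial complexes and Stanley--Reisner ideals\<close>

text \<open>Not every \<open>i \<in> [n]\<close> has to be a vertex of \<open>X\<close>, but the empty face belongs to \<open>X\<close>.\<close>

definition simplicial_complex :: "nat \<Rightarrow> nat set set \<Rightarrow> bool" where
  "simplicial_complex n X \<longleftrightarrow>
     X \<subseteq> Pow {1..n} \<and> {} \<in> X \<and> (\<forall>A \<in> X. \<forall>B. B \<subseteq> A \<longrightarrow> B \<in> X)"

definition SR_ideal :: "'k::field itself \<Rightarrow> nat \<Rightarrow> nat set set \<Rightarrow> 'k mpoly set" where
  "SR_ideal K n X = genideal (poly_ring K n) {\<Prod>i\<in>A. Var i | A. A \<subseteq> {1..n} \<and> A \<notin> X}"


section \<open>Well-formedness of the library structures used above\<close>

lemma polys_0: "0 \<in> polys n"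
  by (simp add: polys_def)

lemma polys_1: "1 \<in> polys n"
  by (simp add: polys_def)

lemma polys_add:
  assumes "p \<in> polys n" "q \<in> polys n"
  shows "p + q \<in> polys n"
  using assms Poly_Mapping.keys_add[of p q] unfolding polys_def by blast

lemma polys_uminus: "p \<in> polys n \<Longrightarrow> - p \<in> polys n"
  by (simp add: polys_def keys_def)

lemma polys_mult:
  assumes "p \<in> polys n" "q \<in> polys n"
  shows "p * q \<in> polys n"
  unfolding polys_def
proof (intro CollectI ballI)
  fix m assume "m \<in> Poly_Mapping.keys (p * q)"
  then obtain a b where ab: "m = a + b" "a \<in> Poly_Mapping.keys p" "b \<in> Poly_Mapping.keys q"
    using Poly_Mapping.keys_mult[of p q] by blast
  have "Poly_Mapping.keys a \<subseteq> {1..n}" "Poly_Mapping.keys b \<subseteq> {1..n}"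
    using ab assms unfolding polys_def by blast+
  then show "Poly_Mapping.keys m \<subseteq> {1..n}"
    using Poly_Mapping.keys_add[of a b] ab(1) by blast
qed

lemma cring_poly_ring: "cring (poly_ring K n)"
proof (rule cringI)
  show "abelian_group (poly_ring K n)"
  proof (rule abelian_groupI)
    fix p assume "p \<in> carrier (poly_ring K n)"
    then show "\<exists>q \<in> carrier (poly_ring K n). q \<oplus>\<^bsub>poly_ring K n\<^esub> p = \<zero>\<^bsub>poly_ring K n\<^esub>"
      by (intro bexI[where x = "- p"]) (simp_all add: poly_ring_def polys_uminus)
  qed (simp_all add: poly_ring_def polys_0 polys_add ac_simps)
  show "comm_monoid (poly_ring K n)"
    by (rule comm_monoidI) (simp_all add: poly_ring_def polys_1 polys_mult ac_simps)
qed (simp add: poly_ring_def distrib_right)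

lemma vector_space_scale: "vector_space scale"
proof
  fix a b :: "'k::field" and v w :: "nat \<Rightarrow> 'k mpoly"
  show "scale a (v + w) = scale a v + scale a w"
    by (simp add: scale_def fun_eq_iff distrib_left)
  show "scale (a + b) v = scale a v + scale b v"
    by (simp add: scale_def Const_def fun_eq_iff single_add distrib_right)
  show "scale a (scale b v) = scale (a * b) v"
    by (simp add: scale_def Const_def fun_eq_iff mult_single mult.assoc [symmetric])
  show "scale 1 v = v"
    by (simp add: scale_def Const_def fun_eq_iff)
qed

end

theory Submission
  imports Defs
begin

text \<open>The multidegree-\<open>m\<close> part of \<open>Tor(K, I\<^sub>X)\<close>, computed by the Koszul resolution, is the homology of
  the complex spanned by the \<open>A \<subseteq> supp m\<close> with \<open>supp (m - A) \<notin> X\<close>.  If \<open>m\<close> is not squarefree this complex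
  is a cone; if \<open>m\<close> is the indicator of \<open>W\<close> it is the family of all \<open>A \<subseteq> W\<close> whose complement \<open>W - A\<close> is a
  nonface.  So \<open>reg I\<^sub>X \<le> r\<close> becomes a combinatorial condition on the up-closed family \<open>N\<close> of nonfaces:
  for every \<open>W\<close> the complex is exact in all degrees \<open>i < |W| - r\<close>.

  For intersections \<open>N \<inter> N'\<close>, first put \<open>N\<close> and \<open>N'\<close> on disjoint copies of the vertex set.  By a
  Kuenneth argument with contracting homotopies the resulting family is \<open>(r + r')\<close>-regular.  Then identify each
  vertex \<open>v\<close> with its copy \<open>v'\<close>, one at a time.  This does not increase the regularity: the long exact
  sequence of \<open>v\<close> shows that in degree \<open>|W| - r\<close> the homology of \<open>N\<close> surjects onto that of
  \<open>{A. A \<union> {v} \<in> N}\<close>, hence also onto that of \<open>{A. A \<union> {v, v'} \<in> N}\<close>, and this is what the long exact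
  sequence of the merged vertex needs.  For unions, use the Mayer-Vietoris sequence of \<open>N\<close> and \<open>N'\<close>, and
  \<open>r, r' \<ge> 1\<close> for nonzero ideals.\<close>

section \<open>Simplicial chains on families of sets\<close>

text \<open>Only the vanishing of Betti numbers enters \<open>reg\<close>, so no Tor module is
  identified up to isomorphism and no quotient is formed: every statement has the shape that cycles
  of a given degree bound, and fillings are passed along explicitly. Chain degree counts elements,
  so the empty set sits in degree 0 and chain degree is the homological degree of the Koszul
  complex.

  Intersections are the harder case: Mayer-Vietoris relates \<open>N \<inter> N'\<close> to
  \<open>N \<union> N'\<close>, and neither is known in advance. On disjoint vertex sets the
  intersection of the ideals is their product and the complexes become tensor products, so exactness
  below \<open>a\<close> and below \<open>b\<close> gives exactness below \<open>a + b\<close>; this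
  is where the sum of the regularities comes from. The bound for intersections is then an input to
  the bound for unions, where the connecting map lowers the degree by one and yields the
  \<open>- 1\<close>.\<close>

definition sgn_ins :: "nat \<Rightarrow> nat set \<Rightarrow> 'k::field" where
  "sgn_ins k A = (- 1) ^ card {l \<in> A. l < k}"

lemma sgn_ins_square [simp]: "sgn_ins k A * sgn_ins k A = (1::'k::field)"
  by (simp add: sgn_ins_def flip: power_mult_distrib)

lemma sgn_ins_square_mult [simp]: "sgn_ins k A * (sgn_ins k A * x) = (x::'k::field)"
  by (simp flip: mult.assoc)

lemma sgn_ins_insert:
  assumes "l \<notin> A"
  shows "sgn_ins k (insert l A) = (if l < k then - sgn_ins k A else (sgn_ins k A :: 'k::field))"
proof -
  have fin: "finite {j \<in> A. j < k}"
    by (rule finite_subset[of _ "{..<k}"]) auto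
  have "{j \<in> insert l A. j < k} = (if l < k then insert l {j \<in> A. j < k} else {j \<in> A. j < k})"
    by auto
  then show ?thesis
    using fin assms by (simp add: sgn_ins_def)
qed

lemma sgn_ins_anticomm:
  assumes "k \<noteq> l" "k \<notin> A" "l \<notin> A"
  shows "sgn_ins k (insert l A) * sgn_ins l A = - (sgn_ins l (insert k A) * sgn_ins k A :: 'k::field)"
  using assms by (cases "k < l") (auto simp: sgn_ins_insert)

text \<open>The simplicial boundary read coefficientwise: the faces \<open>insert k A\<close> are
  those that have \<open>A\<close> in their boundary. The empty set is an ordinary face, so the
  complex is augmented.\<close>

definition bd :: "nat set \<Rightarrow> (nat set \<Rightarrow> 'k::field) \<Rightarrow> nat set \<Rightarrow> 'k" where
  "bd V c A = (\<Sum>k \<in> V - A. sgn_ins k A * c (insert k A))"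

lemma bd_add: "bd V (c + d) = bd V c + bd V d"
  by (simp add: bd_def fun_eq_iff distrib_left sum.distrib)

lemma bd_diff: "bd V (c - d) = bd V c - bd V d"
  by (simp add: bd_def fun_eq_iff right_diff_distrib sum_subtractf)

lemma bd_0: "bd V 0 = 0"
  by (simp add: bd_def fun_eq_iff)

text \<open>The sign makes \<open>d\<close> a chain on the vertices other than \<open>v\<close>, whatever the position of \<open>v\<close> in the order.\<close>
definition glue :: "nat \<Rightarrow> (nat set \<Rightarrow> 'k::field) \<Rightarrow> (nat set \<Rightarrow> 'k) \<Rightarrow> nat set \<Rightarrow> 'k" where
  "glue v c d A = (if v \<in> A then sgn_ins v (A - {v}) * d (A - {v}) else c A)"

text \<open>The differential of a mapping cone, with \<open>c\<close> the part avoiding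
  \<open>v\<close> and \<open>d\<close> the part through \<open>v\<close>. It is the source of the
  long exact sequence that compares \<open>W\<close> with \<open>insert v W\<close>.\<close>

lemma bd_glue:
  assumes V: "finite V" "v \<in> V"
    and c: "\<And>A. v \<in> A \<Longrightarrow> c A = 0" and d: "\<And>A. v \<in> A \<Longrightarrow> d A = 0"
  shows "bd V (glue v c d) = glue v (bd V c + d) (- bd V d)"
proof
  fix A
  show "bd V (glue v c d) A = glue v (bd V c + d) (- bd V d) A"
  proof (cases "v \<in> A")
    case False
    have "bd V (glue v c d) A = sgn_ins v A * glue v c d (insert v A)
        + (\<Sum>k \<in> V - A - {v}. sgn_ins k A * glue v c d (insert k A))"
      unfolding bd_def using V False by (subst sum.remove[of _ v]) auto
    also have "sgn_ins v A * glue v c d (insert v A) = d A"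
      using False by (simp add: glue_def)
    also have "(\<Sum>k \<in> V - A - {v}. sgn_ins k A * glue v c d (insert k A))
        = (\<Sum>k \<in> V - A - {v}. sgn_ins k A * c (insert k A))"
      using False by (intro sum.cong) (auto simp: glue_def)
    also have "\<dots> = bd V c A"
      unfolding bd_def using V c by (intro sum.mono_neutral_left) auto
    finally show ?thesis
      using False by (simp add: glue_def[of v "bd V c + d"])
  next
    case True
    then obtain B where B: "A = insert v B" "v \<notin> B"
      by (metis mk_disjoint_insert)
    have "bd V (glue v c d) A = (\<Sum>k \<in> V - A. sgn_ins k A * (sgn_ins v (insert k B) * d (insert k B)))"
      unfolding bd_def using B by (intro sum.cong) (auto simp: glue_def insert_Diff_if)
    also have "\<dots> = (\<Sum>k \<in> V - A. - (sgn_ins v B * (sgn_ins k B * d (insert k B))))"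
    proof (intro sum.cong refl)
      fix k assume "k \<in> V - A"
      then have "k \<noteq> v" "k \<notin> B" using B by auto
      \<comment> \<open>Exactly one of \<open>v < k\<close> and \<open>k < v\<close> holds, so
        exactly one of the two signs flips.\<close>
      have "sgn_ins k A * sgn_ins v (insert k B) = - (sgn_ins v B * sgn_ins k B :: 'a)"
        using sgn_ins_insert[OF B(2), of k, where 'k = 'a] sgn_ins_insert[OF \<open>k \<notin> B\<close>, of v, where 'k = 'a] \<open>k \<noteq> v\<close>
        unfolding B(1) by (cases "v < k") (simp_all add: mult.commute)
      then show "sgn_ins k A * (sgn_ins v (insert k B) * d (insert k B))
          = - (sgn_ins v B * (sgn_ins k B * d (insert k B)))"
        by (metis mult.assoc mult_minus_left)
    qed
    also have "\<dots> = - (sgn_ins v B * (\<Sum>k \<in> V - A. sgn_ins k B * d (insert k B)))"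
      by (simp add: sum_negf sum_distrib_left)
    also have "(\<Sum>k \<in> V - A. sgn_ins k B * d (insert k B)) = bd V d B"
      unfolding bd_def using V B d by (intro sum.mono_neutral_left) auto
    finally show ?thesis
      using B by (simp add: glue_def[of v _ "- bd V d"])
  qed
qed

text \<open>Inserting two vertices in either order reaches the same set, and the two signs are
  opposite by \<open>sgn_ins_anticomm\<close>.\<close>

lemma bd_bd:
  assumes V: "finite V"
  shows "bd V (bd V c) = (0 :: nat set \<Rightarrow> 'k::field)"
proof
  fix A
  define f :: "nat \<times> nat \<Rightarrow> 'k" where
    "f = (\<lambda>(k, l). sgn_ins k A * (sgn_ins l (insert k A) * c (insert l (insert k A))))"
  define P where "P = {(k, l). k \<in> V - A \<and> l \<in> V - A \<and> k < l}"
  define Q where "Q = {(k, l). k \<in> V - A \<and> l \<in> V - A \<and> l < k}"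
  have fin: "finite P" "finite Q"
    by (rule finite_subset[of _ "V \<times> V"]; use V in \<open>auto simp: P_def Q_def\<close>)+
  have "bd V (bd V c) A = (\<Sum>k \<in> V - A. \<Sum>l \<in> V - insert k A. f (k, l))"
    by (simp add: bd_def f_def sum_distrib_left)
  also have "\<dots> = sum f (SIGMA k : V - A. V - insert k A)"
    using V by (subst sum.Sigma) auto
  also have "(SIGMA k : V - A. V - insert k A) = P \<union> Q"
    by (auto simp: P_def Q_def)
  also have "sum f (P \<union> Q) = sum f P + sum f Q"
    using fin by (intro sum.union_disjoint) (auto simp: P_def Q_def)
  also have "sum f Q = (\<Sum>p \<in> P. f (snd p, fst p))"
    by (rule sum.reindex_bij_witness[of _ "\<lambda>(k, l). (l, k)" "\<lambda>(k, l). (l, k)"]) (auto simp: P_def Q_def)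
  also have "sum f P + \<dots> = (\<Sum>p \<in> P. 0)"
    unfolding sum.distrib[symmetric]
  proof (intro sum.cong refl)
    fix p assume "p \<in> P"
    then obtain k l where p: "p = (k, l)" "k \<noteq> l" "k \<notin> A" "l \<notin> A"
      by (auto simp: P_def)
    show "f p + f (snd p, fst p) = 0"
    proof -
      have "f p + f (snd p, fst p) = (sgn_ins k (insert l A) * sgn_ins l A + sgn_ins l (insert k A) * sgn_ins k A)
          * c (insert k (insert l A))"
        by (simp add: f_def p(1) insert_commute[of l k] algebra_simps)
      then show ?thesis
        by (simp add: sgn_ins_anticomm[OF p(2,3,4)])
    qed
  qed
  finally show "bd V (bd V c) A = 0 A" by simp
qed

section \<open>Chains supported on a family and exactness in one degree\<close>

definition chn :: "nat set set \<Rightarrow> int \<Rightarrow> (nat set \<Rightarrow> 'k::field) set" where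
  "chn Q i = {c. \<forall>A. c A \<noteq> 0 \<longrightarrow> A \<in> Q \<and> int (card A) = i}"

text \<open>Vanishing of homology without quotients. The degree is an integer, so
  \<open>i - 1\<close> needs no case distinction; negative degrees contain only the zero
  chain.\<close>

definition exact_at :: "'k::field itself \<Rightarrow> nat set \<Rightarrow> nat set set \<Rightarrow> int \<Rightarrow> bool" where
  "exact_at K V Q i \<longleftrightarrow> (\<forall>c :: nat set \<Rightarrow> 'k. c \<in> chn Q i \<and> bd V c = 0 \<longrightarrow> (\<exists>u \<in> chn Q (i + 1). bd V u = c))"

lemma chn_0: "0 \<in> chn Q i" by (simp add: chn_def)
lemma chn_add: "c \<in> chn Q i \<Longrightarrow> d \<in> chn Q i \<Longrightarrow> c + d \<in> chn Q i"
  unfolding chn_def by (auto) (metis add.right_neutral add.left_neutral)+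
lemma chn_minus: "c \<in> chn Q i \<Longrightarrow> - c \<in> chn Q i"
  by (auto simp: chn_def)
lemma chn_diff: "c \<in> chn Q i \<Longrightarrow> d \<in> chn Q i \<Longrightarrow> c - d \<in> chn Q i"
  using chn_add[of c Q i "- d"] chn_minus[of d Q i] by simp
lemma chn_mono: "c \<in> chn Q i \<Longrightarrow> Q \<subseteq> Q' \<Longrightarrow> c \<in> chn Q' i"
  by (auto simp: chn_def)

lemma chn_bd:
  assumes "c \<in> chn Q i" and down: "\<And>A B. A \<in> Q \<Longrightarrow> B \<subseteq> A \<Longrightarrow> B \<in> Q" and fin: "\<And>A. A \<in> Q \<Longrightarrow> finite A"
  shows "bd V c \<in> chn Q (i - 1)"
  unfolding chn_def
proof (intro CollectI allI impI)
  fix A assume "bd V c A \<noteq> 0"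
  then obtain k where k: "k \<in> V - A" "c (insert k A) \<noteq> 0"
    unfolding bd_def by (elim sum.not_neutral_contains_not_neutral) auto
  then have ins: "insert k A \<in> Q" "int (card (insert k A)) = i"
    using assms(1) by (simp_all add: chn_def)
  moreover have "A \<in> Q"
    using down[OF ins(1)] by blast
  moreover have "card (insert k A) = Suc (card A)"
    using k fin[OF \<open>A \<in> Q\<close>] by (intro card_insert_disjoint) auto
  ultimately show "A \<in> Q \<and> int (card A) = i - 1"
    by linarith
qed

section \<open>Splitting chains at a vertex\<close>

definition fst_part :: "nat \<Rightarrow> (nat set \<Rightarrow> 'k::field) \<Rightarrow> nat set \<Rightarrow> 'k" where
  "fst_part v c A = (if v \<in> A then 0 else c A)"
definition snd_part :: "nat \<Rightarrow> (nat set \<Rightarrow> 'k::field) \<Rightarrow> nat set \<Rightarrow> 'k" where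
  "snd_part v c A = (if v \<in> A then 0 else sgn_ins v A * c (insert v A))"

lemma glue_parts: "glue v (fst_part v c) (snd_part v c) = c"
  by (auto simp: fun_eq_iff glue_def fst_part_def snd_part_def insert_absorb)

lemma glue_eqD:
  assumes "glue v c d = glue v c' d'"
    and "\<And>A. v \<in> A \<Longrightarrow> c A = 0" "\<And>A. v \<in> A \<Longrightarrow> d A = 0" "\<And>A. v \<in> A \<Longrightarrow> c' A = 0" "\<And>A. v \<in> A \<Longrightarrow> d' A = 0"
  shows "c = c'" "d = (d' :: nat set \<Rightarrow> 'k::field)"
proof -
  have 1: "glue v c d A = glue v c' d' A" for A by (simp add: assms)
  show "c = c'"
  proof
    fix A show "c A = c' A" using 1[of A] assms(2,4) by (cases "v \<in> A") (auto simp: glue_def)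
  qed
  show "d = d'"
  proof
    fix A show "d A = d' A"
    proof (cases "v \<in> A")
      case False
      have "sgn_ins v A * d A = sgn_ins v A * d' A"
        using 1[of "insert v A"] False by (simp add: glue_def)
      then show ?thesis by (metis sgn_ins_square_mult)
    qed (use assms in auto)
  qed
qed

lemma bd_vanish:
  assumes "\<And>A. v \<in> A \<Longrightarrow> c A = 0" "v \<in> A"
  shows "bd V c A = 0"
  using assms by (simp add: bd_def)

lemma glue_0_0: "glue v 0 0 = 0" by (auto simp: glue_def fun_eq_iff)

text \<open>In a cycle the part through \<open>v\<close> is minus the boundary of the part avoiding
  \<open>v\<close>, so the cone with apex \<open>v\<close> over the latter part bounds the whole
  cycle.\<close>

lemma exact_at_cone:
  fixes K :: "'k::field itself"
  assumes "finite V" "v \<in> V" and cone: "\<And>A. v \<notin> A \<Longrightarrow> insert v A \<in> Q \<longleftrightarrow> A \<in> Q"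
    and fin: "\<And>A. A \<in> Q \<Longrightarrow> finite A"
  shows "exact_at K V Q i"
  unfolding exact_at_def
proof (intro allI impI, elim conjE)
  fix c :: "nat set \<Rightarrow> 'k" assume c: "c \<in> chn Q i" "bd V c = 0"
  let ?c = "fst_part v c" and ?d = "snd_part v c"
  have "glue v (bd V ?c + ?d) (- bd V ?d) = glue v 0 0"
    using bd_glue[of V v ?c ?d] assms(1,2) c(2) by (simp add: glue_parts glue_0_0 fst_part_def snd_part_def)
  then have 1: "bd V ?c + ?d = 0"
    by (rule glue_eqD) (auto intro!: bd_vanish simp: fst_part_def snd_part_def)
  have "bd V (glue v 0 ?c) = glue v (bd V 0 + ?c) (- bd V ?c)"
    using assms(1,2) by (intro bd_glue) (auto simp: fst_part_def)
  also have "\<dots> = c"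
    using 1 glue_parts[of v c] by (simp add: bd_0 add_eq_0_iff)
  finally have "bd V (glue v 0 ?c) = c" .
  moreover have "glue v 0 ?c \<in> chn Q (i + 1)"
    unfolding chn_def
  proof (intro CollectI allI impI)
    fix A assume "glue v 0 ?c A \<noteq> 0"
    then have A: "v \<in> A" "c (A - {v}) \<noteq> 0" by (auto simp: glue_def fst_part_def split: if_splits)
    then have "A - {v} \<in> Q" "int (card (A - {v})) = i" using c by (auto simp: chn_def)
    then show "A \<in> Q \<and> int (card A) = i + 1"
      using cone[of "A - {v}"] A fin[of A] by (auto simp: insert_absorb card_Diff_singleton_if card_gt_0_iff split: if_splits)
        (metis One_nat_def Suc_pred card_gt_0_iff empty_iff of_nat_Suc add.commute)
  qed
  ultimately show "\<exists>u \<in> chn Q (i + 1). bd V u = c" by blast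
qed

section \<open>Regularity of up-closed families\<close>

lemma bd_cong_vertices:
  assumes "finite V" "finite V'" "\<And>A. c A \<noteq> 0 \<Longrightarrow> A \<subseteq> V \<and> A \<subseteq> V'"
  shows "bd V c = bd V' c"
proof
  fix A
  have "bd V c A = (\<Sum>k \<in> V \<inter> V' - A. sgn_ins k A * c (insert k A))"
    unfolding bd_def using assms by (intro sum.mono_neutral_right) auto
  also have "\<dots> = bd V' c A"
    unfolding bd_def using assms by (intro sum.mono_neutral_left) auto
  finally show "bd V c A = bd V' c A" .
qed

text \<open>Only vertices lying in faces contribute to \<open>bd\<close>, so the complexes for
  different \<open>W\<close> can be compared inside one ambient vertex set.\<close>

lemma exact_at_cong_vertices:
  assumes "finite V" "finite V'" "\<And>A. A \<in> Q \<Longrightarrow> A \<subseteq> V \<and> A \<subseteq> V'"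
  shows "exact_at K V Q i \<longleftrightarrow> exact_at K V' Q i"
proof -
  have "bd V c = bd V' c" if "c \<in> chn Q j" for j and c :: "nat set \<Rightarrow> 'a"
    using assms that by (intro bd_cong_vertices) (auto simp: chn_def)
  then show ?thesis
    unfolding exact_at_def by (metis (no_types, lifting))
qed

definition up_closed :: "nat set set \<Rightarrow> bool" where
  "up_closed N \<longleftrightarrow> (\<forall>A B. A \<in> N \<longrightarrow> A \<subseteq> B \<longrightarrow> B \<in> N)"

text \<open>The upper Koszul complex in squarefree multidegree \<open>W\<close>; it is closed under subsets if \<open>N\<close> is up-closed.\<close>
definition upper_koszul :: "nat set set \<Rightarrow> nat set \<Rightarrow> nat set set" where
  "upper_koszul N W = {A. A \<subseteq> W \<and> W - A \<in> N}"

text \<open>\<open>card W\<close> is the internal degree and \<open>i\<close> the homological degree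
  of a Betti number, so the range is that of \<open>reg\<close>.\<close>

definition regular :: "'k::field itself \<Rightarrow> nat set \<Rightarrow> int \<Rightarrow> nat set set \<Rightarrow> bool" where
  "regular K V r N \<longleftrightarrow> (\<forall>W i. W \<subseteq> V \<longrightarrow> int (card W) > i + r \<longrightarrow> exact_at K W (upper_koszul N W) i)"

lemma regularD:
  assumes "regular K V r N" "finite V'" "finite W" "W \<subseteq> V" "W \<subseteq> V'" "int (card W) > i + r"
  shows "exact_at K V' (upper_koszul N W) i"
proof -
  have "exact_at K W (upper_koszul N W) i" using assms by (auto simp: regular_def)
  then show ?thesis
    using assms by (subst exact_at_cong_vertices[of _ W]) (auto simp: upper_koszul_def)
qed

lemma regularI:
  assumes "finite V" "V \<subseteq> V'" "finite V'"
    and "\<And>W i. W \<subseteq> V \<Longrightarrow> int (card W) > i + r \<Longrightarrow> exact_at K V' (upper_koszul N W) i"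
  shows "regular K V r N"
  unfolding regular_def
proof (intro allI impI)
  fix W i assume W: "W \<subseteq> V" "int (card W) > i + r"
  then have "finite W" using assms(1) finite_subset by blast
  then show "exact_at K W (upper_koszul N W) i"
    using assms(4)[OF W] assms W by (subst exact_at_cong_vertices[of _ V']) (auto simp: upper_koszul_def)
qed

lemma chn_upper_koszul_bd:
  assumes "c \<in> chn (upper_koszul N W) i" "up_closed N" "finite W"
  shows "bd V c \<in> chn (upper_koszul N W) (i - 1)"
proof (rule chn_bd[OF assms(1)])
  fix A B assume "A \<in> upper_koszul N W" "B \<subseteq> A"
  moreover from \<open>B \<subseteq> A\<close> have "W - A \<subseteq> W - B" by auto
  ultimately show "B \<in> upper_koszul N W"
    using assms(2) unfolding upper_koszul_def up_closed_def by blast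
qed (use assms(3) finite_subset in \<open>auto simp: upper_koszul_def\<close>)

text \<open>On ideals this is the colon ideal by the variable of \<open>v\<close>.\<close>

definition shift :: "nat \<Rightarrow> nat set set \<Rightarrow> nat set set" where
  "shift v N = {A. insert v A \<in> N}"

lemma up_closed_shift: "up_closed N \<Longrightarrow> up_closed (shift v N)"
  unfolding up_closed_def shift_def by (metis insert_mono mem_Collect_eq)

lemma upper_koszul_mono: "N \<subseteq> N' \<Longrightarrow> upper_koszul N W \<subseteq> upper_koszul N' W"
  by (auto simp: upper_koszul_def)

lemma subset_shift: "up_closed N \<Longrightarrow> N \<subseteq> shift v N"
  unfolding up_closed_def shift_def by blast

text \<open>These rules exhibit the complex on \<open>insert v W\<close> as the mapping cone of the
  inclusion of \<open>upper_koszul N W\<close> into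
  \<open>upper_koszul (shift v N) W\<close>.\<close>

lemma upper_koszul_insert:
  assumes "v \<notin> W"
  shows "v \<notin> A \<Longrightarrow> A \<in> upper_koszul N (insert v W) \<longleftrightarrow> A \<in> upper_koszul (shift v N) W"
    and "v \<notin> A \<Longrightarrow> insert v A \<in> upper_koszul N (insert v W) \<longleftrightarrow> A \<in> upper_koszul N W"
    and "A \<in> upper_koszul N W \<Longrightarrow> v \<notin> A"
proof -
  assume v: "v \<notin> A"
  have "insert v W - A = insert v (W - A)" "insert v W - insert v A = W - A"
    using v assms by auto
  then show "A \<in> upper_koszul N (insert v W) \<longleftrightarrow> A \<in> upper_koszul (shift v N) W"
    and "insert v A \<in> upper_koszul N (insert v W) \<longleftrightarrow> A \<in> upper_koszul N W"
    using v assms by (auto simp: upper_koszul_def shift_def)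
qed (use assms in \<open>auto simp: upper_koszul_def\<close>)

lemma fst_part_chn:
  assumes "v \<notin> W" "c \<in> chn (upper_koszul N (insert v W)) i"
  shows "fst_part v c \<in> chn (upper_koszul (shift v N) W) i"
  using assms(2) upper_koszul_insert(1)[OF assms(1)] by (auto simp: chn_def fst_part_def split: if_splits)

lemma snd_part_chn:
  assumes "v \<notin> W" "finite W" "c \<in> chn (upper_koszul N (insert v W)) i"
  shows "snd_part v c \<in> chn (upper_koszul N W) (i - 1)"
  unfolding chn_def
proof (intro CollectI allI impI)
  fix A assume "snd_part v c A \<noteq> 0"
  then have A: "v \<notin> A" "c (insert v A) \<noteq> 0" by (auto simp: snd_part_def split: if_splits)
  then have *: "insert v A \<in> upper_koszul N (insert v W)" "int (card (insert v A)) = i"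
    using assms(3) by (auto simp: chn_def)
  then have "finite A" using assms(2) finite_subset[of "insert v A" "insert v W"] by (auto simp: upper_koszul_def)
  then show "A \<in> upper_koszul N W \<and> int (card A) = i - 1"
    using * A upper_koszul_insert(2)[OF assms(1) A(1)] by auto
qed

lemma glue_chn:
  assumes "v \<notin> W" "finite W" "c \<in> chn (upper_koszul (shift v N) W) i" "d \<in> chn (upper_koszul N W) (i - 1)"
  shows "glue v c d \<in> chn (upper_koszul N (insert v W)) i"
  unfolding chn_def
proof (intro CollectI allI impI)
  fix A assume A: "glue v c d A \<noteq> 0"
  show "A \<in> upper_koszul N (insert v W) \<and> int (card A) = i"
  proof (cases "v \<in> A")
    case True
    then obtain B where B: "A = insert v B" "v \<notin> B"
      by (metis mk_disjoint_insert)
    then have "d B \<noteq> 0" using A by (auto simp: glue_def)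
    then have "B \<in> upper_koszul N W" "int (card B) = i - 1" using assms(4) by (auto simp: chn_def)
    moreover from this have "finite B" using assms(2) finite_subset by (auto simp: upper_koszul_def)
    ultimately show ?thesis using B upper_koszul_insert(2)[OF assms(1)] by auto
  next
    case False
    then have "c A \<noteq> 0" using A by (auto simp: glue_def)
    then show ?thesis using assms(3) upper_koszul_insert(1)[OF assms(1) False] by (auto simp: chn_def)
  qed
qed

lemma chn_upper_koszul_vanish: "c \<in> chn (upper_koszul N W) i \<Longrightarrow> v \<notin> W \<Longrightarrow> v \<in> A \<Longrightarrow> c A = 0"
  by (auto simp: chn_def upper_koszul_def)

text \<open>Surjectivity in the long exact sequence of \<open>v\<close>: \<open>glue v x 0\<close>
  is a cycle on \<open>insert v W\<close>, and in a chain that bounds it the part through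
  \<open>v\<close> is the required cycle \<open>t\<close> of \<open>N\<close>.\<close>

lemma shift_cycle:
  assumes V: "finite V" "v \<in> V" and W: "finite W" "v \<notin> W"
    and ex: "exact_at TYPE('k::field) V (upper_koszul N (insert v W)) i"
    and x: "x \<in> chn (upper_koszul (shift v N) W) i" "bd V x = (0 :: nat set \<Rightarrow> 'k)"
  obtains s t where "s \<in> chn (upper_koszul (shift v N) W) (i + 1)" "t \<in> chn (upper_koszul N W) i" "bd V t = 0"
    "x = bd V s + t"
proof -
  have x0: "x A = 0" if "v \<in> A" for A using chn_upper_koszul_vanish[OF x(1) W(2) that] .
  have "bd V (glue v x 0) = glue v (bd V x + 0) (- bd V 0)"
    using V x0 by (intro bd_glue) auto
  then have "bd V (glue v x 0) = 0"
    using x(2) by (simp add: bd_0 glue_0_0)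
  moreover have "glue v x 0 \<in> chn (upper_koszul N (insert v W)) i"
    by (intro glue_chn W x chn_0)
  ultimately obtain w where w: "w \<in> chn (upper_koszul N (insert v W)) (i + 1)" "bd V w = glue v x 0"
    using ex unfolding exact_at_def by blast
  let ?s = "fst_part v w" and ?t = "snd_part v w"
  have "glue v (bd V ?s + ?t) (- bd V ?t) = glue v x 0"
    using bd_glue[of V v ?s ?t] V w(2) by (simp add: glue_parts fst_part_def snd_part_def)
  then have "bd V ?s + ?t = x" "- bd V ?t = 0"
    by (rule glue_eqD; use x0 in \<open>auto intro!: bd_vanish simp: fst_part_def snd_part_def\<close>)+
  moreover have "?s \<in> chn (upper_koszul (shift v N) W) (i + 1)" "?t \<in> chn (upper_koszul N W) i"
    using fst_part_chn[OF W(2) w(1)] snd_part_chn[OF W(2,1) w(1)] by simp_all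
  ultimately show thesis using that by (metis neg_equal_0_iff_equal)
qed

text \<open>The cycle \<open>t\<close> supplied by \<open>shift_cycle\<close> bounds already in
  \<open>N\<close>, and a filling in \<open>N\<close> is also one in
  \<open>shift v N\<close>.\<close>

lemma shift_exact:
  assumes V: "finite V" "v \<in> V" and W: "finite W" "v \<notin> W" and N: "up_closed N"
    and ex: "exact_at TYPE('k::field) V (upper_koszul N (insert v W)) i" "exact_at TYPE('k) V (upper_koszul N W) i"
  shows "exact_at TYPE('k) V (upper_koszul (shift v N) W) i"
  unfolding exact_at_def
proof (intro allI impI, elim conjE)
  fix x :: "nat set \<Rightarrow> 'k" assume x: "x \<in> chn (upper_koszul (shift v N) W) i" "bd V x = 0"
  obtain s t where st: "s \<in> chn (upper_koszul (shift v N) W) (i + 1)" "t \<in> chn (upper_koszul N W) i" "bd V t = 0"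
    "x = bd V s + t"
    using shift_cycle[OF V W ex(1) x] .
  then obtain y where y: "y \<in> chn (upper_koszul N W) (i + 1)" "bd V y = t"
    using ex(2) unfolding exact_at_def by blast
  have "y \<in> chn (upper_koszul (shift v N) W) (i + 1)"
    using chn_mono[OF y(1) upper_koszul_mono[OF subset_shift[OF N]]] .
  then show "\<exists>u \<in> chn (upper_koszul (shift v N) W) (i + 1). bd V u = x"
    using st y by (intro bexI[of _ "s + y"]) (auto simp: bd_add intro: chn_add)
qed

text \<open>For \<open>A\<close> without \<open>v'\<close> the condition is that the preimage of
  \<open>A\<close> under the identification of \<open>v'\<close> with \<open>v\<close> lies in
  \<open>N\<close>.\<close>

definition merge :: "nat \<Rightarrow> nat \<Rightarrow> nat set set \<Rightarrow> nat set set" where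
  "merge v v' N = {A. if v \<in> A then insert v' A \<in> N else A \<in> N}"

text \<open>For \<open>W = insert v W'\<close> the mapping cone now runs from \<open>N\<close> to
  the double shift of \<open>N\<close> on \<open>W'\<close>. The part of a cycle through
  \<open>v\<close> is bounded in \<open>N\<close>; what remains is a cycle of the double shift,
  which is moved back into \<open>N\<close> one shift at a time. It cannot simply be bounded there,
  since \<open>card W'\<close> may equal \<open>i + r\<close>.\<close>

lemma regular_merge:
  assumes U: "finite U" "v \<notin> U" "v' \<notin> U" "v \<noteq> v'" and N: "up_closed N"
    and reg: "regular TYPE('k::field) (insert v (insert v' U)) r N"
  shows "regular TYPE('k) (insert v U) r (merge v v' N)"
proof -
  define V where "V = insert v (insert v' U)"
  have V: "finite V" "v \<in> V" "v' \<in> V" using U by (auto simp: V_def)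
  have ex: "exact_at TYPE('k) V (upper_koszul N W) i" if "W \<subseteq> V" "int (card W) > i + r" for W i
    using regularD[OF reg] that V finite_subset[OF that(1)] by (simp add: V_def)
  show ?thesis
  proof (rule regularI[of _ V])
    fix W i assume W: "W \<subseteq> insert v U" "int (card W) > i + r"
    have finW: "finite W" using W U finite_subset[of W "insert v U"] by auto
    show "exact_at TYPE('k) V (upper_koszul (merge v v' N) W) i"
    proof (cases "v \<in> W")
      case False
      then have "upper_koszul (merge v v' N) W = upper_koszul N W" by (auto simp: upper_koszul_def merge_def)
      then show ?thesis using ex[of W i] W by (auto simp: V_def)
    next
      case True
      define W' where "W' = W - {v}"
      have W': "W = insert v W'" "v \<notin> W'" "v' \<notin> W'" "finite W'" "W' \<subseteq> V"
        using True W U finW by (auto simp: W'_def V_def)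
      have card: "int (card W) = int (card W') + 1" using W' by simp
      let ?N = "shift v' (shift v N)"
      have nf1: "upper_koszul (shift v (merge v v' N)) W' = upper_koszul ?N W'"
        by (simp add: upper_koszul_def shift_def merge_def insert_commute)
      have nf2: "upper_koszul (merge v v' N) W' = upper_koszul N W'"
        using W' by (auto simp: upper_koszul_def merge_def)
      have sub: "upper_koszul N W' \<subseteq> upper_koszul (shift v N) W'" "upper_koszul (shift v N) W' \<subseteq> upper_koszul ?N W'"
        using N by (intro upper_koszul_mono subset_shift up_closed_shift; simp)+
      have up1: "up_closed (shift v N)" using N by (rule up_closed_shift)
      show ?thesis
        unfolding exact_at_def
      proof (intro allI impI, elim conjE)
        fix c :: "nat set \<Rightarrow> 'k" assume c: "c \<in> chn (upper_koszul (merge v v' N) W) i" "bd V c = 0"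
        let ?c = "fst_part v c" and ?d = "snd_part v c"
        have c0: "?c \<in> chn (upper_koszul ?N W') i" and d0: "?d \<in> chn (upper_koszul N W') (i - 1)"
          using fst_part_chn[OF W'(2)] snd_part_chn[OF W'(2,4)] c(1) nf1 nf2 W'(1) by metis+
        have "glue v (bd V ?c + ?d) (- bd V ?d) = glue v 0 0"
          using bd_glue[of V v ?c ?d] V c(2) by (simp add: glue_parts glue_0_0 fst_part_def snd_part_def)
        then have 1: "bd V ?c + ?d = 0" "- bd V ?d = 0"
          by (rule glue_eqD; auto intro!: bd_vanish simp: fst_part_def snd_part_def)+
        \<comment> \<open>One vertex fewer and one degree less, so the regularity of
          \<open>N\<close> still applies.\<close>
        obtain u where u: "u \<in> chn (upper_koszul N W') i" "bd V u = ?d"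
          using ex[of W' "i - 1"] W W' card d0 1(2) unfolding exact_at_def by force
        have "exact_at TYPE('k) V (upper_koszul N (insert v W')) i"
          using ex[of "insert v W'" i] W W' card V by auto
        \<comment> \<open>\<open>insert v' W'\<close> has as many vertices as \<open>W\<close>, and
          adding \<open>v\<close> only increases the number, so both exactness assumptions of
          \<open>shift_exact\<close> are in range.\<close>
        moreover have "exact_at TYPE('k) V (upper_koszul (shift v N) (insert v' W')) i"
          using W W' V card U(4) by (intro shift_exact N ex) auto
        moreover have "bd V (?c + u) = 0" using 1 u by (simp add: bd_add)
        moreover have "?c + u \<in> chn (upper_koszul ?N W') i"
          using c0 chn_mono[OF u(1), of "upper_koszul ?N W'"] sub by (intro chn_add) auto
        ultimately obtain s t where st: "s \<in> chn (upper_koszul ?N W') (i + 1)"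
          "t \<in> chn (upper_koszul (shift v N) W') i" "bd V t = 0" "?c + u = bd V s + t"
          using shift_cycle[OF V(1,3) W'(4,3)] by metis
        obtain s' t' where st': "s' \<in> chn (upper_koszul (shift v N) W') (i + 1)"
          "t' \<in> chn (upper_koszul N W') i" "bd V t' = 0" "t = bd V s' + t'"
          using shift_cycle[OF V(1,2) W'(4,2) \<open>exact_at TYPE('k) V (upper_koszul N (insert v W')) i\<close> st(2,3)] .
        \<comment> \<open>In the first component \<open>t'\<close> supplies what the boundary of
          \<open>s + s'\<close> misses. Being a cycle it leaves the second component alone, where
          \<open>- u\<close> produces \<open>?d\<close>.\<close>
        let ?w = "glue v (s + s') (t' - u)"
        have ss: "s + s' \<in> chn (upper_koszul ?N W') (i + 1)"
          using st(1) chn_mono[OF st'(1) sub(2)] by (rule chn_add)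
        have tt: "t' - u \<in> chn (upper_koszul N W') i"
          using st'(2) u(1) by (rule chn_diff)
        have "bd V ?w = glue v (bd V (s + s') + (t' - u)) (- bd V (t' - u))"
          using chn_upper_koszul_vanish[OF ss W'(2)] chn_upper_koszul_vanish[OF tt W'(2)] by (intro bd_glue V)
        also have "bd V (s + s') + (t' - u) = ?c"
          using st(4) st'(4) by (simp add: bd_add algebra_simps)
        also have "- bd V (t' - u) = ?d"
          using u(2) st'(3) by (simp add: bd_diff)
        finally have "bd V ?w = c" unfolding glue_parts .
        moreover have "?w \<in> chn (upper_koszul (merge v v' N) W) (i + 1)"
          unfolding W'(1) using ss tt nf1 nf2 by (intro glue_chn W') auto
        ultimately show "\<exists>u \<in> chn (upper_koszul (merge v v' N) W) (i + 1). bd V u = c" by blast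
      qed
    qed
  qed (use U in \<open>auto simp: V_def\<close>)
qed

section \<open>Families on disjoint vertex sets\<close>

definition chn_scale :: "'k::field \<Rightarrow> (nat set \<Rightarrow> 'k) \<Rightarrow> nat set \<Rightarrow> 'k" where
  "chn_scale a c = (\<lambda>A. a * c A)"

interpretation chn_scale: vector_space "chn_scale :: 'k::field \<Rightarrow> _"
  by standard (auto simp: chn_scale_def fun_eq_iff algebra_simps)

interpretation chn_scale_pair: vector_space_pair "chn_scale :: 'k::field \<Rightarrow> _" "chn_scale :: 'k \<Rightarrow> _" ..

lemma bd_chn_scale: "bd V (chn_scale a c) = chn_scale a (bd V c)"
  by (simp add: bd_def chn_scale_def fun_eq_iff sum_distrib_left mult_ac)

lemma linear_bd: "Vector_Spaces.linear chn_scale chn_scale (bd V :: (nat set \<Rightarrow> 'k::field) \<Rightarrow> _)"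
  by unfold_locales (simp_all add: bd_add bd_chn_scale)

lemma subspace_chn: "chn_scale.subspace (chn Q i)"
  unfolding chn_scale.subspace_def by (auto simp: chn_0 chn_add) (auto simp: chn_def chn_scale_def)

lemma exact_atD:
  fixes K :: "'k::field itself" and c :: "nat set \<Rightarrow> 'k"
  assumes "exact_at K V Q i" "c \<in> chn Q i" "bd V c = 0"
  shows "\<exists>u \<in> chn Q (i + 1). bd V u = c"
  using assms by (simp add: exact_at_def)

text \<open>Over a field \<open>bd\<close> has a linear right inverse \<open>g\<close> on the
  boundaries of each degree. Subtracting from a chain \<open>g\<close> of its boundary leaves a
  cycle, and \<open>g\<close> of that cycle is the homotopy. The maps exist in all degrees; only the
  homotopy identity is confined to \<open>i < a\<close>.\<close>

lemma contracting_homotopy: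
  fixes K :: "'k::field itself"
  assumes "finite V" "W \<subseteq> V" "up_closed N" and ex: "\<And>i. i < a \<Longrightarrow> exact_at K V (upper_koszul N W) i"
  obtains h :: "int \<Rightarrow> (nat set \<Rightarrow> 'k) \<Rightarrow> nat set \<Rightarrow> 'k"
  where "\<And>i. Vector_Spaces.linear chn_scale chn_scale (h i)"
    and "\<And>i c. c \<in> chn (upper_koszul N W) i \<Longrightarrow> h i c \<in> chn (upper_koszul N W) (i + 1)"
    and "\<And>i c. i < a \<Longrightarrow> c \<in> chn (upper_koszul N W) i \<Longrightarrow> bd V (h i c) + h (i - 1) (bd V c) = c"
proof -
  have "\<exists>g. range g \<subseteq> chn (upper_koszul N W) (i + 1) \<and> Vector_Spaces.linear chn_scale chn_scale g \<and>
      (\<forall>c \<in> bd V ` chn (upper_koszul N W) (i + 1). bd V (g c) = (c :: nat set \<Rightarrow> 'k))" for i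
    using chn_scale_pair.linear_exists_right_inverse_on[OF linear_bd subspace_chn] .
  then obtain g :: "int \<Rightarrow> (nat set \<Rightarrow> 'k) \<Rightarrow> nat set \<Rightarrow> 'k" where
    g: "\<And>i. range (g i) \<subseteq> chn (upper_koszul N W) (i + 1)" "\<And>i. Vector_Spaces.linear chn_scale chn_scale (g i)"
      "\<And>i c. c \<in> bd V ` chn (upper_koszul N W) (i + 1) \<Longrightarrow> bd V (g i c) = c"
    by metis
  define h where "h = (\<lambda>i c. g i (c - g (i - 1) (bd V c)))"
  have finW: "finite W" using assms finite_subset by blast
  show thesis
  proof
    fix i
    have "Vector_Spaces.linear chn_scale chn_scale (\<lambda>c. g (i - 1) (bd V c))"
      using Vector_Spaces.linear_compose[OF linear_bd g(2)] by (simp add: comp_def)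
    then have "Vector_Spaces.linear chn_scale chn_scale (\<lambda>c. c - g (i - 1) (bd V c))"
      by (intro chn_scale_pair.linear_compose_sub chn_scale.linear_ident)
    then show "Vector_Spaces.linear chn_scale chn_scale (h i)"
      unfolding h_def using Vector_Spaces.linear_compose[OF _ g(2)[of i], of chn_scale "\<lambda>c. c - g (i - 1) (bd V c)"]
      by (simp add: comp_def)
  next
    fix i c show "h i c \<in> chn (upper_koszul N W) (i + 1)"
      using g(1)[of i] by (auto simp: h_def)
  next
    fix i and c :: "nat set \<Rightarrow> 'k" assume i: "i < a" and c: "c \<in> chn (upper_koszul N W) i"
    let ?d = "c - g (i - 1) (bd V c)"
    have "?d \<in> chn (upper_koszul N W) i"
      using c g(1)[of "i - 1"] by (intro chn_diff) auto
    moreover have "bd V (g (i - 1) (bd V c)) = bd V c"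
      using c by (intro g(3)) auto
    then have "bd V ?d = 0" by (simp add: bd_diff)
    ultimately have "?d \<in> bd V ` chn (upper_koszul N W) (i + 1)"
      using exact_atD[OF ex[OF i], of ?d] by (metis imageI)
    then have "bd V (h i c) = ?d" unfolding h_def by (rule g(3))
    \<comment> \<open>The correction inside \<open>h (i - 1)\<close> vanishes because
      \<open>bd V c\<close> is already a cycle.\<close>
    moreover have "h (i - 1) (bd V c) = g (i - 1) (bd V c)"
      using assms(1) by (simp add: h_def bd_bd chn_scale_pair.linear_0[OF g(2)])
    ultimately show "bd V (h i c) + h (i - 1) (bd V c) = c" by simp
  qed
qed

text \<open>The sign of the permutation that sorts \<open>A\<close> followed by \<open>B\<close>.\<close>
definition shuffle_sgn :: "nat set \<Rightarrow> nat set \<Rightarrow> 'k::field" where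
  "shuffle_sgn A B = (- 1) ^ card {(s, t). s \<in> A \<and> t \<in> B \<and> t < s}"

lemma shuffle_sgn_square [simp]: "shuffle_sgn A B * (shuffle_sgn A B * x) = (x :: 'k::field)"
  by (simp add: shuffle_sgn_def flip: mult.assoc power_mult_distrib)

lemma finite_inversions: "finite A \<Longrightarrow> finite B \<Longrightarrow> finite {(s, t). s \<in> A \<and> t \<in> B \<and> P s t}"
  by (rule finite_subset[of _ "A \<times> B"]) auto

lemma shuffle_sgn_insert_left:
  assumes "finite A" "finite B" "k \<notin> A"
  shows "shuffle_sgn (insert k A) B = shuffle_sgn A B * (sgn_ins k B :: 'k::field)"
proof -
  have "{(s, t). s \<in> insert k A \<and> t \<in> B \<and> t < s}
      = {(s, t). s \<in> A \<and> t \<in> B \<and> t < s} \<union> Pair k ` {t \<in> B. t < k}" by auto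
  moreover have "card \<dots> = card {(s, t). s \<in> A \<and> t \<in> B \<and> t < s} + card (Pair k ` {t \<in> B. t < k})"
    using assms finite_inversions[of A B] by (intro card_Un_disjoint) auto
  moreover have "card (Pair k ` {t \<in> B. t < k}) = card {t \<in> B. t < k}"
    by (rule card_image) (auto simp: inj_on_def)
  ultimately show ?thesis by (simp add: shuffle_sgn_def sgn_ins_def power_add)
qed

text \<open>The new inversions pair \<open>k\<close> with the elements of \<open>A\<close> above it.
  Counting those below instead costs \<open>(- 1) ^ card A\<close>, the sign in the second term of
  the Leibniz rule.\<close>

lemma shuffle_sgn_insert_right:
  assumes "finite A" "finite B" "k \<notin> A" "k \<notin> B"
  shows "shuffle_sgn A (insert k B) * (- 1) ^ card A = shuffle_sgn A B * (sgn_ins k A :: 'k::field)"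
proof -
  have "{(s, t). s \<in> A \<and> t \<in> insert k B \<and> t < s}
      = {(s, t). s \<in> A \<and> t \<in> B \<and> t < s} \<union> (\<lambda>s. (s, k)) ` {s \<in> A. k < s}" by auto
  moreover have "card \<dots> = card {(s, t). s \<in> A \<and> t \<in> B \<and> t < s} + card ((\<lambda>s. (s, k)) ` {s \<in> A. k < s})"
    using assms finite_inversions[of A B] by (intro card_Un_disjoint) auto
  moreover have "card ((\<lambda>s. (s, k)) ` {s \<in> A. k < s}) = card {s \<in> A. k < s}"
    by (rule card_image) (auto simp: inj_on_def)
  moreover have "card A = card {s \<in> A. s < k} + card {s \<in> A. k < s}"
  proof -
    have "A = {s \<in> A. s < k} \<union> {s \<in> A. k < s}"
    proof (intro equalityI subsetI)
      fix s assume "s \<in> A"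
      moreover from this assms(3) have "s < k \<or> k < s" by (metis nat_neq_iff)
      ultimately show "s \<in> {s \<in> A. s < k} \<union> {s \<in> A. k < s}" by blast
    qed blast
    moreover have "card ({s \<in> A. s < k} \<union> {s \<in> A. k < s}) = card {s \<in> A. s < k} + card {s \<in> A. k < s}"
      using assms(1) by (intro card_Un_disjoint) auto
    ultimately show ?thesis by simp
  qed
  moreover have "(- 1) ^ n * ((- 1) ^ n * x) = x" for n and x :: 'k
    by (simp flip: mult.assoc power_mult_distrib)
  ultimately show ?thesis
    by (simp add: shuffle_sgn_def sgn_ins_def power_add mult.assoc mult.left_commute[of _ "(- 1) ^ card {s \<in> A. s < k}"])
qed

lemma sgn_ins_Un:
  assumes "A \<inter> B = {}"
  shows "sgn_ins k (A \<union> B) = sgn_ins k A * (sgn_ins k B :: 'k::field)"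
proof -
  have "{l \<in> A \<union> B. l < k} = {l \<in> A. l < k} \<union> {l \<in> B. l < k}" by auto
  moreover have "card \<dots> = card {l \<in> A. l < k} + card {l \<in> B. l < k}"
    using assms by (intro card_Un_disjoint) auto
  ultimately show ?thesis by (simp add: sgn_ins_def power_add)
qed

text \<open>With chains on a disjoint union viewed as a tensor product, this is the coefficient of
  the basis element \<open>B\<close> of the second factor.\<close>

definition slice :: "nat set \<Rightarrow> nat set \<Rightarrow> (nat set \<Rightarrow> 'k::field) \<Rightarrow> nat set \<Rightarrow> 'k" where
  "slice P B z A = (if A \<subseteq> P then shuffle_sgn A B * z (A \<union> B) else 0)"

text \<open>The exponent has to be an integer: \<open>i - 1 - int (card B)\<close> is negative when
  \<open>B\<close> is too large for degree \<open>i\<close>.\<close>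

definition parity :: "int \<Rightarrow> 'k::field" where
  "parity j = (if even j then 1 else - 1)"

text \<open>The Leibniz rule of a tensor product, read off at \<open>B\<close>. Its sign is governed
  by \<open>card A\<close>, which is \<open>i - 1 - card B\<close> wherever the second term is
  nonzero.\<close>

lemma slice_bd:
  fixes z :: "nat set \<Rightarrow> 'k::field"
  assumes P: "finite P" "finite P'" "P \<inter> P' = {}" and B: "B \<subseteq> P'" and z: "z \<in> chn Q i"
  shows "slice P B (bd (P \<union> P') z) = bd P (slice P B z)
    + chn_scale (parity (i - 1 - int (card B))) (\<Sum>k \<in> P' - B. chn_scale (sgn_ins k B) (slice P (insert k B) z))"
proof
  fix A
  let ?R = "bd P (slice P B z)
    + chn_scale (parity (i - 1 - int (card B))) (\<Sum>k \<in> P' - B. chn_scale (sgn_ins k B) (slice P (insert k B) z))"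
  have sum_app: "(\<Sum>k \<in> S. f k) A = (\<Sum>k \<in> S. f k A)" for S and f :: "nat \<Rightarrow> nat set \<Rightarrow> 'k"
    by (induction S rule: infinite_finite_induct) auto
  have finB: "finite B" using B P finite_subset by blast
  show "slice P B (bd (P \<union> P') z) A = ?R A"
  proof (cases "A \<subseteq> P")
    case False
    then show ?thesis by (simp add: slice_def bd_def chn_scale_def sum_app)
  next
    case True
    then have A: "finite A" "A \<inter> B = {}" using B P finite_subset by blast+
    have "slice P B (bd (P \<union> P') z) A
        = (\<Sum>k \<in> P \<union> P' - (A \<union> B). shuffle_sgn A B * (sgn_ins k (A \<union> B) * z (insert k (A \<union> B))))"
      using True by (simp add: slice_def bd_def sum_distrib_left)
    also have "P \<union> P' - (A \<union> B) = (P - A) \<union> (P' - B)"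
      using True B P by auto
    also have "(\<Sum>k \<in> (P - A) \<union> (P' - B). shuffle_sgn A B * (sgn_ins k (A \<union> B) * z (insert k (A \<union> B))))
        = (\<Sum>k \<in> P - A. shuffle_sgn A B * (sgn_ins k (A \<union> B) * z (insert k (A \<union> B))))
        + (\<Sum>k \<in> P' - B. shuffle_sgn A B * (sgn_ins k (A \<union> B) * z (insert k (A \<union> B))))"
      using P by (intro sum.union_disjoint) auto
    also have "(\<Sum>k \<in> P - A. shuffle_sgn A B * (sgn_ins k (A \<union> B) * z (insert k (A \<union> B))))
        = bd P (slice P B z) A"
      unfolding bd_def
    proof (intro sum.cong refl)
      fix k assume k: "k \<in> P - A"
      show "shuffle_sgn A B * (sgn_ins k (A \<union> B) * z (insert k (A \<union> B))) = sgn_ins k A * slice P B z (insert k A)"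
        using k True A finB shuffle_sgn_insert_left[of A B k, where 'k = 'k]
        by (simp add: slice_def sgn_ins_Un mult_ac)
    qed
    also have "(\<Sum>k \<in> P' - B. shuffle_sgn A B * (sgn_ins k (A \<union> B) * z (insert k (A \<union> B))))
       = (\<Sum>k \<in> P' - B. parity (i - 1 - int (card B)) * (sgn_ins k B * slice P (insert k B) z A))"
    proof (intro sum.cong refl)
      fix k assume k: "k \<in> P' - B"
      then have kA: "k \<notin> A" "k \<notin> B" using True P by auto
      show "shuffle_sgn A B * (sgn_ins k (A \<union> B) * z (insert k (A \<union> B)))
          = parity (i - 1 - int (card B)) * (sgn_ins k B * slice P (insert k B) z A)"
      \<comment> \<open>Only a nonzero coefficient ties the size of \<open>A\<close> to the degree
        of \<open>z\<close>.\<close>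
      proof (cases "z (insert k (A \<union> B)) = 0")
        case False
        then have "int (card (insert k (A \<union> B))) = i" using z by (auto simp: chn_def)
        moreover have "card (insert k (A \<union> B)) = Suc (card A + card B)"
          using A finB kA by (simp add: card_Un_disjoint)
        ultimately have "parity (i - 1 - int (card B)) = ((- 1) ^ card A :: 'k)"
          by (auto simp: parity_def uminus_power_if)
        moreover have "(- 1) ^ card A * shuffle_sgn A (insert k B) = shuffle_sgn A B * (sgn_ins k A :: 'k)"
          using shuffle_sgn_insert_right[OF A(1) finB kA, where 'k = 'k] by (simp add: mult.commute)
        ultimately show ?thesis
          using True A by (simp add: slice_def sgn_ins_Un mult_ac)
      qed (simp add: slice_def)
    qed
    finally show ?thesis by (simp add: chn_scale_def sum_app sum_distrib_left)
  qed
qed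

definition joint :: "nat set \<Rightarrow> nat set \<Rightarrow> nat set set \<Rightarrow> nat set set \<Rightarrow> nat set set" where
  "joint P P' N N' = {A. A \<inter> P \<in> N \<and> A \<inter> P' \<in> N'}"

text \<open>The complex is the join of the complexes of \<open>N\<close> and \<open>N'\<close>, so
  its chains form a tensor product.\<close>

lemma upper_koszul_joint:
  assumes "P \<inter> P' = {}" "W \<subseteq> P" "W' \<subseteq> P'"
  shows "upper_koszul (joint P P' N N') (W \<union> W') = {A. A \<subseteq> P \<union> P' \<and> A \<inter> P \<in> upper_koszul N W \<and> A \<inter> P' \<in> upper_koszul N' W'}"
proof -
  have "(W \<union> W' - A) \<inter> P = W - A \<inter> P" "(W \<union> W' - A) \<inter> P' = W' - A \<inter> P'" for A
    using assms by auto
  moreover have "A \<subseteq> W \<union> W' \<longleftrightarrow> A \<subseteq> P \<union> P' \<and> A \<inter> P \<subseteq> W \<and> A \<inter> P' \<subseteq> W'" for A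
    using assms by auto
  ultimately show ?thesis unfolding upper_koszul_def joint_def by auto
qed

text \<open>Apply a contracting homotopy to the first tensor factor. Subtracting the boundary of the
  result kills every slice whose degree in that factor is below \<open>a\<close>. That no new slices
  appear is recorded as well: it lets the bound survive a second application to the other
  factor.\<close>

lemma homologous_slice_degree:
  fixes z :: "nat set \<Rightarrow> 'k::field"
  assumes P: "finite P" "finite P'" "P \<inter> P' = {}" and W: "W \<subseteq> P" "W' \<subseteq> P'" and N: "up_closed N"
    and ex: "\<And>i. i < a \<Longrightarrow> exact_at TYPE('k) P (upper_koszul N W) i"
    and z: "z \<in> chn (upper_koszul (joint P P' N N') (W \<union> W')) i" "bd (P \<union> P') z = 0"
  obtains u where "u \<in> chn (upper_koszul (joint P P' N N') (W \<union> W')) (i + 1)"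
    "\<And>A. (z - bd (P \<union> P') u) A \<noteq> 0 \<Longrightarrow> i - int (card (A \<inter> P')) \<ge> a \<and> slice P (A \<inter> P') z \<noteq> 0"
proof -
  let ?Q = "upper_koszul (joint P P' N N') (W \<union> W')"
  note Q = upper_koszul_joint[OF P(3) W, of N N']
  obtain h :: "int \<Rightarrow> (nat set \<Rightarrow> 'k) \<Rightarrow> nat set \<Rightarrow> 'k" where
    lin: "\<And>i. Vector_Spaces.linear chn_scale chn_scale (h i)"
    and h: "\<And>i c. c \<in> chn (upper_koszul N W) i \<Longrightarrow> h i c \<in> chn (upper_koszul N W) (i + 1)"
    and hom: "\<And>i c. i < a \<Longrightarrow> c \<in> chn (upper_koszul N W) i \<Longrightarrow> bd P (h i c) + h (i - 1) (bd P c) = c"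
    using contracting_homotopy[OF P(1) W(1) N ex] by blast
  note h_0 = chn_scale_pair.linear_0[OF lin] and h_add = chn_scale_pair.linear_add[OF lin]
    and h_scale = chn_scale_pair.linear_scale[OF lin] and h_sum = chn_scale_pair.linear_sum[OF lin]
  define s where "s B = slice P B z" for B
  define d where "d B = i - int (card B)" for B :: "nat set"
  have split: "A \<inter> P \<union> A \<inter> P' = A" "finite (A \<inter> P)" "finite (A \<inter> P')"
      "card A = card (A \<inter> P) + card (A \<inter> P')" if "A \<subseteq> P \<union> P'" for A
  proof -
    show 1: "A \<inter> P \<union> A \<inter> P' = A" "finite (A \<inter> P)" "finite (A \<inter> P')" using that P by auto
    have "A \<inter> P \<inter> (A \<inter> P') = {}" using P by auto
    then show "card A = card (A \<inter> P) + card (A \<inter> P')"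
      using card_Un_disjoint[OF 1(2,3)] 1(1) by simp
  qed
  have join: "(A \<union> B) \<inter> P = A" "(A \<union> B) \<inter> P' = B" if "A \<subseteq> P" "B \<subseteq> P'" for A B
    using that P by auto
  have s_chn: "s B \<in> chn (upper_koszul N W) (d B)" and s_upper_koszul: "s B \<noteq> 0 \<Longrightarrow> B \<in> upper_koszul N' W'" if B: "B \<subseteq> P'" for B
  proof -
    have *: "A \<in> upper_koszul N W \<and> int (card A) = d B \<and> B \<in> upper_koszul N' W'" if "s B A \<noteq> 0" for A
    proof -
      have A: "A \<subseteq> P" "z (A \<union> B) \<noteq> 0" using that by (auto simp: s_def slice_def split: if_splits)
      then have "A \<union> B \<in> ?Q" "int (card (A \<union> B)) = i"
        using z(1) unfolding chn_def by blast+
      moreover have "A \<union> B \<subseteq> P \<union> P'" using A(1) B by blast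
      ultimately show ?thesis using split(4)[of "A \<union> B"] unfolding Q join[OF A(1) B] by (simp add: d_def join[OF A(1) B])
    qed
    then show "s B \<in> chn (upper_koszul N W) (d B)" by (auto simp: chn_def)
    show "s B \<noteq> 0 \<Longrightarrow> B \<in> upper_koszul N' W'" using * by (auto simp: fun_eq_iff)
  qed
  \<comment> \<open>The homotopy tensored with the identity, applied to \<open>z\<close> and
    reassembled from its slices.\<close>
  define u where "u A = (if A \<subseteq> P \<union> P' then shuffle_sgn (A \<inter> P) (A \<inter> P') * h (d (A \<inter> P')) (s (A \<inter> P')) (A \<inter> P) else 0)" for A
  have u: "u \<in> chn ?Q (i + 1)"
    unfolding chn_def
  proof (intro CollectI allI impI)
    fix A assume "u A \<noteq> 0"
    then have A: "A \<subseteq> P \<union> P'" "h (d (A \<inter> P')) (s (A \<inter> P')) (A \<inter> P) \<noteq> 0"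
      by (auto simp: u_def split: if_splits)
    have "s (A \<inter> P') \<noteq> 0"
    proof
      assume "s (A \<inter> P') = 0"
      then show False using A(2) by (simp add: h_0)
    qed
    then have "A \<inter> P' \<in> upper_koszul N' W'" using s_upper_koszul by auto
    moreover have "A \<inter> P \<in> upper_koszul N W \<and> int (card (A \<inter> P)) = d (A \<inter> P') + 1"
      using h[OF s_chn, of "A \<inter> P'"] A(2) by (auto simp: chn_def)
    ultimately show "A \<in> ?Q \<and> int (card A) = i + 1"
      using A(1) split(4)[OF A(1)] by (simp add: Q d_def)
  qed
  have slice_u: "slice P B u = h (d B) (s B)" if B: "B \<subseteq> P'" for B
  proof
    fix A
    show "slice P B u A = h (d B) (s B) A"
    proof (cases "A \<subseteq> P")
      case True
      then show ?thesis using B join[OF True B] by (auto simp: slice_def u_def)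
    next
      case False
      then show ?thesis using h[OF s_chn[OF B]] W(1) by (auto simp: slice_def chn_def upper_koszul_def)
    qed
  qed
  have slice_diff: "slice P B (f - g) = slice P B f - slice P B g" for B and f g :: "nat set \<Rightarrow> 'k"
    by (auto simp: slice_def fun_eq_iff algebra_simps)
  have key: "slice P B (z - bd (P \<union> P') u) = s B - bd P (h (d B) (s B)) - h (d B - 1) (bd P (s B))"
    if B: "B \<subseteq> P'" for B
  proof -
    let ?S = "\<lambda>f. \<Sum>k \<in> P' - B. chn_scale (sgn_ins k B) (f (insert k B))"
    have "d (insert k B) = d B - 1" if "k \<in> P' - B" for k
      using that B P finite_subset[OF B] by (simp add: d_def)
    then have S: "?S (\<lambda>B. slice P B u) = ?S (\<lambda>C. h (d B - 1) (s C))"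
      using B by (intro sum.cong refl) (simp add: slice_u)
    \<comment> \<open>\<open>u\<close> has degree one more than \<open>z\<close>, so its Leibniz
      sign is opposite. This trades the second-factor terms of \<open>bd u\<close> for
      \<open>h\<close> applied to \<open>bd P (s B)\<close>, because \<open>z\<close> is a
      cycle.\<close>
    have par: "parity (d B) = - (parity (d B - 1) :: 'k)" by (simp add: parity_def)
    have "slice P B (bd (P \<union> P') u) = bd P (h (d B) (s B)) + chn_scale (parity (d B)) (?S (\<lambda>C. h (d B - 1) (s C)))"
      using slice_bd[OF P B u] S by (simp add: slice_u[OF B] d_def)
    moreover have "slice P B 0 = 0" by (simp add: slice_def fun_eq_iff)
    then have "slice P B (bd (P \<union> P') z) = 0" using z(2) by simp
    then have "bd P (s B) + chn_scale (parity (d B - 1)) (?S s) = 0"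
      unfolding slice_bd[OF P B z(1)] s_def d_def by (simp add: diff_diff_eq add.commute)
    then have "h (d B - 1) (bd P (s B) + chn_scale (parity (d B - 1)) (?S s)) = 0"
      by (simp only: h_0)
    then have "h (d B - 1) (bd P (s B)) + chn_scale (parity (d B - 1)) (?S (\<lambda>C. h (d B - 1) (s C))) = 0"
      by (simp only: h_add h_scale h_sum)
    ultimately show ?thesis
      unfolding slice_diff s_def[symmetric] par chn_scale.scale_minus_left by (simp add: add_eq_0_iff2)
  qed
  show thesis
  proof (rule that[OF u])
    fix A assume A: "(z - bd (P \<union> P') u) A \<noteq> 0"
    have sub: "A \<subseteq> P \<union> P'"
    proof (rule ccontr)
      assume "\<not> A \<subseteq> P \<union> P'"
      then have "c A = 0" "bd (P \<union> P') c A = 0" if "c \<in> chn ?Q j" for c :: "nat set \<Rightarrow> 'k" and j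
        using that W by (auto simp: chn_def upper_koszul_def bd_def intro!: sum.neutral) blast+
      then show False using A z(1) u by auto
    qed
    let ?B = "A \<inter> P'"
    have "slice P ?B (z - bd (P \<union> P') u) (A \<inter> P) = shuffle_sgn (A \<inter> P) ?B * (z - bd (P \<union> P') u) A"
      using split(1)[OF sub] by (simp add: slice_def)
    then have ne: "slice P ?B (z - bd (P \<union> P') u) \<noteq> 0"
      using A by (auto simp: shuffle_sgn_def dest: fun_cong[of _ _ "A \<inter> P"])
    then have 1: "s ?B - bd P (h (d ?B) (s ?B)) - h (d ?B - 1) (bd P (s ?B)) \<noteq> 0"
      using key[of ?B] by simp
    have "s ?B \<noteq> 0"
    proof
      assume "s ?B = 0"
      then show False using 1 by (simp add: bd_0 h_0)
    qed
    moreover have "\<not> d ?B < a"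
    proof
      assume "d ?B < a"
      from hom[OF this s_chn[OF inf_le2]] show False using 1 by (simp add: diff_diff_eq)
    qed
    ultimately show "i - int (card ?B) \<ge> a \<and> slice P ?B z \<noteq> 0"
      by (simp add: d_def s_def)
  qed
qed

text \<open>Two passes with the roles of the factors exchanged: whatever survives would have degree
  at least \<open>a\<close> in the first factor and at least \<open>b\<close> in the second, which
  is impossible in total degree below \<open>a + b\<close>.\<close>

lemma exact_at_joint:
  assumes P: "finite P" "finite P'" "P \<inter> P' = {}" and W: "W \<subseteq> P" "W' \<subseteq> P'" and N: "up_closed N" "up_closed N'"
    and ex: "\<And>i. i < a \<Longrightarrow> exact_at TYPE('k::field) P (upper_koszul N W) i" "\<And>i. i < b \<Longrightarrow> exact_at TYPE('k) P' (upper_koszul N' W') i"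
    and i: "i < a + b"
  shows "exact_at TYPE('k) (P \<union> P') (upper_koszul (joint P P' N N') (W \<union> W')) i"
  unfolding exact_at_def
proof (intro allI impI, elim conjE)
  let ?Q = "upper_koszul (joint P P' N N') (W \<union> W')"
  have swap: "joint P P' N N' = joint P' P N' N" by (auto simp: joint_def)
  have finQ: "finite A" "A \<subseteq> P \<union> P'" if "A \<in> ?Q" for A
    using that P W finite_subset[of A "P \<union> P'"] by (auto simp: upper_koszul_def)
  have up_closed: "up_closed (joint P P' N N')"
    unfolding up_closed_def joint_def
  proof (intro allI impI, elim CollectE conjE, intro CollectI conjI)
    fix A B :: "nat set" assume "A \<subseteq> B" "A \<inter> P \<in> N" "A \<inter> P' \<in> N'"
    moreover from this have "A \<inter> P \<subseteq> B \<inter> P" "A \<inter> P' \<subseteq> B \<inter> P'" by auto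
    ultimately show "B \<inter> P \<in> N" "B \<inter> P' \<in> N'" using N unfolding up_closed_def by blast+
  qed
  fix z :: "nat set \<Rightarrow> 'k" assume z: "z \<in> chn ?Q i" "bd (P \<union> P') z = 0"
  obtain u where u: "u \<in> chn ?Q (i + 1)"
    "\<And>A. (z - bd (P \<union> P') u) A \<noteq> 0 \<Longrightarrow> i - int (card (A \<inter> P')) \<ge> a \<and> slice P (A \<inter> P') z \<noteq> 0"
    using homologous_slice_degree[OF P W N(1) ex(1) z] by blast
  let ?y = "z - bd (P \<union> P') u"
  have fin: "finite (W \<union> W')" using W P finite_subset by auto
  have "bd (P \<union> P') u \<in> chn ?Q (i + 1 - 1)"
    using chn_upper_koszul_bd[OF u(1) up_closed fin] .
  then have "bd (P \<union> P') u \<in> chn ?Q i" by simp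
  then have y: "?y \<in> chn ?Q i" using z(1) by (rule chn_diff[rotated])
  have y0: "bd (P \<union> P') ?y = 0"
    using z(2) P by (simp add: bd_diff bd_bd)
  have eqs: "P' \<inter> P = {}" "upper_koszul (joint P' P N' N) (W' \<union> W) = ?Q" "P' \<union> P = P \<union> P'"
    using P(3) swap by (auto simp: Un_commute)
  have y': "?y \<in> chn (upper_koszul (joint P' P N' N) (W' \<union> W)) i" "bd (P' \<union> P) ?y = 0"
    unfolding eqs(2,3) by (rule y, rule y0)
  obtain u' where u': "u' \<in> chn ?Q (i + 1)"
    "\<And>A. (?y - bd (P \<union> P') u') A \<noteq> 0 \<Longrightarrow> i - int (card (A \<inter> P)) \<ge> b \<and> slice P' (A \<inter> P) ?y \<noteq> 0"
    using homologous_slice_degree[OF P(2,1) eqs(1) W(2,1) N(2) ex(2) y'] unfolding eqs(2,3) by blast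
  have "?y - bd (P \<union> P') u' = 0"
  proof (rule ext, rule ccontr)
    fix A assume "(?y - bd (P \<union> P') u') A \<noteq> 0 A"
    then have 1: "i - int (card (A \<inter> P)) \<ge> b" "slice P' (A \<inter> P) ?y \<noteq> 0"
      using u'(2)[of A] by simp_all
    \<comment> \<open>The nonzero slice gives a set in the support of \<open>?y\<close> with the
      same trace on \<open>P\<close> as \<open>A\<close>, and the bound of the first pass applies to
      that set.\<close>
    then obtain B where "slice P' (A \<inter> P) ?y B \<noteq> 0" by (auto simp only: fun_eq_iff zero_fun_apply)
    then have B: "B \<subseteq> P'" "?y (B \<union> A \<inter> P) \<noteq> 0"
      unfolding slice_def by (metis, metis mult_zero_right)
    have *: "i - int (card ((B \<union> A \<inter> P) \<inter> P')) \<ge> a"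
      using u(2)[OF B(2)] by blast
    have "(B \<union> A \<inter> P) \<inter> P' = B" using B(1) P(3) by auto
    moreover have "int (card (B \<union> A \<inter> P)) = i"
      using y B(2) unfolding chn_def by blast
    moreover have "card (B \<union> A \<inter> P) = card B + card (A \<inter> P)"
      using B(1) P finite_subset[OF B(1)] by (intro card_Un_disjoint) auto
    ultimately show False using * 1(1) i by simp
  qed
  then have "bd (P \<union> P') (u + u') = z" by (simp add: bd_add algebra_simps)
  then show "\<exists>u \<in> chn ?Q (i + 1). bd (P \<union> P') u = z"
    using chn_add[OF u(1) u'(1)] by blast
qed

text \<open>The thresholds \<open>card W1 - r\<close> and \<open>card W2 - r'\<close> add up to
  \<open>card W - (r + r')\<close>.\<close>

lemma regular_joint:
  assumes P: "finite P" "finite P'" "P \<inter> P' = {}" and N: "up_closed N" "up_closed N'"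
    and reg: "regular TYPE('k::field) P r N" "regular TYPE('k) P' r' N'"
  shows "regular TYPE('k) (P \<union> P') (r + r') (joint P P' N N')"
proof (rule regularI[of _ "P \<union> P'"])
  fix W i assume W: "W \<subseteq> P \<union> P'" "int (card W) > i + (r + r')"
  define W1 where "W1 = W \<inter> P"
  define W2 where "W2 = W \<inter> P'"
  have W12: "W = W1 \<union> W2" "W1 \<subseteq> P" "W2 \<subseteq> P'" "finite W1" "finite W2" "W1 \<inter> W2 = {}"
    using W P by (auto simp: W1_def W2_def)
  have "card W = card W1 + card W2"
    using W12 card_Un_disjoint by metis
  then have i: "i < (int (card W1) - r) + (int (card W2) - r')" using W(2) by simp
  show "exact_at TYPE('k) (P \<union> P') (upper_koszul (joint P P' N N') W) i"
    unfolding W12(1)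
  proof (rule exact_at_joint[OF P W12(2,3) N _ _ i])
    fix j assume "j < int (card W1) - r"
    then show "exact_at TYPE('k) P (upper_koszul N W1) j"
      using regularD[OF reg(1) P(1) W12(4,2,2)] by simp
  next
    fix j assume "j < int (card W2) - r'"
    then show "exact_at TYPE('k) P' (upper_koszul N' W2) j"
      using regularD[OF reg(2) P(2) W12(5,3,3)] by simp
  qed
qed (use P in auto)

section \<open>Intersections and unions of families\<close>

lemma regular_cong:
  assumes "\<And>A. A \<subseteq> V \<Longrightarrow> A \<in> N \<longleftrightarrow> A \<in> N'"
  shows "regular TYPE('k::field) V r N \<longleftrightarrow> regular TYPE('k) V r N'"
proof -
  have "upper_koszul N W = upper_koszul N' W" if "W \<subseteq> V" for W
    using assms that unfolding upper_koszul_def by blast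
  then show ?thesis unfolding regular_def by metis
qed

lemma sgn_ins_image:
  assumes "inj f" "\<And>x y. f x < f y \<longleftrightarrow> x < (y::nat)"
  shows "sgn_ins (f k) (f ` A) = (sgn_ins k A :: 'k::field)"
proof -
  have "{l \<in> f ` A. l < f k} = f ` {l \<in> A. l < k}" using assms(2) by auto
  then show ?thesis
    using assms(1) by (simp add: sgn_ins_def card_image inj_on_def inj_def)
qed

lemma bd_image:
  assumes f: "inj f" "\<And>x y. f x < f y \<longleftrightarrow> x < (y::nat)"
  shows "bd (f ` V) c (f ` A) = bd V (\<lambda>A. c (f ` A)) A"
proof -
  have "f ` V - f ` A = f ` (V - A)" using f(1) by (simp add: image_set_diff)
  then show ?thesis
    using f by (simp add: bd_def sum.reindex inj_on_def inj_def sgn_ins_image)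
qed

text \<open>Signs depend on the order of the vertices, so the renaming is taken to be order
  preserving and leaves every sign unchanged.\<close>

lemma regular_image:
  assumes f: "inj f" "\<And>x y. f x < f y \<longleftrightarrow> x < (y::nat)"
    and reg: "regular TYPE('k::field) V r {A. f ` A \<in> N}" and V: "finite V"
  shows "regular TYPE('k) (f ` V) r N"
  unfolding regular_def
proof (intro allI impI)
  fix W' i assume W': "W' \<subseteq> f ` V" "int (card W') > i + r"
  then obtain W where W: "W' = f ` W" "W \<subseteq> V" by (metis subset_imageE)
  have inv: "f -` (f ` A) = A" for A using f(1) by (simp add: inj_vimage_image_eq)
  have card: "card (f ` A) = card A" for A using f(1) by (simp add: card_image inj_on_def inj_def)
  have upper_koszul: "f ` A \<in> upper_koszul N (f ` W) \<longleftrightarrow> A \<in> upper_koszul {A. f ` A \<in> N} W" for A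
    using f(1) by (simp add: upper_koszul_def image_set_diff inj_image_subset_iff)
  have ex: "exact_at TYPE('k) W (upper_koszul {A. f ` A \<in> N} W) i"
    using reg W W'(2) card by (simp add: regular_def)
  show "exact_at TYPE('k) W' (upper_koszul N W') i"
    unfolding exact_at_def
  proof (intro allI impI, elim conjE)
    fix c :: "nat set \<Rightarrow> 'k" assume c: "c \<in> chn (upper_koszul N W') i" "bd W' c = 0"
    let ?c = "\<lambda>A. c (f ` A)"
    have "?c \<in> chn (upper_koszul {A. f ` A \<in> N} W) i"
      unfolding chn_def
    proof (intro CollectI allI impI)
      fix A assume "c (f ` A) \<noteq> 0"
      then have "f ` A \<in> upper_koszul N (f ` W)" "int (card (f ` A)) = i"
        using c(1) unfolding chn_def W(1) by blast+
      then show "A \<in> upper_koszul {A. f ` A \<in> N} W \<and> int (card A) = i"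
        by (simp add: upper_koszul card)
    qed
    moreover have "bd W ?c = 0"
    proof
      fix A show "bd W ?c A = 0 A"
        unfolding bd_image[OF f, symmetric] W(1)[symmetric] c(2) by simp
    qed
    ultimately obtain u where u: "u \<in> chn (upper_koszul {A. f ` A \<in> N} W) (i + 1)" "bd W u = ?c"
      using ex unfolding exact_at_def by blast
    \<comment> \<open>Without the guard, sets that differ only outside \<open>range f\<close> would
      have the same preimage and share a nonzero value.\<close>
    let ?u = "\<lambda>B. if B \<subseteq> range f then u (f -` B) else 0"
    have fu: "(\<lambda>A. ?u (f ` A)) = u" by (rule ext) (simp add: inv image_mono)
    have "?u \<in> chn (upper_koszul N W') (i + 1)"
      unfolding chn_def
    proof (intro CollectI allI impI)
      fix B assume "?u B \<noteq> 0"
      then have B: "B \<subseteq> range f" "u (f -` B) \<noteq> 0" by (auto split: if_splits)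
      from B(1) obtain A where A: "B = f ` A" by (metis subset_imageE)
      show "B \<in> upper_koszul N W' \<and> int (card B) = i + 1"
        using B(2) u(1) unfolding A inv W(1) upper_koszul card chn_def by simp
    qed
    moreover have "bd W' ?u = c"
    proof
      fix B show "bd W' ?u B = c B"
      proof (cases "B \<subseteq> W'")
        case True
        then obtain A where A: "B = f ` A" "A \<subseteq> W" unfolding W(1) by (metis subset_imageE)
        show ?thesis unfolding A W(1) bd_image[OF f] fu using u(2) by simp
      next
        case False
        then have "c B = 0" using c(1) by (auto simp: chn_def upper_koszul_def)
        moreover have "?u (insert k B) = 0" for k
        proof (rule ccontr)
          assume "?u (insert k B) \<noteq> 0"
          then have "insert k B \<subseteq> W'" using \<open>?u \<in> chn (upper_koszul N W') (i + 1)\<close> unfolding chn_def upper_koszul_def by blast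
          then show False using False by blast
        qed
        ultimately show ?thesis by (simp add: bd_def)
      qed
    qed
    ultimately show "\<exists>u \<in> chn (upper_koszul N W') (i + 1). bd W' u = c" by blast
  qed
qed

theorem regular_Int:
  assumes n: "finite V" and N: "up_closed N" "up_closed N'" and reg: "regular TYPE('k) V r N" "regular TYPE('k) V r' N'"
  shows "regular TYPE('k::field) V (r + r') (N \<inter> N')"
proof -
  obtain m where m: "V \<subseteq> {..<m}" using n finite_nat_iff_bounded by blast
  \<comment> \<open>Translation past a bound of \<open>V\<close> produces a disjoint copy and
    preserves the order, hence the signs.\<close>
  define f where "f x = x + m" for x
  have f: "inj f" "\<And>x y. f x < f y \<longleftrightarrow> x < y" by (auto simp: f_def inj_def)
  have inv: "f -` (f ` A) = A" for A using f(1) by (simp add: inj_vimage_image_eq)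
  have disj: "V \<inter> f ` U = {}" for U using m by (auto simp: f_def)
  have fV: "f x \<notin> V" for x using m by (auto simp: f_def)
  define N2 where "N2 = {B. f -` B \<in> N'}"
  have up_closed_N2: "up_closed N2" using N(2) unfolding up_closed_def N2_def by (metis mem_Collect_eq vimage_mono)
  have "regular TYPE('k) (f ` V) r' N2"
    using n reg(2) by (intro regular_image f) (auto simp: N2_def inv)
  then have base: "regular TYPE('k) (V \<union> f ` V) (r + r') (joint V (f ` V) N N2)"
    using n N up_closed_N2 disj reg by (intro regular_joint) auto
  \<comment> \<open>The family after the pairs in \<open>T\<close> have been merged: the condition
    for \<open>N'\<close> reads a vertex in \<open>T\<close> off \<open>A\<close> directly and any
    other one off its copy. \<open>Z {}\<close> is the joint family, and on subsets of
    \<open>V\<close> the family \<open>Z V\<close> is \<open>N \<inter> N'\<close>.\<close>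
  define Z where "Z T = {A. A \<inter> V \<in> N \<and> {x \<in> V. if x \<in> T then x \<in> A else f x \<in> A} \<in> N'}" for T
  have up_closed_Z: "up_closed (Z T)" for T
    unfolding up_closed_def
  proof (intro allI impI)
    fix A B assume A: "A \<in> Z T" and AB: "A \<subseteq> B"
    have "A \<inter> V \<subseteq> B \<inter> V" using AB by blast
    moreover have "{x \<in> V. if x \<in> T then x \<in> A else f x \<in> A} \<subseteq> {x \<in> V. if x \<in> T then x \<in> B else f x \<in> B}"
      using AB by auto
    ultimately show "B \<in> Z T" using A N unfolding Z_def up_closed_def by blast
  qed
  have "regular TYPE('k) (V \<union> f ` (V - T)) (r + r') (Z T)" if "finite T" "T \<subseteq> V" for T
    using that
  proof (induction T rule: finite_induct)
    case empty
    have "A \<in> joint V (f ` V) N N2 \<longleftrightarrow> A \<in> Z {}" if "A \<subseteq> V \<union> f ` V" for A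
    proof -
      have "f -` (A \<inter> f ` V) = {x \<in> V. f x \<in> A}" using f(1) by (auto simp: inj_def)
      then show ?thesis by (simp add: joint_def Z_def N2_def)
    qed
    then have "regular TYPE('k) (V \<union> f ` V) (r + r') (Z {})"
      using base regular_cong[of "V \<union> f ` V" "joint V (f ` V) N N2" "Z {}"] by blast
    then show ?case by simp
  next
    case (insert v T)
    let ?U = "(V - {v}) \<union> f ` (V - insert v T)"
    have v: "v \<in> V" using insert by simp
    have vf: "v \<noteq> f x" for x using fV[of x] v by metis
    have fv: "f v \<notin> ?U" "v \<notin> ?U" "v \<noteq> f v"
      using fV v f(1) vf by (auto simp: inj_def)
    have "V \<union> f ` (V - T) = insert v (insert (f v) ?U)"
      using v insert by auto
    then have "regular TYPE('k) (insert v (insert (f v) ?U)) (r + r') (Z T)"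
      using insert by simp
    then have "regular TYPE('k) (insert v ?U) (r + r') (merge v (f v) (Z T))"
      using n fv up_closed_Z by (intro regular_merge) auto
    moreover have "insert v ?U = V \<union> f ` (V - insert v T)" using v by auto
    moreover have "A \<in> merge v (f v) (Z T) \<longleftrightarrow> A \<in> Z (insert v T)" if A: "A \<subseteq> insert v ?U" for A
    proof (cases "v \<in> A")
      case True
      have "{x \<in> V. if x \<in> T then x \<in> insert (f v) A else f x \<in> insert (f v) A}
          = {x \<in> V. if x \<in> insert v T then x \<in> A else f x \<in> A}"
        using True fV f(1) insert(2) by (auto simp: inj_def)
      moreover have "insert (f v) A \<inter> V = A \<inter> V" using fV by auto
      ultimately show ?thesis using True by (simp add: merge_def Z_def)
    next
      case False
      have "f v \<notin> A" using A fv by auto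
      then have "{x \<in> V. if x \<in> T then x \<in> A else f x \<in> A}
          = {x \<in> V. if x \<in> insert v T then x \<in> A else f x \<in> A}"
        using False insert(2) by auto
      then show ?thesis using False by (simp add: merge_def Z_def)
    qed
    ultimately show ?case using regular_cong[of "insert v ?U"] by metis
  qed
  from this[OF n] have "regular TYPE('k) V (r + r') (Z V)" by simp
  moreover have "A \<in> Z V \<longleftrightarrow> A \<in> N \<inter> N'" if "A \<subseteq> V" for A
  proof -
    have "{x \<in> V. if x \<in> V then x \<in> A else f x \<in> A} = A" "A \<inter> V = A" using that by auto
    then show ?thesis by (simp add: Z_def)
  qed
  ultimately show ?thesis using regular_cong[of V] by metis
qed

text \<open>Mayer-Vietoris needs the two families in degree \<open>i\<close> and their intersection
  in degree \<open>i - 1\<close>. The lower degree gains the 1 in the bound; the two families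
  themselves are in range because the regularity of the other one is at least 1.\<close>

lemma regular_Un:
  assumes V: "finite V" and N: "up_closed N" "up_closed N'" and r: "r \<ge> 1" "r' \<ge> 1"
    and reg: "regular TYPE('k) V r N" "regular TYPE('k) V r' N'"
  shows "regular TYPE('k::field) V (r + r' - 1) (N \<union> N')"
proof (rule regularI[of _ V])
  fix W i assume W: "W \<subseteq> V" "int (card W) > i + (r + r' - 1)"
  have finW: "finite W" using W V finite_subset by blast
  have up_closed_Int: "up_closed (N \<inter> N')" using N unfolding up_closed_def by blast
  have ex: "exact_at TYPE('k) V (upper_koszul N W) i" "exact_at TYPE('k) V (upper_koszul N' W) i" "exact_at TYPE('k) V (upper_koszul (N \<inter> N') W) (i - 1)"
    using regularD[OF reg(1) V finW W(1,1), of i] regularD[OF reg(2) V finW W(1,1), of i]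
      regularD[OF regular_Int[OF V N reg] V finW W(1,1), of "i - 1"] W(2) r by simp_all
  show "exact_at TYPE('k) V (upper_koszul (N \<union> N') W) i"
    unfolding exact_at_def
  proof (intro allI impI, elim conjE)
    fix c :: "nat set \<Rightarrow> 'k" assume c: "c \<in> chn (upper_koszul (N \<union> N') W) i" "bd V c = 0"
    define c1 where "c1 A = (if W - A \<in> N then c A else 0)" for A
    define c2 where "c2 A = (if W - A \<in> N then 0 else c A)" for A
    have c12: "c = c1 + c2" by (auto simp: c1_def c2_def)
    have c1: "c1 \<in> chn (upper_koszul N W) i" and c2: "c2 \<in> chn (upper_koszul N' W) i"
      using c(1) by (auto simp: chn_def upper_koszul_def c1_def c2_def)
    have eq: "bd V c1 = - bd V c2" using c(2) unfolding c12 bd_add by (simp add: eq_neg_iff_add_eq_0)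
    have b1: "bd V c1 \<in> chn (upper_koszul N W) (i - 1)" using chn_upper_koszul_bd[OF c1 N(1) finW] .
    have b2: "bd V c1 \<in> chn (upper_koszul N' W) (i - 1)" unfolding eq using chn_minus[OF chn_upper_koszul_bd[OF c2 N(2) finW]] .
    have "bd V c1 \<in> chn (upper_koszul (N \<inter> N') W) (i - 1)"
      using b1 b2 by (simp add: chn_def upper_koszul_def)
    \<comment> \<open>Subtracting \<open>t\<close> from \<open>c1\<close> and adding it to
      \<open>c2\<close> keeps the sum and turns both summands into cycles.\<close>
    from exact_atD[OF ex(3) this bd_bd[OF V]] obtain t where
      t: "t \<in> chn (upper_koszul (N \<inter> N') W) i" "bd V t = bd V c1" by auto
    have t1: "t \<in> chn (upper_koszul N W) i" "t \<in> chn (upper_koszul N' W) i"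
      using t(1) by (simp_all add: chn_def upper_koszul_def)
    have "bd V (c1 - t) = 0" using t(2) by (simp add: bd_diff)
    from exact_atD[OF ex(1) chn_diff[OF c1 t1(1)] this] obtain u1 where
      u1: "u1 \<in> chn (upper_koszul N W) (i + 1)" "bd V u1 = c1 - t" by auto
    have "bd V (c2 + t) = 0" using t(2) eq by (simp add: bd_add)
    from exact_atD[OF ex(2) chn_add[OF c2 t1(2)] this] obtain u2 where
      u2: "u2 \<in> chn (upper_koszul N' W) (i + 1)" "bd V u2 = c2 + t" by auto
    have "u1 \<in> chn (upper_koszul (N \<union> N') W) (i + 1)" "u2 \<in> chn (upper_koszul (N \<union> N') W) (i + 1)"
      using chn_mono[OF u1(1) upper_koszul_mono[of N "N \<union> N'"]] chn_mono[OF u2(1) upper_koszul_mono[of N' "N \<union> N'"]] by simp_all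
    moreover have "bd V (u1 + u2) = c" using u1(2) u2(2) c12 by (simp add: bd_add)
    ultimately show "\<exists>u \<in> chn (upper_koszul (N \<union> N') W) (i + 1). bd V u = c"
      using chn_add by blast
  qed
qed (use V in auto)

text \<open>A generator of least degree forces \<open>r \<ge> card W\<close>: for a smallest member
  \<open>W\<close> of \<open>N\<close> the empty set is the only face, and it is a cycle of degree 0
  that is not a boundary.\<close>

lemma regular_pos:
  assumes V: "finite V" and A: "A \<in> N" "A \<subseteq> V" and N: "{} \<notin> N"
    and reg: "regular TYPE('k::field) V r N"
  shows "r \<ge> 1"
proof -
  define W where "W = (ARG_MIN card W. W \<in> N \<and> W \<subseteq> V)"
  have W: "W \<in> N" "W \<subseteq> V" and min: "\<And>B. B \<in> N \<Longrightarrow> B \<subseteq> V \<Longrightarrow> card W \<le> card B"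
    using arg_min_nat_lemma[of "\<lambda>W. W \<in> N \<and> W \<subseteq> V" A card] A unfolding W_def by auto
  have finW: "finite W" using W V finite_subset by blast
  have "card W \<noteq> 0" using W N finW by auto
  moreover have "\<not> int (card W) > r"
  proof
    assume "int (card W) > r"
    then have ex: "exact_at TYPE('k) W (upper_koszul N W) 0" using reg W unfolding regular_def by simp
    define c :: "nat set \<Rightarrow> 'k" where "c A = (if A = {} then 1 else 0)" for A
    have "c \<in> chn (upper_koszul N W) 0" using W by (auto simp: chn_def c_def upper_koszul_def)
    moreover have "bd W c = 0" by (auto simp: bd_def c_def)
    ultimately obtain u where u: "u \<in> chn (upper_koszul N W) (0 + 1)" "bd W u = c"
      using exact_atD[OF ex] by blast
    have "u B = 0" for B
    proof (rule ccontr)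
      assume "u B \<noteq> 0"
      then have B: "B \<subseteq> W" "W - B \<in> N" "card B = 1" using u(1) by (auto simp: chn_def upper_koszul_def)
      then have "card (W - B) < card W" using finW by (intro psubset_card_mono) (auto simp: card_1_singleton_iff)
      moreover have "card W \<le> card (W - B)" using B W by (intro min) auto
      ultimately show False by simp
    qed
    then have "u = 0" by auto
    then have "c = 0" using u(2) by (simp add: bd_0)
    then have "c {} = 0" by simp
    then show False by (simp add: c_def)
  qed
  ultimately show ?thesis by linarith
qed

section \<open>Graded maps and the comparison of resolutions\<close>

lemma homog_0: "homog d 0" by (simp add: homog_def)

lemma homog_add: "homog d p \<Longrightarrow> homog d q \<Longrightarrow> homog d (p + q)"
  using Poly_Mapping.keys_add[of p q] by (auto simp: homog_def)

lemma homog_uminus: "homog d p \<Longrightarrow> homog d (- p)"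
  by (simp add: homog_def keys_def)

lemma homog_diff: "homog d p \<Longrightarrow> homog d q \<Longrightarrow> homog d (p - q)"
  using homog_add[of d p "- q"] homog_uminus[of d q] by simp

lemma homog_sum: "(\<And>x. x \<in> A \<Longrightarrow> homog d (f x)) \<Longrightarrow> homog d (sum f A)"
  by (induction A rule: infinite_finite_induct) (auto simp: homog_0 homog_add)

lemma total_deg_superset: "finite A \<Longrightarrow> Poly_Mapping.keys m \<subseteq> A \<Longrightarrow> total_deg m = (\<Sum>i \<in> A. Poly_Mapping.lookup m i)"
  unfolding total_deg_def by (intro sum.mono_neutral_left) (auto simp: in_keys_iff)

lemma total_deg_add: "total_deg (m + m') = total_deg m + total_deg m'"
proof -
  let ?A = "Poly_Mapping.keys m \<union> Poly_Mapping.keys m'"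
  have "total_deg (m + m') = (\<Sum>i \<in> ?A. Poly_Mapping.lookup (m + m') i)"
    using Poly_Mapping.keys_add[of m m'] by (intro total_deg_superset) auto
  also have "\<dots> = (\<Sum>i \<in> ?A. Poly_Mapping.lookup m i) + (\<Sum>i \<in> ?A. Poly_Mapping.lookup m' i)"
    by (simp add: lookup_add sum.distrib)
  also have "\<dots> = total_deg m + total_deg m'"
    using total_deg_superset[of ?A m] total_deg_superset[of ?A m'] by simp
  finally show ?thesis .
qed

lemma homog_mult:
  assumes "homog d p" "homog e q"
  shows "homog (d + e) (p * q)"
  unfolding homog_def
proof
  fix m assume "m \<in> Poly_Mapping.keys (p * q)"
  then obtain a b where "m = a + b" "a \<in> Poly_Mapping.keys p" "b \<in> Poly_Mapping.keys q"
    using Poly_Mapping.keys_mult[of p q] by blast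
  then show "int (total_deg m) = d + e"
    using assms by (simp add: homog_def total_deg_add)
qed

lemma homog_1: "homog 0 1"
  by (simp add: homog_def total_deg_def)

section \<open>Homogeneous components of polynomials\<close>

definition homog_part :: "int \<Rightarrow> 'k::field mpoly \<Rightarrow> 'k mpoly" where
  "homog_part d p = Poly_Mapping.mapp (\<lambda>m c. if int (total_deg m) = d then c else 0) p"

lemma lookup_homog_part:
  "Poly_Mapping.lookup (homog_part d p) m = (if int (total_deg m) = d then Poly_Mapping.lookup p m else 0)"
  by (auto simp: homog_part_def lookup_mapp when_def in_keys_iff)

lemma homog_homog_part: "homog d (homog_part d p)"
  by (auto simp: homog_def in_keys_iff lookup_homog_part split: if_splits)

lemma homog_part_polys: "p \<in> polys n \<Longrightarrow> homog_part d p \<in> polys n"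
  by (auto simp: polys_def in_keys_iff lookup_homog_part split: if_splits)

lemma homog_part_id: "homog d p \<Longrightarrow> homog_part d p = p"
  by (intro poly_mapping_eqI) (auto simp: lookup_homog_part homog_def in_keys_iff)

lemma homog_part_add: "homog_part d (p + q) = homog_part d p + homog_part d q"
  by (intro poly_mapping_eqI) (simp add: lookup_homog_part lookup_add)

lemma homog_part_0: "homog_part d 0 = 0"
  by (intro poly_mapping_eqI) (simp add: lookup_homog_part)

lemma homog_part_sum: "homog_part d (sum f A) = (\<Sum>x \<in> A. homog_part d (f x))"
  by (induction A rule: infinite_finite_induct) (auto simp: homog_part_0 homog_part_add)

text \<open>Once its component of degree \<open>d - e\<close> is removed, \<open>p\<close> has no
  monomial that \<open>q\<close> could carry into degree \<open>d\<close>.\<close>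

lemma homog_part_mult:
  assumes "homog e q"
  shows "homog_part d (q * p) = q * homog_part (d - e) p"
proof -
  let ?r = "p - homog_part (d - e) p"
  have "homog_part d (q * ?r) = 0"
  proof (intro poly_mapping_eqI)
    fix m
    have "Poly_Mapping.lookup (q * ?r) m = 0" if "int (total_deg m) = d"
    proof (rule ccontr)
      assume "Poly_Mapping.lookup (q * ?r) m \<noteq> 0"
      then have "m \<in> Poly_Mapping.keys (q * ?r)" by (simp add: in_keys_iff)
      then obtain a b where ab: "m = a + b" "a \<in> Poly_Mapping.keys q" "b \<in> Poly_Mapping.keys ?r"
        using Poly_Mapping.keys_mult[of q ?r] by blast
      then have "int (total_deg b) = d - e"
        using assms that by (simp add: homog_def total_deg_add)
      then show False
        using ab(3) by (simp add: in_keys_iff lookup_minus lookup_homog_part)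
    qed
    then show "Poly_Mapping.lookup (homog_part d (q * ?r)) m = Poly_Mapping.lookup 0 m"
      by (simp add: lookup_homog_part)
  qed
  moreover have "homog (e + (d - e)) (q * homog_part (d - e) p)"
    using assms homog_homog_part by (rule homog_mult)
  then have "homog_part d (q * homog_part (d - e) p) = q * homog_part (d - e) p"
    by (intro homog_part_id) simp
  moreover have "q * p = q * ?r + q * homog_part (d - e) p"
    by (simp add: algebra_simps)
  ultimately show ?thesis by (simp add: homog_part_add)
qed

lemma polys_sum: "(\<And>x. x \<in> A \<Longrightarrow> f x \<in> polys n) \<Longrightarrow> sum f A \<in> polys n"
  by (induction A rule: infinite_finite_induct) (auto simp: polys_0 polys_add)

lemma polys_diff: "p \<in> polys n \<Longrightarrow> q \<in> polys n \<Longrightarrow> p - q \<in> polys n"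
  using polys_add[of p n "- q"] polys_uminus[of q n] by simp

section \<open>Coefficient ideals and graded maps of free modules\<close>

definition closed_submodule :: "nat \<Rightarrow> 'k::field mpoly set \<Rightarrow> bool" where
  "closed_submodule n M \<longleftrightarrow> 0 \<in> M \<and> (\<forall>p \<in> M. \<forall>q \<in> M. p + q \<in> M) \<and> (\<forall>p \<in> polys n. \<forall>q \<in> M. p * q \<in> M)"

lemma closed_submodule_polys: "closed_submodule n (polys n)"
  by (auto simp: closed_submodule_def polys_0 polys_add polys_mult)

lemma closed_submodule_sum: "closed_submodule n M \<Longrightarrow> (\<And>x. x \<in> A \<Longrightarrow> f x \<in> M) \<Longrightarrow> sum f A \<in> M"
  by (induction A rule: infinite_finite_induct) (auto simp: closed_submodule_def)

lemma closed_submodule_uminus: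
  assumes "closed_submodule n M" "p \<in> M" shows "- p \<in> M"
proof -
  have "(- 1) * p \<in> M" using assms polys_uminus[OF polys_1] unfolding closed_submodule_def by blast
  then show ?thesis by simp
qed

definition mat_vec :: "nat \<Rightarrow> nat \<Rightarrow> (nat \<Rightarrow> nat \<Rightarrow> 'k::field mpoly) \<Rightarrow> (nat \<Rightarrow> 'k mpoly) \<Rightarrow> nat \<Rightarrow> 'k mpoly" where
  "mat_vec r s A v = (\<lambda>a. if a < r then \<Sum>b<s. A a b * v b else 0)"

text \<open>Degree-preserving \<open>S\<close>-linear maps from \<open>F\<^sub>i\<close> to \<open>G\<^sub>k\<close>, which act on \<open>F\<^sub>i \<otimes> M\<close> for every \<open>M\<close>.\<close>
definition gmap :: "nat \<Rightarrow> 'k::field free_complex \<Rightarrow> nat \<Rightarrow> 'k free_complex \<Rightarrow> nat \<Rightarrow> ((nat \<Rightarrow> 'k mpoly) \<Rightarrow> nat \<Rightarrow> 'k mpoly) \<Rightarrow> bool" where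
  "gmap n F i G k f \<longleftrightarrow> (\<exists>A. f = mat_vec (rk G k) (rk F i) A \<and>
     (\<forall>a < rk G k. \<forall>b < rk F i. A a b \<in> polys n \<and> homog (dg F i b - dg G k a) (A a b)))"

lemma gmapE:
  assumes "gmap n F i G k f"
  obtains A where "f = mat_vec (rk G k) (rk F i) A"
    "\<And>a b. a < rk G k \<Longrightarrow> b < rk F i \<Longrightarrow> A a b \<in> polys n"
    "\<And>a b. a < rk G k \<Longrightarrow> b < rk F i \<Longrightarrow> homog (dg F i b - dg G k a) (A a b)"
  using assms unfolding gmap_def by blast

lemma gmapI:
  assumes "f = mat_vec (rk G k) (rk F i) A"
    "\<And>a b. a < rk G k \<Longrightarrow> b < rk F i \<Longrightarrow> A a b \<in> polys n"
    "\<And>a b. a < rk G k \<Longrightarrow> b < rk F i \<Longrightarrow> homog (dg F i b - dg G k a) (A a b)"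
  shows "gmap n F i G k f"
  using assms unfolding gmap_def by blast

lemma gmap_chains:
  assumes "gmap n F i G k f" "closed_submodule n M" "v \<in> chains F i M"
  shows "f v \<in> chains G k M"
proof -
  obtain A where A: "f = mat_vec (rk G k) (rk F i) A" "\<And>a b. a < rk G k \<Longrightarrow> b < rk F i \<Longrightarrow> A a b \<in> polys n"
    using gmapE[OF assms(1)] by metis
  have "A a b * v b \<in> M" if "a < rk G k" "b < rk F i" for a b
    using A(2)[OF that] assms(2,3) that by (auto simp: closed_submodule_def chains_def)
  then show ?thesis
    by (auto simp: A(1) mat_vec_def chains_def intro!: closed_submodule_sum[OF assms(2)])
qed

lemma gmap_degree:
  assumes "gmap n F i G k f" "v \<in> degree_part F i j"
  shows "f v \<in> degree_part G k j"
proof -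
  obtain A where A: "f = mat_vec (rk G k) (rk F i) A"
    "\<And>a b. a < rk G k \<Longrightarrow> b < rk F i \<Longrightarrow> homog (dg F i b - dg G k a) (A a b)"
    using gmapE[OF assms(1)] by metis
  have "homog (j - dg G k a) (A a b * v b)" if "a < rk G k" "b < rk F i" for a b
    using homog_mult[OF A(2)[OF that], of "j - dg F i b" "v b"] assms(2) that by (simp add: degree_part_def)
  then show ?thesis
    by (auto simp: A(1) mat_vec_def degree_part_def intro!: homog_sum)
qed

lemma mat_vec_add: "mat_vec r s A (v + w) = mat_vec r s A v + mat_vec r s A w"
  by (auto simp: mat_vec_def fun_eq_iff distrib_left sum.distrib)
lemma mat_vec_diff: "mat_vec r s A (v - w) = mat_vec r s A v - mat_vec r s A w"
  by (auto simp: mat_vec_def fun_eq_iff right_diff_distrib sum_subtractf)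
lemma mat_vec_0: "mat_vec r s A 0 = 0"
  by (auto simp: mat_vec_def fun_eq_iff)

lemma gmap_add: "gmap n F i G k f \<Longrightarrow> f (v + w) = f v + f w"
  by (auto simp: gmap_def mat_vec_add)
lemma gmap_diff: "gmap n F i G k f \<Longrightarrow> f (v - w) = f v - f w"
  by (auto simp: gmap_def mat_vec_diff)
lemma gmap_0: "gmap n F i G k f \<Longrightarrow> f 0 = 0"
  by (auto simp: gmap_def mat_vec_0)

lemma gmap_comp:
  assumes "gmap n F i G k f" "gmap n G k H l g"
  shows "gmap n F i H l (\<lambda>v. g (f v))"
proof -
  obtain A where A: "f = mat_vec (rk G k) (rk F i) A" "\<And>a b. a < rk G k \<Longrightarrow> b < rk F i \<Longrightarrow> A a b \<in> polys n"
    "\<And>a b. a < rk G k \<Longrightarrow> b < rk F i \<Longrightarrow> homog (dg F i b - dg G k a) (A a b)"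
    using gmapE[OF assms(1)] by metis
  obtain B where B: "g = mat_vec (rk H l) (rk G k) B" "\<And>a b. a < rk H l \<Longrightarrow> b < rk G k \<Longrightarrow> B a b \<in> polys n"
    "\<And>a b. a < rk H l \<Longrightarrow> b < rk G k \<Longrightarrow> homog (dg G k b - dg H l a) (B a b)"
    using gmapE[OF assms(2)] by metis
  show ?thesis
  proof (rule gmapI)
    show "(\<lambda>v. g (f v)) = mat_vec (rk H l) (rk F i) (\<lambda>a b. \<Sum>c < rk G k. B a c * A c b)"
    proof (intro ext)
      fix v a
      have "(\<Sum>c < rk G k. B a c * (\<Sum>b < rk F i. A c b * v b)) = (\<Sum>b < rk F i. (\<Sum>c < rk G k. B a c * A c b) * v b)"
        by (simp add: sum_distrib_left sum_distrib_right mult.assoc) (rule sum.swap)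
      then show "g (f v) a = mat_vec (rk H l) (rk F i) (\<lambda>a b. \<Sum>c < rk G k. B a c * A c b) v a"
        by (simp add: A(1) B(1) mat_vec_def)
    qed
  next
    fix a b assume ab: "a < rk H l" "b < rk F i"
    show "(\<Sum>c < rk G k. B a c * A c b) \<in> polys n"
      using ab A(2) B(2) by (intro polys_sum polys_mult) auto
    show "homog (dg F i b - dg H l a) (\<Sum>c < rk G k. B a c * A c b)"
    proof (intro homog_sum)
      fix c assume "c \<in> {..<rk G k}"
      then show "homog (dg F i b - dg H l a) (B a c * A c b)"
        using homog_mult[OF B(3)[OF ab(1), of c] A(3)[OF _ ab(2), of c]] by simp
    qed
  qed
qed

lemma gmap_minus:
  assumes "gmap n F i G k f" "gmap n F i G k g"
  shows "gmap n F i G k (\<lambda>v. f v - g v)"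
proof -
  obtain A where A: "f = mat_vec (rk G k) (rk F i) A" "\<And>a b. a < rk G k \<Longrightarrow> b < rk F i \<Longrightarrow> A a b \<in> polys n"
    "\<And>a b. a < rk G k \<Longrightarrow> b < rk F i \<Longrightarrow> homog (dg F i b - dg G k a) (A a b)"
    using gmapE[OF assms(1)] by metis
  obtain B where B: "g = mat_vec (rk G k) (rk F i) B" "\<And>a b. a < rk G k \<Longrightarrow> b < rk F i \<Longrightarrow> B a b \<in> polys n"
    "\<And>a b. a < rk G k \<Longrightarrow> b < rk F i \<Longrightarrow> homog (dg F i b - dg G k a) (B a b)"
    using gmapE[OF assms(2)] by metis
  show ?thesis
    by (rule gmapI[of _ _ _ _ _ "\<lambda>a b. A a b - B a b"])
      (auto simp: A(1) B(1) mat_vec_def fun_eq_iff left_diff_distrib sum_subtractf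
        intro: polys_diff homog_diff A(2,3) B(2,3))
qed

definition unit_vec :: "nat \<Rightarrow> nat \<Rightarrow> 'k::field mpoly" where
  "unit_vec b a = (if a = b then 1 else 0)"

lemma mat_vec_unit_vec: "b < s \<Longrightarrow> mat_vec r s A (unit_vec b) = (\<lambda>a. if a < r then A a b else 0)"
  by (simp add: mat_vec_def unit_vec_def fun_eq_iff if_distrib sum.delta cong: if_cong)

lemma unit_vec_chains: "b < rk F i \<Longrightarrow> unit_vec b \<in> chains F i (polys n)"
  by (auto simp: chains_def unit_vec_def polys_0 polys_1)

lemma unit_vec_degree: "unit_vec b \<in> degree_part F i (dg F i b)"
  by (auto simp: degree_part_def unit_vec_def homog_0 homog_1)

text \<open>Both maps are matrices, so agreement on unit vectors gives agreement everywhere, in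
  particular on chains with coefficients in an ideal. Identities obtained from exactness over
  \<open>polys n\<close> thereby survive tensoring.\<close>

lemma gmap_eqI:
  assumes "gmap n F i G k f" "gmap n F i G k g" "\<And>b. b < rk F i \<Longrightarrow> f (unit_vec b) = g (unit_vec b)"
  shows "f = g"
proof -
  obtain A B where AB: "f = mat_vec (rk G k) (rk F i) A" "g = mat_vec (rk G k) (rk F i) B"
    using assms(1,2) unfolding gmap_def by metis
  have "A a b = B a b" if "a < rk G k" "b < rk F i" for a b
    using fun_cong[OF assms(3)[OF that(2)], of a] that by (simp add: AB mat_vec_unit_vec)
  then show ?thesis unfolding AB by (auto simp: mat_vec_def fun_eq_iff)
qed

lemma gmap_of_columns:
  assumes "\<And>b. b < rk F i \<Longrightarrow> u b \<in> chains G k (polys n) \<inter> degree_part G k (dg F i b)"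
  obtains f where "gmap n F i G k f" "\<And>b. b < rk F i \<Longrightarrow> f (unit_vec b) = u b"
proof
  let ?f = "mat_vec (rk G k) (rk F i) (\<lambda>a b. u b a)"
  show "gmap n F i G k ?f"
    using assms by (intro gmapI[OF refl]) (auto simp: chains_def degree_part_def)
  show "?f (unit_vec b) = u b" if "b < rk F i" for b
    using assms[OF that] by (auto simp: mat_vec_unit_vec[OF that] chains_def fun_eq_iff)
qed

text \<open>The identity matrix cuts off all coordinates beyond the rank, so it fixes only vectors
  that vanish there.\<close>

lemma gmap_id:
  obtains f where "gmap n F i F i f" "\<And>v. (\<forall>a \<ge> rk F i. v a = 0) \<Longrightarrow> f v = v"
proof
  let ?f = "mat_vec (rk F i) (rk F i) (\<lambda>a b. if a = b then 1 else 0)"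
  show "gmap n F i F i ?f"
    by (rule gmapI[OF refl]) (auto simp: polys_0 polys_1 homog_0 homog_1)
  show "?f v = v" if "\<forall>a \<ge> rk F i. v a = 0" for v
    using that by (auto simp: mat_vec_def fun_eq_iff if_distrib[of "\<lambda>x. x * _"] cong: if_cong)
qed

section \<open>Exactness of resolutions and lifting of graded maps\<close>

lemma diff_Suc: "diff F (Suc i) = mat_vec (rk F i) (rk F (Suc i)) (df F (Suc i))"
  by (auto simp: diff_def mat_vec_def fun_eq_iff)

lemma gmap_diff_resolution:
  assumes "graded_free_resolution n F"
  shows "gmap n F (Suc i) F i (diff F (Suc i))"
  using assms unfolding graded_free_resolution_def
  by (intro gmapI[OF diff_Suc]) (metis diff_Suc_1 zero_less_Suc)+

text \<open>In degree 0 the augmentation takes the place of the differential, so lifting arguments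
  can treat all degrees alike.\<close>

definition aug_cycle :: "'k::field free_complex \<Rightarrow> nat \<Rightarrow> (nat \<Rightarrow> 'k mpoly) \<Rightarrow> bool" where
  "aug_cycle F i v \<longleftrightarrow> (if i = 0 then augment F v = 0 else diff F i v = 0)"

lemma resolution_exact:
  assumes "graded_free_resolution n F" "v \<in> chains F i (polys n)"
  shows "aug_cycle F i v \<longleftrightarrow> v \<in> boundaries F i (polys n)"
proof (cases "i = 0")
  case True
  have "{v \<in> chains F 0 (polys n). augment F v = 0} = boundaries F 0 (polys n)"
    using assms(1) by (simp add: graded_free_resolution_def)
  then show ?thesis using True assms(2) unfolding aug_cycle_def by auto
next
  case False
  then have "cycles F i (polys n) = boundaries F i (polys n)"
    using assms(1) by (simp add: graded_free_resolution_def)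
  then show ?thesis using False assms(2) unfolding aug_cycle_def cycles_def by auto
qed

lemma resolution_boundary_cycle:
  assumes F: "graded_free_resolution n F" and "v \<in> chains F (Suc i) (polys n)"
  shows "aug_cycle F i (diff F (Suc i) v)"
  using resolution_exact[OF F gmap_chains[OF gmap_diff_resolution[OF F] closed_submodule_polys assms(2)]] assms(2)
  by (auto simp: boundaries_def)

text \<open>Exactness yields this only on chains over \<open>polys n\<close>; tested on unit vectors
  it becomes a matrix identity.\<close>

lemma resolution_diff_diff:
  assumes F: "graded_free_resolution n F"
  shows "diff F (Suc i) (diff F (Suc (Suc i)) v) = 0"
proof -
  have 0: "gmap n F (Suc (Suc i)) F i (\<lambda>v. 0)"
    by (rule gmapI[of _ _ _ _ _ "\<lambda>a b. 0"]) (auto simp: mat_vec_def fun_eq_iff polys_0 homog_0)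
  have "(\<lambda>v. diff F (Suc i) (diff F (Suc (Suc i)) v)) = (\<lambda>v. 0)"
    using resolution_boundary_cycle[OF F unit_vec_chains]
    by (intro gmap_eqI[OF gmap_comp[OF gmap_diff_resolution[OF F] gmap_diff_resolution[OF F]] 0])
      (auto simp: aug_cycle_def)
  then show ?thesis by (rule fun_cong)
qed

text \<open>The matrix entries are homogeneous, so replacing each coordinate of a preimage by its
  component of the right degree does not change a homogeneous image.\<close>

lemma homogeneous_preimage:
  assumes F: "graded_free_resolution n F"
    and w: "w \<in> boundaries F i (polys n)" "w \<in> degree_part F i j"
  obtains u where "u \<in> chains F (Suc i) (polys n)" "u \<in> degree_part F (Suc i) j" "diff F (Suc i) u = w"
proof -
  obtain u where u: "u \<in> chains F (Suc i) (polys n)" "diff F (Suc i) u = w"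
    using w(1) by (auto simp: boundaries_def)
  define u' where "u' a = (if a < rk F (Suc i) then homog_part (j - dg F (Suc i) a) (u a) else 0)" for a
  have hom: "homog (dg F (Suc i) b - dg F i a) (df F (Suc i) a b)" if "a < rk F i" "b < rk F (Suc i)" for a b
    using F that unfolding graded_free_resolution_def by (metis diff_Suc_1 zero_less_Suc)
  show thesis
  proof
    show "u' \<in> chains F (Suc i) (polys n)"
      using u(1) by (auto simp: chains_def u'_def homog_part_polys)
    show "u' \<in> degree_part F (Suc i) j"
      by (auto simp: degree_part_def u'_def homog_homog_part)
    show "diff F (Suc i) u' = w"
    proof
      fix a show "diff F (Suc i) u' a = w a"
      proof (cases "a < rk F i")
        case True
        have wa: "w a = (\<Sum>b < rk F (Suc i). df F (Suc i) a b * u b)"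
          using u(2) True by (auto simp: diff_Suc mat_vec_def)
        have "w a = homog_part (j - dg F i a) (w a)"
          using w(2) True by (simp add: degree_part_def homog_part_id)
        also have "\<dots> = (\<Sum>b < rk F (Suc i). homog_part (j - dg F i a) (df F (Suc i) a b * u b))"
          by (simp add: wa homog_part_sum)
        also have "\<dots> = (\<Sum>b < rk F (Suc i). df F (Suc i) a b * u' b)"
        proof (intro sum.cong refl)
          fix b assume "b \<in> {..<rk F (Suc i)}"
          then show "homog_part (j - dg F i a) (df F (Suc i) a b * u b) = df F (Suc i) a b * u' b"
            using homog_part_mult[OF hom[OF True]] by (simp add: u'_def)
        qed
        finally show ?thesis using True by (simp add: diff_Suc mat_vec_def)
      next
        case False
        then show ?thesis using u(2) by (auto simp: diff_Suc mat_vec_def)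
      qed
    qed
  qed
qed

text \<open>The source is free: homogeneous preimages of the images of its basis vectors form the
  columns of the lift.\<close>

lemma gmap_lift:
  assumes G: "graded_free_resolution n G" and f: "gmap n F i G k f"
    and cyc: "\<And>v. v \<in> chains F i (polys n) \<Longrightarrow> aug_cycle G k (f v)"
  obtains g where "gmap n F i G (Suc k) g" "\<And>v. diff G (Suc k) (g v) = f v"
proof -
  have "\<exists>u. u \<in> chains G (Suc k) (polys n) \<inter> degree_part G (Suc k) (dg F i b) \<and> diff G (Suc k) u = f (unit_vec b)"
    if b: "b < rk F i" for b
  proof -
    have "f (unit_vec b) \<in> boundaries G k (polys n)"
      using cyc[OF unit_vec_chains[OF b]] resolution_exact[OF G gmap_chains[OF f closed_submodule_polys unit_vec_chains[OF b]]]
      by simp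
    then show ?thesis
      using homogeneous_preimage[OF G _ gmap_degree[OF f unit_vec_degree]] by blast
  qed
  then obtain u where u: "\<And>b. b < rk F i \<Longrightarrow> u b \<in> chains G (Suc k) (polys n) \<inter> degree_part G (Suc k) (dg F i b)"
    "\<And>b. b < rk F i \<Longrightarrow> diff G (Suc k) (u b) = f (unit_vec b)"
    by metis
  obtain g where g: "gmap n F i G (Suc k) g" "\<And>b. b < rk F i \<Longrightarrow> g (unit_vec b) = u b"
    using gmap_of_columns[of F i u G "Suc k" n] u(1) by metis
  have "(\<lambda>v. diff G (Suc k) (g v)) = f"
    by (rule gmap_eqI[OF gmap_comp[OF g(1) gmap_diff_resolution[OF G]] f]) (simp add: g(2) u(2))
  then show thesis using g(1) that by (metis (no_types))
qed

lemma lookup_mult_0: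
  "Poly_Mapping.lookup (p * q) (0 :: nat \<Rightarrow>\<^sub>0 nat) = Poly_Mapping.lookup p 0 * (Poly_Mapping.lookup q 0 :: 'k::field)"
proof -
  have *: "0 = a + b \<longleftrightarrow> a = 0 \<and> b = (0 :: nat \<Rightarrow>\<^sub>0 nat)" for a b
    by (auto simp: poly_mapping_eq_iff fun_eq_iff lookup_add)
  have "Poly_Mapping.lookup (p * q) 0 = (\<Sum>l. Poly_Mapping.lookup p l * (\<Sum>l'. Poly_Mapping.lookup q l' when l = 0 \<and> l' = 0))"
    by (simp add: lookup_mult *)
  also have "\<dots> = (\<Sum>l. Poly_Mapping.lookup p l * Poly_Mapping.lookup q 0 when l = 0)"
    by (intro arg_cong[of _ _ Sum_any] ext) (auto simp: when_def)
  also have "\<dots> = Poly_Mapping.lookup p 0 * Poly_Mapping.lookup q 0"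
    by simp
  finally show ?thesis .
qed

lemma augment_diff: "augment F (v - w) = augment F v - augment F w"
  by (simp add: augment_def lookup_minus left_diff_distrib sum_subtractf)

text \<open>\<open>augment\<close> sees only constant coefficients, and taking these is
  multiplicative, so the comparison reduces to basis vectors.\<close>

lemma augment_gmap:
  assumes f: "gmap n F 0 G 0 f" and aug: "\<And>b. b < rk F 0 \<Longrightarrow> augment G (f (unit_vec b)) = au F b"
  shows "augment G (f v) = augment F v"
proof -
  obtain A where A: "f = mat_vec (rk G 0) (rk F 0) A" using f by (auto simp: gmap_def)
  have col: "(\<Sum>a < rk G 0. Poly_Mapping.lookup (A a b) 0 * au G a) = au F b" if "b < rk F 0" for b
    using aug[OF that] by (simp add: A augment_def mat_vec_unit_vec[OF that])
  have "augment G (f v) = (\<Sum>a < rk G 0. \<Sum>b < rk F 0. Poly_Mapping.lookup (A a b) 0 * Poly_Mapping.lookup (v b) 0 * au G a)"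
    by (simp add: A augment_def mat_vec_def lookup_sum lookup_mult_0 sum_distrib_right)
  also have "\<dots> = (\<Sum>b < rk F 0. Poly_Mapping.lookup (v b) 0 * (\<Sum>a < rk G 0. Poly_Mapping.lookup (A a b) 0 * au G a))"
    by (subst sum.swap) (simp add: sum_distrib_left mult_ac)
  also have "\<dots> = augment F v"
    by (simp add: augment_def col)
  finally show ?thesis .
qed

text \<open>Only basis elements of degree 0 have nonzero augmentation, so the degree 0 component of
  a preimage is again a preimage.\<close>

lemma augment_homogeneous_surj:
  assumes G: "graded_free_resolution n G"
  obtains w where "w \<in> chains G 0 (polys n)" "w \<in> degree_part G 0 0" "augment G w = c"
proof -
  have "c \<in> augment G ` chains G 0 (polys n)"
    using G by (simp add: graded_free_resolution_def)
  then obtain u where u: "u \<in> chains G 0 (polys n)" "augment G u = c" by auto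
  define w where "w a = (if a < rk G 0 then homog_part (- dg G 0 a) (u a) else 0)" for a
  show thesis
  proof
    show "w \<in> chains G 0 (polys n)"
      using u(1) by (auto simp: chains_def w_def homog_part_polys)
    show "w \<in> degree_part G 0 0"
      by (auto simp: degree_part_def w_def homog_homog_part)
    have "Poly_Mapping.lookup (w a) 0 * au G a = Poly_Mapping.lookup (u a) 0 * au G a" if "a < rk G 0" for a
    proof (cases "au G a = 0")
      case False
      then have "dg G 0 a = 0" using G that by (auto simp: graded_free_resolution_def)
      then show ?thesis using that by (simp add: w_def lookup_homog_part total_deg_def)
    qed simp
    then show "augment G w = c"
      unfolding u(2)[symmetric] augment_def by (intro sum.cong) auto
  qed
qed

section \<open>Chain maps and homotopies over the residue field\<close>

definition chain_map :: "nat \<Rightarrow> 'k::field free_complex \<Rightarrow> 'k free_complex \<Rightarrow> (nat \<Rightarrow> (nat \<Rightarrow> 'k mpoly) \<Rightarrow> nat \<Rightarrow> 'k mpoly) \<Rightarrow> bool" where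
  "chain_map n F G f \<longleftrightarrow> (\<forall>i. gmap n F i G i (f i)) \<and> (\<forall>v. augment G (f 0 v) = augment F v) \<and>
     (\<forall>i v. diff G (Suc i) (f (Suc i) v) = f i (diff F (Suc i) v))"

lemma chain_map_exists:
  assumes F: "graded_free_resolution n F" and G: "graded_free_resolution n G"
  obtains f where "chain_map n F G f"
proof -
  have "\<exists>u. u \<in> chains G 0 (polys n) \<inter> degree_part G 0 (dg F 0 b) \<and> augment G u = au F b" if "b < rk F 0" for b
  proof (cases "au F b = 0")
    case True
    have "0 \<in> chains G 0 (polys n)" "0 \<in> degree_part G 0 (dg F 0 b)" "augment G 0 = 0"
      by (auto simp: chains_def degree_part_def augment_def polys_0 homog_0)
    then show ?thesis using True by auto
  next
    case False
    then have "dg F 0 b = 0" using F that by (auto simp: graded_free_resolution_def)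
    then show ?thesis using augment_homogeneous_surj[OF G, of "au F b"] by (metis IntI)
  qed
  then obtain u where u: "\<And>b. b < rk F 0 \<Longrightarrow> u b \<in> chains G 0 (polys n) \<inter> degree_part G 0 (dg F 0 b)"
    "\<And>b. b < rk F 0 \<Longrightarrow> augment G (u b) = au F b"
    by metis
  obtain f0 where f0: "gmap n F 0 G 0 f0" "\<And>b. b < rk F 0 \<Longrightarrow> f0 (unit_vec b) = u b"
    using gmap_of_columns[of F 0 u G 0 n] u(1) by metis
  have aug0: "augment G (f0 v) = augment F v" for v
    using augment_gmap[OF f0(1)] f0(2) u(2) by simp
  \<comment> \<open>The invariant that boundaries of \<open>F\<close> go to cycles of
    \<open>G\<close> is exactly what allows the next component to be lifted.\<close>
  define P where "P i f \<longleftrightarrow> gmap n F i G i f \<and> (i = 0 \<longrightarrow> (\<forall>v. augment G (f v) = augment F v)) \<and>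
    (\<forall>v \<in> chains F (Suc i) (polys n). aug_cycle G i (f (diff F (Suc i) v)))" for i f
  have "\<exists>f. \<forall>i. P i (f i) \<and> (\<forall>v. diff G (Suc i) (f (Suc i) v) = f i (diff F (Suc i) v))"
  proof (rule dependent_nat_choice)
    have "aug_cycle G 0 (f0 (diff F (Suc 0) v))" if "v \<in> chains F (Suc 0) (polys n)" for v
      using resolution_boundary_cycle[OF F that] by (simp add: aug_cycle_def aug0)
    then show "\<exists>f. P 0 f" using f0(1) aug0 by (auto simp: P_def)
  next
    fix f i assume "P i f"
    then have f: "gmap n F i G i f" "\<And>v. v \<in> chains F (Suc i) (polys n) \<Longrightarrow> aug_cycle G i (f (diff F (Suc i) v))"
      by (auto simp: P_def)
    obtain g where g: "gmap n F (Suc i) G (Suc i) g" "\<And>v. diff G (Suc i) (g v) = f (diff F (Suc i) v)"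
      using gmap_lift[OF G gmap_comp[OF gmap_diff_resolution[OF F] f(1)] f(2)] by metis
    have "aug_cycle G (Suc i) (g (diff F (Suc (Suc i)) v))" for v
      by (simp add: aug_cycle_def g(2) resolution_diff_diff[OF F] gmap_0[OF f(1)])
    then show "\<exists>g. P (Suc i) g \<and> (\<forall>v. diff G (Suc i) (g v) = f (diff F (Suc i) v))"
      using g by (auto simp: P_def)
  qed
  then obtain f where "\<And>i. P i (f i)" "\<And>i v. diff G (Suc i) (f (Suc i) v) = f i (diff F (Suc i) v)"
    by metis
  then have "chain_map n F G f" by (simp add: chain_map_def P_def)
  then show thesis by (rule that)
qed

text \<open>By the identity already reached, the part of \<open>f\<close> not yet accounted for by
  \<open>h\<close> takes values in cycles, so exactness lifts the next component. The resulting
  identities hold for every \<open>v\<close>, hence also with coefficients in an ideal.\<close>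

lemma null_homotopy:
  assumes F: "graded_free_resolution n F"
    and f: "\<And>i. gmap n F i F i (f i)" "\<And>v. v \<in> chains F 0 (polys n) \<Longrightarrow> augment F (f 0 v) = 0"
      "\<And>i v. diff F (Suc i) (f (Suc i) v) = f i (diff F (Suc i) v)"
  obtains h where "\<And>i. gmap n F i F (Suc i) (h i)" "\<And>v. diff F (Suc 0) (h 0 v) = f 0 v"
    "\<And>i v. diff F (Suc (Suc i)) (h (Suc i) v) = f (Suc i) v - h i (diff F (Suc i) v)"
proof -
  define P where "P i h \<longleftrightarrow> gmap n F i F (Suc i) h \<and> (i = 0 \<longrightarrow> (\<forall>v. diff F (Suc 0) (h v) = f 0 v)) \<and>
    (\<forall>v. diff F (Suc i) (f (Suc i) v - h (diff F (Suc i) v)) = 0)" for i h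
  note d = gmap_diff_resolution[OF F]
  have "\<exists>h. \<forall>i. P i (h i) \<and> (\<forall>v. diff F (Suc (Suc i)) (h (Suc i) v) = f (Suc i) v - h i (diff F (Suc i) v))"
  proof (rule dependent_nat_choice)
    obtain h where h: "gmap n F 0 F (Suc 0) h" "\<And>v. diff F (Suc 0) (h v) = f 0 v"
      using gmap_lift[OF F f(1)[of 0]] f(2) by (metis aug_cycle_def)
    then have "P 0 h" by (simp add: P_def gmap_diff[OF d] f(3))
    then show "\<exists>h. P 0 h" by blast
  next
    fix h i assume "P i h"
    then have h: "gmap n F i F (Suc i) h" "\<And>v. diff F (Suc i) (f (Suc i) v - h (diff F (Suc i) v)) = 0"
      by (auto simp: P_def)
    have cyc: "aug_cycle F (Suc i) (f (Suc i) v - h (diff F (Suc i) v))" for v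
      by (simp add: aug_cycle_def h(2))
    have gm: "gmap n F (Suc i) F (Suc i) (\<lambda>v. f (Suc i) v - h (diff F (Suc i) v))"
      by (intro gmap_minus f gmap_comp[OF d h(1)])
    obtain g where g: "gmap n F (Suc i) F (Suc (Suc i)) g"
      "\<And>v. diff F (Suc (Suc i)) (g v) = f (Suc i) v - h (diff F (Suc i) v)"
      using gmap_lift[OF F gm cyc] by blast
    have "diff F (Suc (Suc i)) (f (Suc (Suc i)) v - g (diff F (Suc (Suc i)) v)) = 0" for v
      by (simp add: gmap_diff[OF d] f(3) g(2) resolution_diff_diff[OF F] gmap_0[OF h(1)])
    then show "\<exists>g. P (Suc i) g \<and> (\<forall>v. diff F (Suc (Suc i)) (g v) = f (Suc i) v - h (diff F (Suc i) v))"
      using g by (auto simp: P_def)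
  qed
  then obtain h where "\<And>i. P i (h i)" "\<And>i v. diff F (Suc (Suc i)) (h (Suc i) v) = f (Suc i) v - h i (diff F (Suc i) v)"
    by metis
  then show thesis using that[of h] by (simp add: P_def)
qed

definition acyclic_at :: "'k::field free_complex \<Rightarrow> nat \<Rightarrow> int \<Rightarrow> 'k mpoly set \<Rightarrow> bool" where
  "acyclic_at F i j M \<longleftrightarrow> cycles F i M \<inter> degree_part F i j \<subseteq> boundaries F i M"

text \<open>Comparison maps \<open>p\<close> and \<open>q\<close> give
  \<open>z = q i (p i z) + f i z\<close> with \<open>f\<close> null homotopic. The first term bounds
  because \<open>p i z\<close> bounds in \<open>G\<close>, the second by the homotopy. Only the
  cycle has to be homogeneous, so the degree of the filling is not tracked.\<close>

theorem acyclic_at_resolution_independent: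
  assumes F: "graded_free_resolution n F" and G: "graded_free_resolution n G" and M: "closed_submodule n M"
    and ac: "acyclic_at G i j M"
  shows "acyclic_at F i j M"
  unfolding acyclic_at_def
proof
  fix z assume "z \<in> cycles F i M \<inter> degree_part F i j"
  then have z: "z \<in> chains F i M" "diff F i z = 0" "z \<in> degree_part F i j"
    by (auto simp: cycles_def)
  obtain p q where p: "chain_map n F G p" and q: "chain_map n G F q"
    using chain_map_exists[OF F G] chain_map_exists[OF G F] by metis
  have "\<exists>f. gmap n F i F i f \<and> (\<forall>v. (\<forall>a \<ge> rk F i. v a = 0) \<longrightarrow> f v = v)" for i
    using gmap_id by metis
  then obtain e where e: "\<And>i. gmap n F i F i (e i)" "\<And>i v. (\<forall>a \<ge> rk F i. v a = 0) \<Longrightarrow> e i v = v"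
    by metis
  have e_chains: "e i v = v" if "v \<in> chains F i M'" for i v M'
    using that by (intro e(2)) (auto simp: chains_def)
  note dF = gmap_diff_resolution[OF F]
  define f where "f i v = e i v - q i (p i v)" for i v
  have gp: "gmap n F i G i (p i)" and gq: "gmap n G i F i (q i)" for i
    using p q by (auto simp: chain_map_def)
  have f: "gmap n F i F i (f i)" for i
    unfolding f_def by (intro gmap_minus e gmap_comp[OF gp gq])
  have de: "diff F (Suc i) (e (Suc i) v) = e i (diff F (Suc i) v)" for i v
  proof -
    have "(\<lambda>v. diff F (Suc i) (e (Suc i) v)) = (\<lambda>v. e i (diff F (Suc i) v))"
      by (rule gmap_eqI[OF gmap_comp[OF e(1) dF] gmap_comp[OF dF e(1)]])
        (metis e_chains unit_vec_chains gmap_chains[OF dF closed_submodule_polys])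
    then show ?thesis by (rule fun_cong)
  qed
  have "diff F (Suc i) (f (Suc i) v) = f i (diff F (Suc i) v)" for i v
    using p q by (simp add: f_def gmap_diff[OF dF] de chain_map_def)
  moreover have "augment F (f 0 v) = 0" if "v \<in> chains F 0 (polys n)" for v
    using p q e_chains[OF that] by (simp add: f_def augment_diff chain_map_def)
  ultimately obtain h where h: "\<And>i. gmap n F i F (Suc i) (h i)" "\<And>v. diff F (Suc 0) (h 0 v) = f 0 v"
    "\<And>i v. diff F (Suc (Suc i)) (h (Suc i) v) = f (Suc i) v - h i (diff F (Suc i) v)"
    using null_homotopy[OF F f] by metis
  have hz: "diff F (Suc i) (h i z) = f i z"
  proof (cases i)
    case 0
    then show ?thesis using h(2) by simp
  next
    case (Suc k)
    then show ?thesis using h(3)[of k z] z(2) by (simp add: gmap_0[OF h(1)])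
  qed
  have "diff G i (p i z) = 0"
  proof (cases i)
    case 0
    then show ?thesis by (simp add: diff_def fun_eq_iff)
  next
    case (Suc k)
    then show ?thesis using p z(2) gmap_0[OF gp] by (simp add: chain_map_def)
  qed
  then have "p i z \<in> cycles G i M \<inter> degree_part G i j"
    using gmap_chains[OF gp M z(1)] gmap_degree[OF gp z(3)] by (simp add: cycles_def)
  then obtain w where w: "w \<in> chains G (Suc i) M" "diff G (Suc i) w = p i z"
    using ac by (auto simp: acyclic_at_def boundaries_def)
  let ?u = "q (Suc i) w + h i z"
  have "diff F (Suc i) ?u = q i (p i z) + f i z"
    using q w(2) hz by (simp add: gmap_add[OF dF] chain_map_def)
  also have "\<dots> = z"
    by (simp add: f_def e_chains[OF z(1)])
  finally have "diff F (Suc i) ?u = z" .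
  moreover have "?u \<in> chains F (Suc i) M"
    using gmap_chains[OF gq M w(1)] gmap_chains[OF h(1) M z(1)] M by (auto simp: chains_def closed_submodule_def)
  ultimately show "z \<in> boundaries F i M"
    unfolding boundaries_def by (metis imageI)
qed

section \<open>Vanishing of Betti numbers\<close>

interpretation scale: vector_space scale
  by (rule vector_space_scale)

lemma finite_exponents: "finite {m :: nat \<Rightarrow>\<^sub>0 nat. Poly_Mapping.keys m \<subseteq> {1..n} \<and> total_deg m = d}"
proof -
  let ?M = "{m :: nat \<Rightarrow>\<^sub>0 nat. Poly_Mapping.keys m \<subseteq> {1..n} \<and> total_deg m = d}"
  have "finite {f :: nat \<Rightarrow> nat. \<forall>x. (x \<in> {1..n} \<longrightarrow> f x \<in> {..d}) \<and> (x \<notin> {1..n} \<longrightarrow> f x = 0)}"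
    by (rule finite_set_of_finite_funs) auto
  moreover have "Poly_Mapping.lookup ` ?M \<subseteq> {f. \<forall>x. (x \<in> {1..n} \<longrightarrow> f x \<in> {..d}) \<and> (x \<notin> {1..n} \<longrightarrow> f x = 0)}"
  proof (intro image_subsetI CollectI conjI allI impI)
    fix m x assume "m \<in> ?M"
    then have m: "Poly_Mapping.keys m \<subseteq> {1..n}" "total_deg m = d" by auto
    show "Poly_Mapping.lookup m x \<in> {..d}"
    proof (cases "x \<in> Poly_Mapping.keys m")
      case True
      then show ?thesis
        using member_le_sum[of x "Poly_Mapping.keys m" "Poly_Mapping.lookup m"] m(2) by (simp add: total_deg_def)
    qed (simp add: in_keys_iff)
    show "Poly_Mapping.lookup m x = 0" if "x \<notin> {1..n}"
      using m(1) that in_keys_iff[of x m] by blast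
  qed
  ultimately have "finite (Poly_Mapping.lookup ` ?M)" by (rule finite_subset[rotated])
  then show ?thesis
    by (rule finite_imageD) (simp add: inj_on_def lookup_inject)
qed

lemma poly_mapping_sum_singles:
  assumes "finite S" "Poly_Mapping.keys p \<subseteq> S"
  shows "p = (\<Sum>m \<in> S. Poly_Mapping.single m (Poly_Mapping.lookup p m))"
proof (rule poly_mapping_eqI)
  fix m
  have "(\<Sum>x \<in> S. Poly_Mapping.lookup (Poly_Mapping.single x (Poly_Mapping.lookup p x)) m)
      = (\<Sum>x \<in> S. if x = m then Poly_Mapping.lookup p m else 0)"
    by (intro sum.cong) (auto simp: lookup_single when_def)
  also have "\<dots> = Poly_Mapping.lookup p m"
    using assms by (auto simp: in_keys_iff)
  finally show "Poly_Mapping.lookup p m = Poly_Mapping.lookup (\<Sum>m \<in> S. Poly_Mapping.single m (Poly_Mapping.lookup p m)) m"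
    by (simp add: lookup_sum)
qed

lemma degree_part_finite_dim:
  obtains B where "finite B" "chains F i (polys n) \<inter> degree_part F i j \<subseteq> scale.span B"
proof -
  define T where "T a = {m :: nat \<Rightarrow>\<^sub>0 nat. Poly_Mapping.keys m \<subseteq> {1..n} \<and> total_deg m = nat (j - dg F i a)}" for a
  have finT: "finite (T a)" for a unfolding T_def by (rule finite_exponents)
  define mon where "mon a m = (\<lambda>b. if b = a then Poly_Mapping.single m (1 :: 'a) else 0)" for a :: nat and m :: "nat \<Rightarrow>\<^sub>0 nat"
  define B where "B = (\<Union>a < rk F i. mon a ` T a)"
  show thesis
  proof
    show "finite B" using finT by (simp add: B_def)
    show "chains F i (polys n) \<inter> degree_part F i j \<subseteq> scale.span B"
    proof
      fix v assume v: "v \<in> chains F i (polys n) \<inter> degree_part F i j"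
      have keys: "Poly_Mapping.keys (v a) \<subseteq> T a" if "a < rk F i" for a
      proof
        fix m assume "m \<in> Poly_Mapping.keys (v a)"
        then show "m \<in> T a"
          using v that by (force simp: T_def chains_def polys_def degree_part_def homog_def)
      qed
      have "v = (\<Sum>a < rk F i. \<Sum>m \<in> T a. scale (Poly_Mapping.lookup (v a) m) (mon a m))"
      proof
        fix b
        have sum_app: "(\<Sum>x \<in> S. g x) b = (\<Sum>x \<in> S. g x b)" for S :: "'z set" and g :: "'z \<Rightarrow> nat \<Rightarrow> 'a mpoly"
          by (induction S rule: infinite_finite_induct) auto
        have "(\<Sum>a < rk F i. \<Sum>m \<in> T a. scale (Poly_Mapping.lookup (v a) m) (mon a m)) b
            = (\<Sum>a < rk F i. if a = b then (\<Sum>m \<in> T a. Poly_Mapping.single m (Poly_Mapping.lookup (v a) m)) else 0)"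
          unfolding sum_app
          by (intro sum.cong refl) (auto simp: scale_def mon_def Const_def mult_single)
        also have "\<dots> = v b"
        proof (cases "b < rk F i")
          case True
          then show ?thesis using poly_mapping_sum_singles[OF finT keys[OF True]] by simp
        next
          case False
          then show ?thesis using v by (simp add: chains_def)
        qed
        finally show "v b = (\<Sum>a < rk F i. \<Sum>m \<in> T a. scale (Poly_Mapping.lookup (v a) m) (mon a m)) b" by simp
      qed
      also have "\<dots> \<in> scale.span B"
        by (intro scale.span_sum scale.span_scale scale.span_base) (auto simp: B_def)
      finally show "v \<in> scale.span B" .
    qed
  qed
qed

text \<open>Truncated subtraction gives only \<open>dim T \<le> dim S\<close>. A basis of
  \<open>S\<close> extended to one of \<open>T\<close> then cannot grow, its finiteness being
  supplied by \<open>B\<close>.\<close>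

lemma (in vector_space) dim_diff_eq_0_iff:
  assumes "finite B" "T \<subseteq> span B" "S \<subseteq> T" "subspace S"
  shows "dim T - dim S = 0 \<longleftrightarrow> T \<subseteq> S"
proof
  assume "dim T - dim S = 0"
  then have le: "dim T \<le> dim S" by simp
  obtain b where b: "b \<subseteq> S" "independent b" "S \<subseteq> span b" "card b = dim S"
    using basis_exists by metis
  obtain c where c: "b \<subseteq> c" "c \<subseteq> T" "independent c" "T \<subseteq> span c"
    using maximal_independent_subset_extend[of b T] b assms(3) by blast
  have "finite c"
    using independent_span_bound[OF assms(1) c(3)] c(2) assms(2) by blast
  moreover have "dim T = card c"
    using basis_card_eq_dim[OF c(2,4,3)] by simp
  ultimately have "b = c" using c(1) b(4) le by (intro card_seteq) auto
  then show "T \<subseteq> S" using c(4) span_minimal[OF b(1) assms(4)] by auto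
next
  assume "T \<subseteq> S"
  then have "T = S" using assms(3) by blast
  then show "dim T - dim S = 0" by simp
qed

lemma scale_chains:
  assumes "closed_submodule n M" "v \<in> chains F i M"
  shows "scale c v \<in> chains F i M"
proof -
  have "Const c \<in> polys n" by (auto simp: Const_def polys_def)
  then show ?thesis using assms by (auto simp: chains_def scale_def closed_submodule_def)
qed

lemma betti_eq_0_iff:
  fixes M :: "'k::field mpoly set"
  assumes F: "graded_free_resolution n (resolution n :: 'k free_complex)" and M: "closed_submodule n M" "M \<subseteq> polys n"
  shows "betti n i j M = 0 \<longleftrightarrow> acyclic_at (resolution n) i j M"
proof -
  let ?F = "resolution n :: 'k free_complex"
  let ?T = "cycles ?F i M \<inter> degree_part ?F i j" and ?S = "boundaries ?F i M \<inter> degree_part ?F i j"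
  note d = gmap_diff_resolution[OF F]
  obtain B where B: "finite B" "chains ?F i (polys n) \<inter> degree_part ?F i j \<subseteq> scale.span B"
    using degree_part_finite_dim by metis
  have "?T \<subseteq> chains ?F i (polys n) \<inter> degree_part ?F i j"
    using M(2) by (auto simp: cycles_def chains_def)
  moreover have "boundaries ?F i M \<subseteq> cycles ?F i M"
  proof
    fix v assume "v \<in> boundaries ?F i M"
    then obtain u where u: "u \<in> chains ?F (Suc i) M" "v = diff ?F (Suc i) u"
      by (auto simp: boundaries_def)
    have "diff ?F i v = 0"
    proof (cases i)
      case 0
      then show ?thesis by (simp add: diff_def fun_eq_iff)
    next
      case (Suc k)
      show ?thesis unfolding u(2) Suc by (rule resolution_diff_diff[OF F])
    qed
    then show "v \<in> cycles ?F i M"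
      using gmap_chains[OF d M(1) u(1)] u(2) by (simp add: cycles_def)
  qed
  moreover have "scale.subspace ?S"
    unfolding scale.subspace_def
  proof (intro conjI ballI allI)
    show "0 \<in> ?S"
      using M(1) gmap_0[OF d] by (auto simp: boundaries_def degree_part_def homog_0 closed_submodule_def chains_def intro!: rev_image_eqI[of 0])
  next
    fix v w assume "v \<in> ?S" "w \<in> ?S"
    then obtain x y where xy: "x \<in> chains ?F (Suc i) M" "y \<in> chains ?F (Suc i) M"
      "v = diff ?F (Suc i) x" "w = diff ?F (Suc i) y" "v \<in> degree_part ?F i j" "w \<in> degree_part ?F i j"
      by (auto simp: boundaries_def)
    have "x + y \<in> chains ?F (Suc i) M" using xy M(1) by (auto simp: chains_def closed_submodule_def)
    then have "v + w \<in> boundaries ?F i M"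
      unfolding boundaries_def xy(3,4) gmap_add[OF d, symmetric] by (rule imageI)
    then show "v + w \<in> ?S" using xy(5,6) by (auto simp: degree_part_def homog_add)
  next
    fix c v assume "v \<in> ?S"
    then obtain x where x: "x \<in> chains ?F (Suc i) M" "v = diff ?F (Suc i) x" "v \<in> degree_part ?F i j"
      by (auto simp: boundaries_def)
    have "scale c v = diff ?F (Suc i) (scale c x)"
      by (auto simp: x(2) diff_def scale_def fun_eq_iff sum_distrib_left mult_ac)
    then have "scale c v \<in> boundaries ?F i M"
      using scale_chains[OF M(1) x(1)] by (auto simp: boundaries_def)
    moreover have "homog 0 (Const c)" by (auto simp: homog_def Const_def total_deg_def split: if_splits)
    then have "scale c v \<in> degree_part ?F i j"
      using x(3) homog_mult[of 0 "Const c"] by (auto simp: degree_part_def scale_def)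
    ultimately show "scale c v \<in> ?S" by simp
  qed
  ultimately have "betti n i j M = 0 \<longleftrightarrow> ?T \<subseteq> ?S"
    unfolding betti_def Let_def using B by (intro scale.dim_diff_eq_0_iff[OF B(1)]) auto
  then show ?thesis by (auto simp: acyclic_at_def)
qed

section \<open>The Koszul resolution\<close>

lemma lookup_single_mult:
  "Poly_Mapping.lookup (Poly_Mapping.single (Poly_Mapping.single k 1) c * p) (m :: nat \<Rightarrow>\<^sub>0 nat)
    = (if k \<in> Poly_Mapping.keys m then c * Poly_Mapping.lookup p (m - Poly_Mapping.single k 1) else (0 :: 'k::field))"
proof -
  let ?s = "Poly_Mapping.single k (1 :: nat)"
  have "Poly_Mapping.lookup (Poly_Mapping.single ?s c * p) m
      = (\<Sum>l. c * (\<Sum>q. Poly_Mapping.lookup p q when m = l + q) when ?s = l)"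
    by (simp add: lookup_mult lookup_single when_mult)
  also have "\<dots> = c * (\<Sum>q. Poly_Mapping.lookup p q when m = ?s + q)"
    by simp
  also have "(\<Sum>q. Poly_Mapping.lookup p q when m = ?s + q)
      = (if k \<in> Poly_Mapping.keys m then Poly_Mapping.lookup p (m - ?s) else 0)"
  proof (cases "k \<in> Poly_Mapping.keys m")
    case True
    then have "Poly_Mapping.lookup m k \<noteq> 0" by (simp add: in_keys_iff)
    then have "m = ?s + (m - ?s)"
      by (intro poly_mapping_eqI) (auto simp: lookup_add lookup_minus lookup_single when_def)
    then have "m = ?s + q \<longleftrightarrow> q = m - ?s" for q
      by (metis add_diff_cancel_left')
    then show ?thesis using True by simp
  next
    case False
    then have "m \<noteq> ?s + q" for q
      by (auto simp: in_keys_iff lookup_add)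
    then show ?thesis using False by simp
  qed
  finally show ?thesis by simp
qed

lemma keys_nonempty:
  assumes "m \<noteq> 0"
  obtains x where "x \<in> Poly_Mapping.keys m"
proof -
  have "\<exists>x. Poly_Mapping.lookup m x \<noteq> 0"
    using assms by (auto intro: poly_mapping_eqI)
  then show thesis using that by (auto simp: in_keys_iff)
qed

section \<open>Squarefree monomials\<close>

definition squarefree_mon :: "nat set \<Rightarrow> (nat \<Rightarrow>\<^sub>0 nat)" where
  "squarefree_mon A = (\<Sum>i \<in> A. Poly_Mapping.single i 1)"

lemma lookup_squarefree_mon: "finite A \<Longrightarrow> Poly_Mapping.lookup (squarefree_mon A) i = (if i \<in> A then 1 else 0)"
  by (simp add: squarefree_mon_def lookup_sum lookup_single when_def)

lemma keys_squarefree_mon: "finite A \<Longrightarrow> Poly_Mapping.keys (squarefree_mon A) = A"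
  by (auto simp: in_keys_iff lookup_squarefree_mon split: if_splits)

lemma squarefree_mon_insert: "finite A \<Longrightarrow> k \<notin> A \<Longrightarrow> squarefree_mon (insert k A) = squarefree_mon A + Poly_Mapping.single k 1"
  by (simp add: squarefree_mon_def add.commute)

lemma total_deg_squarefree_mon: "finite A \<Longrightarrow> total_deg (squarefree_mon A) = card A"
  by (simp add: total_deg_def keys_squarefree_mon lookup_squarefree_mon)

lemma squarefree_mon_add_diff: "finite A \<Longrightarrow> A \<subseteq> Poly_Mapping.keys m \<Longrightarrow> m - squarefree_mon A + squarefree_mon A = m"
  by (intro poly_mapping_eqI) (auto simp: lookup_add lookup_minus lookup_squarefree_mon in_keys_iff subset_iff Suc_le_eq)

lemma keys_add_nat: "Poly_Mapping.keys (a + b :: nat \<Rightarrow>\<^sub>0 nat) = Poly_Mapping.keys a \<union> Poly_Mapping.keys b"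
  by (auto simp: in_keys_iff lookup_add)

section \<open>The Koszul complex in coordinates\<close>

definition faces :: "nat \<Rightarrow> nat \<Rightarrow> nat set set" where
  "faces n i = {A. A \<subseteq> {1..n} \<and> card A = i}"

text \<open>Basis elements of a \<open>free_complex\<close> are numbered; an arbitrary enumeration
  of the faces serves.\<close>

definition face :: "nat \<Rightarrow> nat \<Rightarrow> nat \<Rightarrow> nat set" where
  "face n i = (SOME e. bij_betw e {0..<card (faces n i)} (faces n i))"

definition index :: "nat \<Rightarrow> nat \<Rightarrow> nat set \<Rightarrow> nat" where
  "index n i = inv_into {0..<card (faces n i)} (face n i)"

lemma finite_faces: "finite (faces n i)"
  by (simp add: faces_def)

lemma face_bij: "bij_betw (face n i) {0..<card (faces n i)} (faces n i)"
  unfolding face_def using ex_bij_betw_nat_finite[OF finite_faces] by (rule someI_ex)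

lemma face_in: "a < card (faces n i) \<Longrightarrow> face n i a \<in> faces n i"
  using face_bij[of n i] by (auto simp: bij_betw_def)

lemma index_less: "A \<in> faces n i \<Longrightarrow> index n i A < card (faces n i)"
  using bij_betw_inv_into[OF face_bij[of n i]] by (auto simp: bij_betw_def index_def)

lemma face_index: "A \<in> faces n i \<Longrightarrow> face n i (index n i A) = A"
  unfolding index_def using face_bij by (rule bij_betw_inv_into_right)

lemma index_face: "a < card (faces n i) \<Longrightarrow> index n i (face n i a) = a"
  unfolding index_def using bij_betw_inv_into_left[OF face_bij] by simp

lemma faces_finite: "A \<in> faces n i \<Longrightarrow> finite A"
  using finite_subset[of A "{1..n}"] by (auto simp: faces_def)

lemma faces_insert: "A \<in> faces n i \<Longrightarrow> k \<in> {1..n} - A \<Longrightarrow> insert k A \<in> faces n (Suc i)"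
  using faces_finite[of A n i] by (auto simp: faces_def)

text \<open>At most one \<open>k\<close> meets the condition, so each entry is a signed variable or
  zero, with the sign used in \<open>bd\<close>.\<close>

definition koszul :: "nat \<Rightarrow> 'k::field free_complex" where
  "koszul n = \<lparr>rk = \<lambda>i. card (faces n i), dg = \<lambda>i a. int i,
     df = \<lambda>i a b. \<Sum>k \<in> {1..n} - face n (i - 1) a. if insert k (face n (i - 1) a) = face n i b
       then Poly_Mapping.single (Poly_Mapping.single k 1) (sgn_ins k (face n (i - 1) a)) else 0,
     au = \<lambda>a. 1\<rparr>"

lemma koszul_simps:
  "rk (koszul n) i = card (faces n i)" "dg (koszul n) i a = int i" "au (koszul n) a = 1"
  "df (koszul n) (Suc i) a b = (\<Sum>k \<in> {1..n} - face n i a. if insert k (face n i a) = face n (Suc i) b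
       then Poly_Mapping.single (Poly_Mapping.single k 1) (sgn_ins k (face n i a)) else 0)"
  by (simp_all add: koszul_def cong: if_cong)

lemma koszul_diff:
  assumes "a < card (faces n i)"
  shows "diff (koszul n) (Suc i) v a = (\<Sum>k \<in> {1..n} - face n i a.
    Poly_Mapping.single (Poly_Mapping.single k 1) (sgn_ins k (face n i a)) * v (index n (Suc i) (insert k (face n i a))))"
proof -
  let ?s = "\<lambda>k. Poly_Mapping.single (Poly_Mapping.single k 1) (sgn_ins k (face n i a))"
  have "diff (koszul n) (Suc i) v a = (\<Sum>b < card (faces n (Suc i)). \<Sum>k \<in> {1..n} - face n i a.
      (if insert k (face n i a) = face n (Suc i) b then ?s k else 0) * v b)"
    using assms by (simp add: diff_Suc mat_vec_def koszul_simps sum_distrib_right)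
  also have "\<dots> = (\<Sum>k \<in> {1..n} - face n i a. \<Sum>b < card (faces n (Suc i)).
      (if insert k (face n i a) = face n (Suc i) b then ?s k else 0) * v b)"
    by (rule sum.swap)
  also have "\<dots> = (\<Sum>k \<in> {1..n} - face n i a. ?s k * v (index n (Suc i) (insert k (face n i a))))"
  proof (intro sum.cong refl)
    fix k assume k: "k \<in> {1..n} - face n i a"
    let ?A = "insert k (face n i a)"
    have A: "?A \<in> faces n (Suc i)" using faces_insert[OF face_in[OF assms] k] .
    have "(\<Sum>b < card (faces n (Suc i)). (if ?A = face n (Suc i) b then ?s k else 0) * v b)
        = (\<Sum>b < card (faces n (Suc i)). if b = index n (Suc i) ?A then ?s k * v b else 0)"
      using face_index[OF A] index_face[of _ n "Suc i"] by (intro sum.cong) auto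
    also have "\<dots> = ?s k * v (index n (Suc i) ?A)"
      using index_less[OF A] by simp
    finally show "(\<Sum>b < card (faces n (Suc i)). (if ?A = face n (Suc i) b then ?s k else 0) * v b)
      = ?s k * v (index n (Suc i) ?A)" .
  qed
  finally show ?thesis .
qed

text \<open>The basis element \<open>A\<close> has multidegree \<open>x\<^sup>A\<close>, so the multidegree-\<open>m\<close> part of a chain is read off at \<open>x\<^sup>m / x\<^sup>A\<close>.\<close>
definition mcomp :: "nat \<Rightarrow> nat \<Rightarrow> (nat \<Rightarrow> 'k::field mpoly) \<Rightarrow> (nat \<Rightarrow>\<^sub>0 nat) \<Rightarrow> nat set \<Rightarrow> 'k" where
  "mcomp n i v m A = (if A \<in> faces n i \<and> A \<subseteq> Poly_Mapping.keys m
     then Poly_Mapping.lookup (v (index n i A)) (m - squarefree_mon A) else 0)"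

text \<open>Replacing the basis element \<open>insert k A\<close> by \<open>A\<close> while
  multiplying by the variable of \<open>k\<close> keeps the multidegree, so on each multidegree the
  Koszul differential is the simplicial boundary.\<close>

lemma mcomp_diff:
  "mcomp n i (diff (koszul n) (Suc i) v) m = bd {1..n} (mcomp n (Suc i) v m)"
proof
  fix A
  let ?c = "mcomp n (Suc i) v m"
  show "mcomp n i (diff (koszul n) (Suc i) v) m A = bd {1..n} ?c A"
  proof (cases "A \<in> faces n i \<and> A \<subseteq> Poly_Mapping.keys m")
    case True
    then have A: "A \<in> faces n i" "A \<subseteq> Poly_Mapping.keys m" by auto
    have finA: "finite A" using faces_finite[OF A(1)] .
    have "mcomp n i (diff (koszul n) (Suc i) v) m A = (\<Sum>k \<in> {1..n} - A. Poly_Mapping.lookup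
      (Poly_Mapping.single (Poly_Mapping.single k 1) (sgn_ins k A) * v (index n (Suc i) (insert k A))) (m - squarefree_mon A))"
      using A by (simp add: mcomp_def koszul_diff[OF index_less[OF A(1)]] face_index lookup_sum)
    also have "\<dots> = (\<Sum>k \<in> {1..n} - A. sgn_ins k A * ?c (insert k A))"
    proof (intro sum.cong refl)
      fix k assume k: "k \<in> {1..n} - A"
      have "k \<in> Poly_Mapping.keys (m - squarefree_mon A) \<longleftrightarrow> k \<in> Poly_Mapping.keys m"
        using k finA by (simp add: in_keys_iff lookup_minus lookup_squarefree_mon)
      moreover have "m - squarefree_mon A - Poly_Mapping.single k 1 = m - squarefree_mon (insert k A)"
        using k finA by (simp add: squarefree_mon_insert diff_diff_add)
      ultimately show "Poly_Mapping.lookup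
          (Poly_Mapping.single (Poly_Mapping.single k 1) (sgn_ins k A) * v (index n (Suc i) (insert k A))) (m - squarefree_mon A)
        = sgn_ins k A * ?c (insert k A)"
        unfolding lookup_single_mult using A faces_insert[OF A(1) k] by (simp add: mcomp_def)
    qed
    finally show ?thesis by (simp add: bd_def)
  next
    case False
    have "?c (insert k A) = 0" if "k \<in> {1..n} - A" for k
    proof (rule ccontr)
      assume "?c (insert k A) \<noteq> 0"
      then have *: "insert k A \<in> faces n (Suc i)" "insert k A \<subseteq> Poly_Mapping.keys m"
        by (auto simp: mcomp_def split: if_splits)
      then have "A \<in> faces n i"
        using that faces_finite[OF *(1)] by (auto simp: faces_def)
      then show False using False * by auto
    qed
    then have "bd {1..n} ?c A = 0" by (simp add: bd_def)
    moreover have "mcomp n i (diff (koszul n) (Suc i) v) m A = 0" using False by (auto simp: mcomp_def)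
    ultimately show ?thesis by simp
  qed
qed

lemma mcomp_0: "mcomp n i 0 m = 0"
  by (simp add: mcomp_def fun_eq_iff)

text \<open>No coefficient is lost: the one at exponent \<open>t\<close> and face \<open>A\<close>
  is visible in multidegree \<open>t + squarefree_mon A\<close>.\<close>

lemma mcomp_eqI:
  assumes "v \<in> chains (koszul n) i M" "w \<in> chains (koszul n) i M'" "\<And>m. mcomp n i v m = mcomp n i w m"
  shows "v = w"
proof
  fix a show "v a = w a"
  proof (cases "a < card (faces n i)")
    case True
    show ?thesis
    proof (rule poly_mapping_eqI)
      fix t
      let ?A = "face n i a"
      have A: "?A \<in> faces n i" "finite ?A" using face_in[OF True] faces_finite by auto
      have "?A \<subseteq> Poly_Mapping.keys (t + squarefree_mon ?A)" using A by (simp add: keys_add_nat keys_squarefree_mon)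
      then show "Poly_Mapping.lookup (v a) t = Poly_Mapping.lookup (w a) t"
        using fun_cong[OF assms(3)[of "t + squarefree_mon ?A"], of ?A] A by (simp add: mcomp_def index_face[OF True])
    qed
  next
    case False
    then show ?thesis using assms(1,2) by (simp add: chains_def koszul_simps)
  qed
qed

section \<open>Monomial ideals determined by supports, and their multigraded strands\<close>

definition mon_ideal :: "nat \<Rightarrow> nat set set \<Rightarrow> 'k::field mpoly set" where
  "mon_ideal n N = {p \<in> polys n. \<forall>m \<in> Poly_Mapping.keys p. Poly_Mapping.keys m \<in> N}"

text \<open>The faces that a chain with coefficients in \<open>mon_ideal n N\<close> can use in
  multidegree \<open>m\<close>.\<close>

definition mfaces :: "nat set set \<Rightarrow> (nat \<Rightarrow>\<^sub>0 nat) \<Rightarrow> nat set set" where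
  "mfaces N m = {A. A \<subseteq> Poly_Mapping.keys m \<and> Poly_Mapping.keys (m - squarefree_mon A) \<in> N}"

lemma mfaces_finite: "A \<in> mfaces N m \<Longrightarrow> finite A"
  by (auto simp: mfaces_def intro: finite_subset)

lemma mcomp_chn:
  assumes "v \<in> chains (koszul n) i (mon_ideal n N)"
  shows "mcomp n i v m \<in> chn (mfaces N m) (int i)" "mcomp n i v m \<noteq> 0 \<Longrightarrow> Poly_Mapping.keys m \<subseteq> {1..n}"
proof -
  have *: "A \<in> mfaces N m \<and> card A = i \<and> Poly_Mapping.keys m \<subseteq> {1..n}" if "mcomp n i v m A \<noteq> 0" for A
  proof -
    have A: "A \<in> faces n i" "A \<subseteq> Poly_Mapping.keys m"
      "m - squarefree_mon A \<in> Poly_Mapping.keys (v (index n i A))"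
      using that by (auto simp: mcomp_def in_keys_iff split: if_splits)
    have "v (index n i A) \<in> mon_ideal n N"
      using assms index_less[OF A(1)] by (simp add: chains_def koszul_simps)
    then have "Poly_Mapping.keys (m - squarefree_mon A) \<in> N" "Poly_Mapping.keys (m - squarefree_mon A) \<subseteq> {1..n}"
      using A(3) by (auto simp: mon_ideal_def polys_def)
    moreover have "Poly_Mapping.keys m = Poly_Mapping.keys (m - squarefree_mon A) \<union> A"
      using squarefree_mon_add_diff[OF faces_finite[OF A(1)] A(2)] faces_finite[OF A(1)] keys_add_nat keys_squarefree_mon by metis
    ultimately show ?thesis using A by (auto simp: mfaces_def faces_def)
  qed
  then show "mcomp n i v m \<in> chn (mfaces N m) (int i)" by (simp add: chn_def)
  show "mcomp n i v m \<noteq> 0 \<Longrightarrow> Poly_Mapping.keys m \<subseteq> {1..n}" using * by (auto simp: fun_eq_iff)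
qed

text \<open>Finitely many prescribed strands come from one chain. They do not interfere, since
  \<open>m\<close> is recovered from \<open>m - squarefree_mon A\<close> by adding \<open>A\<close>
  back.\<close>

lemma mcomp_inverse:
  fixes u :: "(nat \<Rightarrow>\<^sub>0 nat) \<Rightarrow> nat set \<Rightarrow> 'k::field"
  assumes T: "finite T" "\<And>m. m \<in> T \<Longrightarrow> Poly_Mapping.keys m \<subseteq> {1..n}" "\<And>m. m \<in> T \<Longrightarrow> u m \<in> chn (mfaces N m) (int i)"
  defines "w \<equiv> (\<lambda>a. if a < card (faces n i) then \<Sum>m \<in> T. Poly_Mapping.single (m - squarefree_mon (face n i a)) (u m (face n i a)) else 0)"
  shows "w \<in> chains (koszul n) i (mon_ideal n N)" "mcomp n i w m = (if m \<in> T then u m else 0)"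
proof -
  have u: "A \<subseteq> Poly_Mapping.keys m \<and> Poly_Mapping.keys (m - squarefree_mon A) \<in> N \<and> card A = i" if "m \<in> T" "u m A \<noteq> 0" for m A
    using T(3)[OF that(1)] that(2) by (auto simp: chn_def mfaces_def)
  have "w a \<in> mon_ideal n N" if a: "a < card (faces n i)" for a
  proof -
    have "Poly_Mapping.keys t \<in> N \<and> Poly_Mapping.keys t \<subseteq> {1..n}" if "t \<in> Poly_Mapping.keys (w a)" for t
    proof -
      have "Poly_Mapping.lookup (w a) t \<noteq> 0" using that by (simp add: in_keys_iff)
      then have "(\<Sum>m \<in> T. Poly_Mapping.lookup (Poly_Mapping.single (m - squarefree_mon (face n i a)) (u m (face n i a))) t) \<noteq> 0"
        using a by (simp add: w_def lookup_sum)
      then obtain m where m: "m \<in> T" "Poly_Mapping.lookup (Poly_Mapping.single (m - squarefree_mon (face n i a)) (u m (face n i a))) t \<noteq> 0"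
        by (rule sum.not_neutral_contains_not_neutral)
      then have "t = m - squarefree_mon (face n i a)" "u m (face n i a) \<noteq> 0"
        by (auto simp: lookup_single when_def split: if_splits)
      moreover have "Poly_Mapping.keys (m - squarefree_mon (face n i a)) \<subseteq> Poly_Mapping.keys m"
        by (auto simp: in_keys_iff lookup_minus)
      ultimately show ?thesis using u[OF m(1)] T(2)[OF m(1)] by auto
    qed
    then show ?thesis by (auto simp: mon_ideal_def polys_def)
  qed
  then show "w \<in> chains (koszul n) i (mon_ideal n N)"
    by (simp add: chains_def koszul_simps w_def)
  show "mcomp n i w m = (if m \<in> T then u m else 0)"
  proof
    fix A
    show "mcomp n i w m A = (if m \<in> T then u m else 0) A"
    proof (cases "A \<in> faces n i \<and> A \<subseteq> Poly_Mapping.keys m")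
      case True
      then have A: "A \<in> faces n i" "A \<subseteq> Poly_Mapping.keys m" "finite A" using faces_finite by auto
      have "mcomp n i w m A = (\<Sum>m' \<in> T. Poly_Mapping.lookup (Poly_Mapping.single (m' - squarefree_mon A) (u m' A)) (m - squarefree_mon A))"
        using A index_less[OF A(1)] by (simp add: mcomp_def w_def face_index lookup_sum)
      also have "\<dots> = (\<Sum>m' \<in> T. if m' = m then u m A else 0)"
      proof (intro sum.cong refl)
        fix m' assume m': "m' \<in> T"
        show "Poly_Mapping.lookup (Poly_Mapping.single (m' - squarefree_mon A) (u m' A)) (m - squarefree_mon A) = (if m' = m then u m A else 0)"
        proof (cases "u m' A = 0")
          case False
          then have "m' - squarefree_mon A = m - squarefree_mon A \<longleftrightarrow> m' = m"
            using u[OF m' False] squarefree_mon_add_diff[OF A(3,2)] squarefree_mon_add_diff[OF A(3), of m'] by metis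
          then show ?thesis by (auto simp: lookup_single when_def)
        qed auto
      qed
      also have "\<dots> = (if m \<in> T then u m else 0) A"
        using T(1) by simp
      finally show ?thesis .
    next
      case False
      have "u m A = 0" if "m \<in> T"
        using u[OF that, of A] T(2)[OF that] False by (auto simp: faces_def)
      then show ?thesis using False by (auto simp: mcomp_def)
    qed
  qed
qed

lemma finite_mcomp: "finite {m. mcomp n i v m \<noteq> 0}"
proof (rule finite_subset)
  let ?S = "\<Union>A \<in> faces n i. (\<lambda>t. t + squarefree_mon A) ` Poly_Mapping.keys (v (index n i A))"
  show "finite ?S" using finite_faces by simp
  show "{m. mcomp n i v m \<noteq> 0} \<subseteq> ?S"
  proof
    fix m assume "m \<in> {m. mcomp n i v m \<noteq> 0}"
    then obtain A where "mcomp n i v m A \<noteq> 0" by (auto simp: fun_eq_iff)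
    then have A: "A \<in> faces n i" "A \<subseteq> Poly_Mapping.keys m" "m - squarefree_mon A \<in> Poly_Mapping.keys (v (index n i A))"
      by (auto simp: mcomp_def in_keys_iff split: if_splits)
    then have "m = (m - squarefree_mon A) + squarefree_mon A" using squarefree_mon_add_diff[OF faces_finite] by simp
    then show "m \<in> ?S" using A by blast
  qed
qed

lemma polys_eq_mon_ideal: "polys n = mon_ideal n UNIV"
  by (simp add: mon_ideal_def)

lemma up_closed_UNIV: "up_closed UNIV" by (simp add: up_closed_def)

lemma closed_submodule_mon_ideal:
  assumes "up_closed N"
  shows "closed_submodule n (mon_ideal n N :: 'k::field mpoly set)"
  unfolding closed_submodule_def
proof (intro conjI ballI)
  show "0 \<in> (mon_ideal n N :: 'k mpoly set)" by (simp add: mon_ideal_def polys_0)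
next
  fix p q :: "'k mpoly" assume "p \<in> mon_ideal n N" "q \<in> mon_ideal n N"
  then show "p + q \<in> mon_ideal n N"
    using Poly_Mapping.keys_add[of p q] by (auto simp: mon_ideal_def polys_add)
next
  fix p q :: "'k mpoly" assume p: "p \<in> polys n" and q: "q \<in> mon_ideal n N"
  have "Poly_Mapping.keys m \<in> N" if m: "m \<in> Poly_Mapping.keys (p * q)" for m
  proof -
    obtain a b where ab: "m = a + b" "b \<in> Poly_Mapping.keys q"
      using m Poly_Mapping.keys_mult[of p q] by blast
    then have "Poly_Mapping.keys b \<in> N" using q by (simp add: mon_ideal_def)
    moreover have "Poly_Mapping.keys b \<subseteq> Poly_Mapping.keys m" by (simp add: ab keys_add_nat)
    ultimately show ?thesis using assms unfolding up_closed_def by blast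
  qed
  then show "p * q \<in> mon_ideal n N" using p q by (simp add: mon_ideal_def polys_mult)
qed

lemma koszul_df:
  "df (koszul n :: 'k::field free_complex) (Suc i) a b \<in> polys n"
  "homog 1 (df (koszul n :: 'k free_complex) (Suc i) a b)"
proof -
  have *: "Poly_Mapping.single (Poly_Mapping.single k 1) c \<in> polys n" "homog 1 (Poly_Mapping.single (Poly_Mapping.single k 1) c)"
    if "k \<in> {1..n}" for k and c :: 'k
    using that by (auto simp: polys_def homog_def total_deg_def split: if_splits)
  show "df (koszul n :: 'k free_complex) (Suc i) a b \<in> polys n"
    unfolding koszul_simps by (intro polys_sum) (auto simp: polys_0 *(1)[simplified])
  show "homog 1 (df (koszul n :: 'k free_complex) (Suc i) a b)"
    unfolding koszul_simps by (intro homog_sum) (auto simp: homog_0 *(2)[simplified])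
qed

lemma koszul_gmap: "gmap n (koszul n) (Suc i) (koszul n) i (diff (koszul n :: 'k::field free_complex) (Suc i))"
by (rule gmapI[OF diff_Suc]) (simp_all add: koszul_df koszul_simps(2))

text \<open>The finitely many nonzero strands are filled separately and the fillings reassembled by
  \<open>mcomp_inverse\<close>.\<close>

lemma koszul_boundaryI:
  fixes v :: "nat \<Rightarrow> 'k::field mpoly"
  assumes N: "up_closed N" and v: "v \<in> chains (koszul n) i (mon_ideal n N)"
    and ex: "\<And>m. mcomp n i v m \<noteq> 0 \<Longrightarrow> mcomp n i v m \<in> bd {1..n} ` chn (mfaces N m) (int i + 1)"
  shows "v \<in> boundaries (koszul n) i (mon_ideal n N)"
proof -
  define T where "T = {m. mcomp n i v m \<noteq> 0}"
  have "\<forall>m \<in> T. \<exists>c \<in> chn (mfaces N m) (int i + 1). mcomp n i v m = bd {1..n} c"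
    using ex by (auto simp: T_def)
  then obtain u where u: "\<And>m. m \<in> T \<Longrightarrow> u m \<in> chn (mfaces N m) (int i + 1)"
    "\<And>m. m \<in> T \<Longrightarrow> mcomp n i v m = bd {1..n} (u m)"
    by metis
  have T: "finite T" "\<And>m. m \<in> T \<Longrightarrow> Poly_Mapping.keys m \<subseteq> {1..n}"
    using finite_mcomp mcomp_chn(2)[OF v] by (simp_all add: T_def)
  have u1: "\<And>m. m \<in> T \<Longrightarrow> u m \<in> chn (mfaces N m) (int (Suc i))"
    using u(1) by (simp add: add.commute)
  obtain w where w: "w \<in> chains (koszul n) (Suc i) (mon_ideal n N)"
    "\<And>m. mcomp n (Suc i) w m = (if m \<in> T then u m else 0)"
    using mcomp_inverse[where T = T and u = u, OF T u1] by blast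
  have "v = diff (koszul n) (Suc i) w"
  proof (rule mcomp_eqI[OF v gmap_chains[OF koszul_gmap closed_submodule_mon_ideal[OF N] w(1)]])
    fix m show "mcomp n i v m = mcomp n i (diff (koszul n) (Suc i) w) m"
      using u(2)[of m] by (auto simp: mcomp_diff w(2) bd_0 T_def)
  qed
  then show ?thesis using w(1) by (auto simp: boundaries_def)
qed

lemma bd_degree_0:
  assumes "c \<in> chn Q 0" "\<And>A. A \<in> Q \<Longrightarrow> finite A"
  shows "bd V c = 0"
proof
  fix A
  have "c (insert k A) = 0" for k
    using assms by (auto simp: chn_def) (metis card_0_eq insert_not_empty)
  then show "bd V c A = 0 A" by (simp add: bd_def)
qed

text \<open>In degree 0, where \<open>diff\<close> is zero by definition, the simplicial boundary
  vanishes too: a chain of degree 0 lives on the empty set.\<close>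

lemma mcomp_cycle:
  assumes v: "v \<in> chains (koszul n) i (mon_ideal n N)" and "diff (koszul n) i v = 0"
  shows "bd {1..n} (mcomp n i v m) = 0"
proof (cases i)
  case 0
  then show ?thesis
    using mcomp_chn(1)[OF v, of m] mfaces_finite by (intro bd_degree_0[of _ "mfaces N m"]) auto
next
  case (Suc k)
  show ?thesis using mcomp_diff[of n k v m] assms(2) unfolding Suc by (simp add: mcomp_0)
qed

lemma mfaces_squarefree_mon:
  assumes "finite W" shows "mfaces N (squarefree_mon W) = upper_koszul N W"
proof -
  have "Poly_Mapping.keys (squarefree_mon W - squarefree_mon A) = W - A" if "A \<subseteq> W" for A
    using that assms finite_subset[OF that assms] by (auto simp: in_keys_iff lookup_minus lookup_squarefree_mon split: if_splits)
  then show ?thesis by (auto simp: mfaces_def upper_koszul_def keys_squarefree_mon[OF assms])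
qed

text \<open>Lowering an exponent that is at least 2 by one leaves the support unchanged, and for
  \<open>N = UNIV\<close> supports impose no condition. In both cases \<open>v\<close> is a cone
  point.\<close>

lemma exact_at_nonsquarefree:
  assumes m: "Poly_Mapping.keys m \<subseteq> {1..n}" and v: "v \<in> Poly_Mapping.keys m"
    and ge: "N = UNIV \<or> Poly_Mapping.lookup m v \<ge> 2"
  shows "exact_at K {1..n} (mfaces N m) i"
proof (rule exact_at_cone[of _ v])
  fix A assume A: "v \<notin> A"
  show "insert v A \<in> mfaces N m \<longleftrightarrow> A \<in> mfaces N m"
  proof (cases "A \<subseteq> Poly_Mapping.keys m \<and> N \<noteq> UNIV")
    case True
    then have "finite A" using finite_subset[OF _ finite_keys] by blast
    then have "Poly_Mapping.keys (m - squarefree_mon (insert v A)) = Poly_Mapping.keys (m - squarefree_mon A)"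
      using ge True A by (auto simp: in_keys_iff lookup_minus lookup_squarefree_mon)
    then show ?thesis using v by (auto simp: mfaces_def)
  qed (use v in \<open>auto simp: mfaces_def\<close>)
qed (use m v mfaces_finite in auto)

lemma squarefree_cases:
  assumes "\<And>v. v \<in> Poly_Mapping.keys m \<Longrightarrow> Poly_Mapping.lookup m v < 2"
  shows "m = squarefree_mon (Poly_Mapping.keys m)"
proof (rule poly_mapping_eqI)
  fix k show "Poly_Mapping.lookup m k = Poly_Mapping.lookup (squarefree_mon (Poly_Mapping.keys m)) k"
    using assms[of k] by (auto simp: lookup_squarefree_mon in_keys_iff)
qed

text \<open>Any variable in the support of a nonzero multidegree is a cone point. Multidegree 0 has
  only the empty face, in degree 0, and this strand is what the augmentation reads.\<close>

theorem koszul_resolution: "graded_free_resolution n (koszul n :: 'k::field free_complex)"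
proof -
  let ?F = "koszul n :: 'k free_complex"
  have f0: "faces n 0 = {{}}" by (auto simp: faces_def dest: finite_subset)
  have i0: "index n 0 {} = 0" using index_less[of "{}" n 0] by (simp add: f0)
  have aug: "augment ?F v = mcomp n 0 v 0 {}" for v
    by (simp add: augment_def koszul_simps f0 mcomp_def i0 squarefree_mon_def)
  have pos: "mcomp n i v m \<in> bd {1..n} ` chn (mfaces UNIV m) (int i + 1)"
    if "m \<noteq> 0" "v \<in> chains ?F i (polys n)" "diff ?F i v = 0" "mcomp n i v m \<noteq> 0" for i v m
  proof -
    have v: "v \<in> chains ?F i (mon_ideal n UNIV)" using that(2) by (simp add: polys_eq_mon_ideal)
    obtain x where x: "x \<in> Poly_Mapping.keys m" using keys_nonempty[OF \<open>m \<noteq> 0\<close>] .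
    have "exact_at TYPE('k) {1..n} (mfaces UNIV m) (int i)"
      by (rule exact_at_nonsquarefree[OF mcomp_chn(2)[OF v that(4)] x]) (rule disjI1, rule refl)
    from exact_atD[OF this mcomp_chn(1)[OF v] mcomp_cycle[OF v that(3)]] obtain c
      where "c \<in> chn (mfaces UNIV m) (int i + 1)" "bd {1..n} c = mcomp n i v m" by blast
    then show ?thesis by (metis imageI)
  qed
  have zero: "mcomp n (Suc i) v 0 = 0" for i and v :: "nat \<Rightarrow> 'k mpoly"
    by (auto simp: mcomp_def faces_def fun_eq_iff)
  have diff0: "diff ?F 0 v = 0" for v by (simp add: diff_def fun_eq_iff)
  have bnd: "boundaries ?F i (polys n) \<subseteq> chains ?F i (polys n)" for i
    using gmap_chains[OF koszul_gmap closed_submodule_polys] by (auto simp: boundaries_def)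
  show ?thesis
    unfolding graded_free_resolution_def
  proof (intro conjI allI impI)
    fix i a b :: nat assume "0 < i"
    then obtain k where k: "i = Suc k" by (cases i) auto
    show "df ?F i a b \<in> polys n" unfolding k by (rule koszul_df)
    show "homog (dg ?F i b - dg ?F (i - 1) a) (df ?F i a b)"
      using koszul_df(2) by (simp add: koszul_simps(2) k)
  next
    fix a show "dg ?F 0 a = 0" by (simp add: koszul_simps)
  next
    show "augment ?F ` chains ?F 0 (polys n) = UNIV"
    proof (intro equalityI subset_UNIV subsetI)
      fix c :: 'k
      have "(\<lambda>a. if a = 0 then Const c else 0) \<in> chains ?F 0 (polys n)"
        by (auto simp: chains_def koszul_simps f0 Const_def polys_def)
      moreover have "augment ?F (\<lambda>a. if a = 0 then Const c else 0) = c"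
        by (simp add: augment_def koszul_simps f0 Const_def)
      ultimately show "c \<in> augment ?F ` chains ?F 0 (polys n)" by (metis imageI)
    qed
  next
    show "{v \<in> chains ?F 0 (polys n). augment ?F v = 0} = boundaries ?F 0 (polys n)"
    proof (intro equalityI subsetI)
      fix v assume v: "v \<in> {v \<in> chains ?F 0 (polys n). augment ?F v = 0}"
      have "mcomp n 0 v 0 = 0"
      proof
        fix A show "mcomp n 0 v 0 A = 0 A" using v aug[of v] by (cases "A = {}") (auto simp: mcomp_def)
      qed
      then have "mcomp n 0 v m \<noteq> 0 \<Longrightarrow> mcomp n 0 v m \<in> bd {1..n} ` chn (mfaces UNIV m) (int 0 + 1)" for m
        using v pos[of m v 0] diff0 by (cases "m = 0") blast+
      then show "v \<in> boundaries ?F 0 (polys n)"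
        using v unfolding polys_eq_mon_ideal by (intro koszul_boundaryI up_closed_UNIV) auto
    next
      fix v assume v: "v \<in> boundaries ?F 0 (polys n)"
      then obtain u where "v = diff ?F (Suc 0) u" by (auto simp: boundaries_def)
      then have "augment ?F v = 0" unfolding aug by (simp add: mcomp_diff zero bd_0)
      then show "v \<in> {v \<in> chains ?F 0 (polys n). augment ?F v = 0}" using v bnd by auto
    qed
  next
    fix i :: nat assume "0 < i"
    then obtain k where k: "i = Suc k" by (cases i) auto
    show "cycles ?F i (polys n) = boundaries ?F i (polys n)"
    proof (intro equalityI subsetI)
      fix v assume "v \<in> cycles ?F i (polys n)"
      then have v: "v \<in> chains ?F i (polys n)" "diff ?F i v = 0" by (auto simp: cycles_def)
      show "v \<in> boundaries ?F i (polys n)"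
        unfolding polys_eq_mon_ideal
      proof (rule koszul_boundaryI[OF up_closed_UNIV v(1)[unfolded polys_eq_mon_ideal]])
        fix m assume "mcomp n i v m \<noteq> 0"
        \<comment> \<open>A nonempty face does not fit into the empty support of
          \<open>m = 0\<close>.\<close>
        moreover from this have "m \<noteq> 0" using zero k by metis
        ultimately show "mcomp n i v m \<in> bd {1..n} ` chn (mfaces UNIV m) (int i + 1)"
          using pos v by blast
      qed
    next
      fix v assume v: "v \<in> boundaries ?F i (polys n)"
      then obtain u where u: "u \<in> chains ?F (Suc i) (polys n)" "v = diff ?F (Suc i) u" by (auto simp: boundaries_def)
      have vc: "v \<in> chains ?F i (polys n)" using v bnd by blast
      have "diff ?F (Suc k) v = 0"
      proof (rule mcomp_eqI)
        show "diff ?F (Suc k) v \<in> chains ?F k (polys n)"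
          using gmap_chains[OF koszul_gmap closed_submodule_polys] vc k by blast
        show "0 \<in> chains ?F k (polys n)" by (simp add: chains_def polys_0)
        fix m
        show "mcomp n k (diff ?F (Suc k) v) m = mcomp n k 0 m"
          by (simp add: mcomp_0 u(2) k mcomp_diff bd_bd)
      qed
      then show "v \<in> cycles ?F i (polys n)" using vc k by (simp add: cycles_def)
    qed
  qed
qed

text \<open>The internal degree \<open>j\<close> is the total degree of a multidegree, hence
  \<open>card W\<close> for a squarefree one. Conversely a simplicial cycle on \<open>W\<close> is a
  homogeneous Koszul cycle concentrated in one multidegree.\<close>

theorem acyclic_at_koszul:
  assumes N: "up_closed N"
  shows "acyclic_at (koszul n) i j (mon_ideal n N :: 'k::field mpoly set) \<longleftrightarrow>
    (\<forall>W \<subseteq> {1..n}. int (card W) = j \<longrightarrow> exact_at TYPE('k) {1..n} (upper_koszul N W) (int i))"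
    (is "?L \<longleftrightarrow> ?R")
proof
  let ?F = "koszul n :: 'k free_complex" and ?M = "mon_ideal n N :: 'k mpoly set"
  assume R: ?R
  show ?L
    unfolding acyclic_at_def
  proof
    fix z assume "z \<in> cycles ?F i ?M \<inter> degree_part ?F i j"
    then have z: "z \<in> chains ?F i ?M" "diff ?F i z = 0" "z \<in> degree_part ?F i j"
      by (auto simp: cycles_def)
    show "z \<in> boundaries ?F i ?M"
    proof (rule koszul_boundaryI[OF N z(1)])
      fix m assume ne: "mcomp n i z m \<noteq> 0"
      have m: "Poly_Mapping.keys m \<subseteq> {1..n}" using mcomp_chn(2)[OF z(1) ne] .
      have "exact_at TYPE('k) {1..n} (mfaces N m) (int i)"
      proof (cases "\<exists>v \<in> Poly_Mapping.keys m. Poly_Mapping.lookup m v \<ge> 2")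
        case True
        then show ?thesis using exact_at_nonsquarefree[OF m] by blast
      next
        case False
        let ?W = "Poly_Mapping.keys m"
        have mW: "m = squarefree_mon ?W" using False by (intro squarefree_cases) force
        obtain A where "mcomp n i z m A \<noteq> 0" using ne by (auto simp: fun_eq_iff)
        then have A: "A \<in> faces n i" "A \<subseteq> ?W" "m - squarefree_mon A \<in> Poly_Mapping.keys (z (index n i A))"
          by (auto simp: mcomp_def in_keys_iff split: if_splits)
        have finA: "finite A" using faces_finite[OF A(1)] .
        \<comment> \<open>The basis element \<open>A\<close> accounts for \<open>i\<close> of the
          degree \<open>j\<close>, its coefficient for the rest.\<close>
        have "int (total_deg (m - squarefree_mon A)) = j - int i"
          using z(3) index_less[OF A(1)] A(3) by (auto simp: degree_part_def koszul_simps homog_def)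
        moreover have "total_deg m = total_deg (m - squarefree_mon A) + total_deg (squarefree_mon A)"
          unfolding total_deg_add[symmetric] using squarefree_mon_add_diff[OF finA A(2)] by simp
        moreover have "total_deg m = card ?W"
          using total_deg_squarefree_mon[of ?W] mW by simp
        ultimately have "int (card ?W) = j"
          using A(1) finA by (simp add: total_deg_squarefree_mon faces_def)
        then have "exact_at TYPE('k) {1..n} (upper_koszul N ?W) (int i)" using R m by blast
        then show ?thesis using mfaces_squarefree_mon[of ?W N] mW by simp
      qed
      from exact_atD[OF this mcomp_chn(1)[OF z(1)] mcomp_cycle[OF z(1,2)]]
      show "mcomp n i z m \<in> bd {1..n} ` chn (mfaces N m) (int i + 1)" by (metis imageI)
    qed
  qed
next
  let ?F = "koszul n :: 'k free_complex" and ?M = "mon_ideal n N :: 'k mpoly set"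
  assume L: ?L
  show ?R
  proof (intro allI impI)
    fix W assume W: "W \<subseteq> {1..n}" "int (card W) = j"
    have finW: "finite W" using W(1) finite_subset by auto
    let ?m = "squarefree_mon W"
    show "exact_at TYPE('k) {1..n} (upper_koszul N W) (int i)"
      unfolding exact_at_def
    proof (intro allI impI, elim conjE)
      fix c :: "nat set \<Rightarrow> 'k" assume c: "c \<in> chn (upper_koszul N W) (int i)" "bd {1..n} c = 0"
      \<comment> \<open>Written as a sum over a singleton so that it is the chain of
        \<open>mcomp_inverse\<close>.\<close>
      define w where "w = (\<lambda>a. if a < card (faces n i) then \<Sum>m \<in> {?m}. Poly_Mapping.single (m - squarefree_mon (face n i a)) (c (face n i a)) else 0)"
      have "w \<in> chains ?F i ?M \<and> (\<forall>m. mcomp n i w m = (if m \<in> {?m} then c else 0))"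
        using mcomp_inverse[of "{?m}" n "\<lambda>_. c" N i] W(1) c(1) keys_squarefree_mon[OF finW] mfaces_squarefree_mon[OF finW] unfolding w_def by simp
      then have w: "w \<in> chains ?F i ?M" "\<And>m. mcomp n i w m = (if m = ?m then c else 0)" by auto
      have "diff ?F i w = 0"
      proof (cases i)
        case 0
        then show ?thesis by (simp add: diff_def fun_eq_iff)
      next
        case (Suc k)
        show ?thesis
          unfolding Suc
        proof (rule mcomp_eqI)
          show "diff ?F (Suc k) w \<in> chains ?F k ?M"
            using gmap_chains[OF koszul_gmap closed_submodule_mon_ideal[OF N]] w(1) Suc by blast
          show "0 \<in> chains ?F k (polys n)" by (simp add: chains_def polys_0)
          fix m
          show "mcomp n k (diff ?F (Suc k) w) m = mcomp n k 0 m"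
            using w(2)[of m] c(2) unfolding mcomp_diff mcomp_0 Suc by (cases "m = ?m") (simp_all add: bd_0)
        qed
      qed
      moreover have "w \<in> degree_part ?F i j"
        unfolding degree_part_def
      proof (intro CollectI allI impI)
        fix a assume "a < rk ?F i"
        then have a: "a < card (faces n i)" by (simp add: koszul_simps)
        let ?A = "face n i a"
        have "int (total_deg (?m - squarefree_mon ?A)) = j - int i" if "c ?A \<noteq> 0"
        proof -
          have A: "?A \<subseteq> W" "card ?A = i" "finite ?A"
            using that c(1) finite_subset[OF _ finW] by (auto simp: chn_def upper_koszul_def)
          then have "total_deg ?m = total_deg (?m - squarefree_mon ?A) + total_deg (squarefree_mon ?A)"
            unfolding total_deg_add[symmetric] using squarefree_mon_add_diff[of ?A ?m] keys_squarefree_mon[OF finW] by simp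
          then show ?thesis using A W(2) by (simp add: total_deg_squarefree_mon finW)
        qed
        then show "homog (j - dg ?F i a) (w a)"
          using a by (auto simp: w_def homog_def koszul_simps split: if_splits)
      qed
      ultimately have "w \<in> boundaries ?F i ?M"
        using L w(1) by (auto simp: acyclic_at_def cycles_def)
      then obtain u where u: "u \<in> chains ?F (Suc i) ?M" "w = diff ?F (Suc i) u"
        unfolding boundaries_def by blast
      have "bd {1..n} (mcomp n (Suc i) u ?m) = c"
        using mcomp_diff[of n i u ?m] w(2)[of ?m] unfolding u(2)[symmetric] by simp
      moreover have "mcomp n (Suc i) u ?m \<in> chn (upper_koszul N W) (int i + 1)"
        using mcomp_chn(1)[OF u(1), of ?m] mfaces_squarefree_mon[OF finW] by (simp add: add.commute)
      ultimately show "\<exists>u \<in> chn (upper_koszul N W) (int i + 1). bd {1..n} u = c" by blast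
    qed
  qed
qed

section \<open>Regularity of Stanley--Reisner ideals\<close>

lemma resolution_is_resolution: "graded_free_resolution n (resolution n :: 'k::field free_complex)"
  unfolding resolution_def using koszul_resolution by (rule someI)

text \<open>\<open>betti\<close> refers to an arbitrarily chosen resolution, so its vanishing is
  first transferred to the Koszul complex.\<close>

lemma betti_mon_ideal:
  assumes N: "up_closed N"
  shows "betti n i j (mon_ideal n N :: 'k::field mpoly set) = 0 \<longleftrightarrow>
    (\<forall>W \<subseteq> {1..n}. int (card W) = j \<longrightarrow> exact_at TYPE('k) {1..n} (upper_koszul N W) (int i))"
proof -
  let ?M = "mon_ideal n N :: 'k mpoly set"
  have M: "closed_submodule n ?M" "?M \<subseteq> polys n"
    using closed_submodule_mon_ideal[OF N] by (auto simp: mon_ideal_def)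
  have "betti n i j ?M = 0 \<longleftrightarrow> acyclic_at (resolution n) i j ?M"
    by (rule betti_eq_0_iff[OF resolution_is_resolution M])
  also have "\<dots> \<longleftrightarrow> acyclic_at (koszul n) i j ?M"
    using acyclic_at_resolution_independent[OF resolution_is_resolution koszul_resolution M(1)]
      acyclic_at_resolution_independent[OF koszul_resolution resolution_is_resolution M(1)] by blast
  finally show ?thesis unfolding acyclic_at_koszul[OF N] .
qed

lemma exact_at_negative:
  fixes K :: "'a::field itself"
  assumes "i < 0" shows "exact_at K V Q i"
  unfolding exact_at_def
proof (intro allI impI, elim conjE)
  fix c :: "nat set \<Rightarrow> 'a" assume c: "c \<in> chn Q i"
  have "c = 0"
  proof
    fix A show "c A = 0 A" using c assms by (auto simp: chn_def)
  qed
  then show "\<exists>u \<in> chn Q (i + 1). bd V u = c" using chn_0 bd_0 by metis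
qed

text \<open>Betti numbers are indexed by naturals and \<open>regular\<close> by integers; the
  additional negative degrees hold only the zero chain.\<close>

lemma reg_mon_ideal:
  assumes N: "up_closed N"
  shows "reg n (mon_ideal n N :: 'k::field mpoly set) = (INF \<rho> \<in> {\<rho>. regular TYPE('k) {1..n} \<rho> N}. ereal (of_int \<rho>))"
proof -
  have "(\<forall>i j. j > int i + \<rho> \<longrightarrow> betti n i j (mon_ideal n N :: 'k mpoly set) = 0) \<longleftrightarrow> regular TYPE('k) {1..n} \<rho> N" for \<rho>
  proof
    assume L: "\<forall>i j. j > int i + \<rho> \<longrightarrow> betti n i j (mon_ideal n N :: 'k mpoly set) = 0"
    show "regular TYPE('k) {1..n} \<rho> N"
    proof (rule regularI[of _ "{1..n}"])
      fix W i assume W: "W \<subseteq> {1..n}" "int (card W) > i + \<rho>"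
      show "exact_at TYPE('k) {1..n} (upper_koszul N W) i"
      proof (cases "i < 0")
        case True
        then show ?thesis by (rule exact_at_negative)
      next
        case False
        then have k: "i = int (nat i)" by simp
        show ?thesis using L W unfolding betti_mon_ideal[OF N] by (metis k)
      qed
    qed auto
  next
    assume R: "regular TYPE('k) {1..n} \<rho> N"
    have "exact_at TYPE('k) {1..n} (upper_koszul N W) (int i)" if "W \<subseteq> {1..n}" "int (card W) > int i + \<rho>" for W i
      using regularD[OF R, of "{1..n}" W] that finite_subset[OF that(1)] by auto
    then show "\<forall>i j. j > int i + \<rho> \<longrightarrow> betti n i j (mon_ideal n N :: 'k mpoly set) = 0"
      unfolding betti_mon_ideal[OF N] by blast
  qed
  then show ?thesis
    unfolding reg_def by (intro arg_cong[of _ _ Inf]) auto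
qed

text \<open>Beyond the threshold \<open>card V\<close> only negative degrees remain.\<close>

lemma regular_exists: "finite V \<Longrightarrow> regular K V (int (card V)) N"
  unfolding regular_def
proof (intro allI impI)
  fix W i assume "finite V" "W \<subseteq> V" "int (card W) > i + int (card V)"
  then have "i < 0" using card_mono[of V W] by linarith
  then show "exact_at K W (upper_koszul N W) i" by (rule exact_at_negative)
qed

text \<open>All admissible bounds are at least 1 and \<open>n\<close> is one of them, so the infimum
  is attained as a least natural number.\<close>

lemma reg_mon_ideal_eq:
  assumes N: "up_closed N" "{} \<notin> N" and A: "A \<in> N" "A \<subseteq> {1..n}"
  obtains r where "r \<ge> 1" "regular TYPE('k::field) {1..n} r N" "reg n (mon_ideal n N :: 'k mpoly set) = ereal (of_int r)"
proof -
  let ?P = "\<lambda>k. regular TYPE('k) {1..n} (int k) N"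
  have "?P n" using regular_exists[of "{1..n}" "TYPE('k)" N] by simp
  define k where "k = (LEAST k. ?P k)"
  have k: "?P k" unfolding k_def using \<open>?P n\<close> by (rule LeastI)
  have least: "int k \<le> \<rho>" if "regular TYPE('k) {1..n} \<rho> N" for \<rho>
  proof -
    have "\<rho> \<ge> 1" using regular_pos[OF _ A N(2) that] by simp
    then have "?P (nat \<rho>)" using that by simp
    then have "k \<le> nat \<rho>" unfolding k_def by (rule Least_le)
    then show ?thesis using \<open>\<rho> \<ge> 1\<close> by linarith
  qed
  have "reg n (mon_ideal n N :: 'k mpoly set) = ereal (of_int (int k))"
    unfolding reg_mon_ideal[OF N(1)]
  proof (rule antisym)
    show "(INF \<rho> \<in> {\<rho>. regular TYPE('k) {1..n} \<rho> N}. ereal (of_int \<rho>)) \<le> ereal (of_int (int k))"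
      using k by (intro INF_lower) simp
    show "ereal (of_int (int k)) \<le> (INF \<rho> \<in> {\<rho>. regular TYPE('k) {1..n} \<rho> N}. ereal (of_int \<rho>))"
      using least by (intro INF_greatest) (metis ereal_less_eq(3) mem_Collect_eq of_int_le_iff)
  qed
  moreover have "int k \<ge> 1" using regular_pos[OF _ A N(2) k] by simp
  ultimately show thesis using k that by blast
qed

text \<open>The zero ideal is \<open>mon_ideal n {}\<close>. Its complexes have no faces, so every
  integer is an admissible bound.\<close>

lemma reg_zero: "reg n {0 :: 'k::field mpoly} = - \<infinity>"
proof -
  have eq: "{0 :: 'k mpoly} = mon_ideal n {}"
    by (auto simp: mon_ideal_def polys_def in_keys_iff intro: poly_mapping_eqI)
  have "regular TYPE('k) {1..n} \<rho> {}" for \<rho>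
    unfolding regular_def exact_at_def
  proof (intro allI impI, elim conjE)
    fix W i and c :: "nat set \<Rightarrow> 'k" assume "c \<in> chn (upper_koszul {} W) i"
    then have "c = 0" by (auto simp: chn_def upper_koszul_def)
    then show "\<exists>u \<in> chn (upper_koszul {} W) (i + 1). bd W u = c" using chn_0 bd_0 by metis
  qed
  then have "reg n {0 :: 'k mpoly} = (INF \<rho> :: int. ereal (of_int \<rho>))"
    unfolding eq reg_mon_ideal[of "{}", unfolded up_closed_def, simplified] by simp
  also have "\<dots> = - \<infinity>"
  proof (rule ereal_bot)
    fix B :: real
    have "(INF \<rho> :: int. ereal (of_int \<rho>)) \<le> ereal (of_int \<lfloor>B\<rfloor>)" by (rule INF_lower) simp
    also have "\<dots> \<le> ereal B" by simp
    finally show "(INF \<rho> :: int. ereal (of_int \<rho>)) \<le> ereal B" .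
  qed
  finally show ?thesis .
qed

section \<open>Stanley-Reisner ideals as monomial ideals\<close>

lemma prod_Var: "finite A \<Longrightarrow> (\<Prod>i \<in> A. Var i) = (Poly_Mapping.single (squarefree_mon A) 1 :: 'k::field mpoly)"
  by (induction A rule: finite_induct) (auto simp: squarefree_mon_def Var_def mult_single)

lemma ideal_mon_ideal:
  assumes "up_closed N"
  shows "ideal (mon_ideal n N) (poly_ring TYPE('k::field) n)"
proof -
  let ?R = "poly_ring TYPE('k) n" and ?M = "mon_ideal n N :: 'k mpoly set"
  interpret R: cring ?R by (rule cring_poly_ring)
  have M: "0 \<in> ?M" "\<And>p q. p \<in> ?M \<Longrightarrow> q \<in> ?M \<Longrightarrow> p + q \<in> ?M"
    "\<And>p q. p \<in> polys n \<Longrightarrow> q \<in> ?M \<Longrightarrow> p * q \<in> ?M"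
    using closed_submodule_mon_ideal[OF assms, of n, where 'k = 'k] unfolding closed_submodule_def by blast+
  have subset: "?M \<subseteq> polys n" by (auto simp: mon_ideal_def)
  show ?thesis
  proof (rule idealI[OF R.ring_axioms])
    show "subgroup ?M (add_monoid ?R)"
    proof (rule group.subgroupI[OF R.a_group])
      show "?M \<subseteq> carrier (add_monoid ?R)" using subset by (simp add: poly_ring_def)
      show "?M \<noteq> {}" using M(1) by blast
      fix p assume p: "p \<in> ?M"
      then have "- p \<in> ?M" using closed_submodule_uminus[OF closed_submodule_mon_ideal[OF assms]] by blast
      moreover have "\<ominus>\<^bsub>?R\<^esub> p = - p"
        using p subset by (intro R.minus_equality) (auto simp: poly_ring_def polys_uminus)
      ultimately show "inv\<^bsub>add_monoid ?R\<^esub> p \<in> ?M" by (simp add: a_inv_def)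
    next
      fix p q assume "p \<in> ?M" "q \<in> ?M"
      then show "p \<otimes>\<^bsub>add_monoid ?R\<^esub> q \<in> ?M" using M(2) by (simp add: poly_ring_def)
    qed
  next
    fix p x assume "p \<in> ?M" "x \<in> carrier ?R"
    then show "x \<otimes>\<^bsub>?R\<^esub> p \<in> ?M" "p \<otimes>\<^bsub>?R\<^esub> x \<in> ?M"
      using M(3)[of x p] by (simp_all add: poly_ring_def mult.commute)
  qed
qed

text \<open>A monomial with support \<open>A\<close> is a multiple of the squarefree monomial of
  \<open>A\<close>, a generator whenever \<open>A\<close> is a nonface. \<open>- X\<close> also
  contains sets outside \<open>{1..n}\<close>: they never occur as supports in
  \<open>polys n\<close>, and they keep the family up-closed.\<close>

lemma SR_ideal_eq_mon_ideal:
  assumes X: "simplicial_complex n X"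
  shows "SR_ideal TYPE('k::field) n X = mon_ideal n (- X)"
proof -
  let ?R = "poly_ring TYPE('k) n"
  let ?G = "{\<Prod>i\<in>A. Var i | A. A \<subseteq> {1..n} \<and> A \<notin> X} :: 'k mpoly set"
  interpret R: cring ?R by (rule cring_poly_ring)
  have up_closed: "up_closed (- X)" using X unfolding simplicial_complex_def up_closed_def by blast
  have G: "?G = {Poly_Mapping.single (squarefree_mon A) 1 | A. A \<subseteq> {1..n} \<and> A \<notin> X}"
    using prod_Var finite_subset[OF _ finite_atLeastAtMost[of 1 n]] by metis
  have GM: "?G \<subseteq> mon_ideal n (- X)"
  proof
    fix p assume "p \<in> ?G"
    then obtain A where A: "p = Poly_Mapping.single (squarefree_mon A) 1" "A \<subseteq> {1..n}" "A \<notin> X"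
      unfolding G by blast
    moreover have "Poly_Mapping.keys (squarefree_mon A) = A"
      using keys_squarefree_mon finite_subset[OF A(2)] by blast
    ultimately show "p \<in> mon_ideal n (- X)" by (simp add: mon_ideal_def polys_def)
  qed
  have GR: "?G \<subseteq> carrier ?R" using GM by (auto simp: mon_ideal_def poly_ring_def)
  show ?thesis
  proof
    show "SR_ideal TYPE('k) n X \<subseteq> mon_ideal n (- X)"
      unfolding SR_ideal_def by (rule R.genideal_minimal[OF ideal_mon_ideal[OF up_closed] GM])
    interpret I: ideal "SR_ideal TYPE('k) n X" ?R
      unfolding SR_ideal_def by (rule R.genideal_ideal[OF GR])
    have zero: "0 \<in> SR_ideal TYPE('k) n X"
      using additive_subgroup.zero_closed[OF I.additive_subgroup_axioms] by (simp add: poly_ring_def)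
    have add: "p + q \<in> SR_ideal TYPE('k) n X" if "p \<in> SR_ideal TYPE('k) n X" "q \<in> SR_ideal TYPE('k) n X" for p q
      using additive_subgroup.a_closed[OF I.additive_subgroup_axioms that] by (simp add: poly_ring_def)
    have mult: "p * q \<in> SR_ideal TYPE('k) n X" if "p \<in> polys n" "q \<in> SR_ideal TYPE('k) n X" for p q
      using I.I_l_closed[OF that(2), of p] that(1) by (simp add: poly_ring_def)
    have sum: "sum f S \<in> SR_ideal TYPE('k) n X" if "\<And>x. x \<in> S \<Longrightarrow> f x \<in> SR_ideal TYPE('k) n X"
      for f :: "(nat \<Rightarrow>\<^sub>0 nat) \<Rightarrow> 'k mpoly" and S
      using that by (induction S rule: infinite_finite_induct) (auto simp: zero add)
    show "mon_ideal n (- X) \<subseteq> SR_ideal TYPE('k) n X"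
    proof
      fix p :: "'k mpoly" assume p: "p \<in> mon_ideal n (- X)"
      have "Poly_Mapping.single m (Poly_Mapping.lookup p m) \<in> SR_ideal TYPE('k) n X" if m: "m \<in> Poly_Mapping.keys p" for m
      proof -
        let ?A = "Poly_Mapping.keys m"
        have A: "?A \<subseteq> {1..n}" "?A \<notin> X" using p m by (auto simp: mon_ideal_def polys_def)
        have "Poly_Mapping.single (squarefree_mon ?A) 1 \<in> ?G" unfolding G using A by blast
        then have "Poly_Mapping.single (squarefree_mon ?A) 1 \<in> SR_ideal TYPE('k) n X"
          unfolding SR_ideal_def using R.genideal_self[OF GR] by blast
        moreover have "Poly_Mapping.keys (m - squarefree_mon ?A) \<subseteq> ?A" by (auto simp: in_keys_iff lookup_minus)
        then have "Poly_Mapping.single (m - squarefree_mon ?A) (Poly_Mapping.lookup p m) \<in> polys n"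
          using A(1) by (auto simp: polys_def)
        ultimately have "Poly_Mapping.single (m - squarefree_mon ?A) (Poly_Mapping.lookup p m) * Poly_Mapping.single (squarefree_mon ?A) 1
            \<in> SR_ideal TYPE('k) n X"
          by (rule mult[rotated])
        then show ?thesis by (simp add: mult_single squarefree_mon_add_diff)
      qed
      then have "(\<Sum>m \<in> Poly_Mapping.keys p. Poly_Mapping.single m (Poly_Mapping.lookup p m)) \<in> SR_ideal TYPE('k) n X"
        by (rule sum)
      then show "p \<in> SR_ideal TYPE('k) n X" using poly_mapping_sum_singles[of "Poly_Mapping.keys p" p] by simp
    qed
  qed
qed

lemma mon_ideal_Int: "mon_ideal n N \<inter> mon_ideal n N' = mon_ideal n (N \<inter> N')"
  by (auto simp: mon_ideal_def)

text \<open>A polynomial is split monomial by monomial, those with support in \<open>N\<close> going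
  to the first summand.\<close>

lemma mon_ideal_sum:
  assumes "up_closed N" "up_closed N'"
  shows "mon_ideal n N <+>\<^bsub>poly_ring TYPE('k::field) n\<^esub> mon_ideal n N' = mon_ideal n (N \<union> N')"
proof
  show "mon_ideal n N <+>\<^bsub>poly_ring TYPE('k) n\<^esub> mon_ideal n N' \<subseteq> mon_ideal n (N \<union> N')"
  proof
    fix p assume "p \<in> mon_ideal n N <+>\<^bsub>poly_ring TYPE('k) n\<^esub> mon_ideal n N'"
    then obtain q r where p: "p = q + r" "q \<in> mon_ideal n N" "r \<in> mon_ideal n N'"
      by (auto simp: set_add_def' poly_ring_def)
    then show "p \<in> mon_ideal n (N \<union> N')"
      using Poly_Mapping.keys_add[of q r] by (auto simp: mon_ideal_def polys_add)
  qed
  show "mon_ideal n (N \<union> N') \<subseteq> mon_ideal n N <+>\<^bsub>poly_ring TYPE('k) n\<^esub> mon_ideal n N'"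
  proof
    fix p :: "'k mpoly" assume p: "p \<in> mon_ideal n (N \<union> N')"
    define q where "q = Poly_Mapping.mapp (\<lambda>m c. if Poly_Mapping.keys m \<in> N then c else 0) p"
    have q: "Poly_Mapping.lookup q m = (if Poly_Mapping.keys m \<in> N then Poly_Mapping.lookup p m else 0)" for m
      by (auto simp: q_def lookup_mapp when_def in_keys_iff)
    have "q \<in> mon_ideal n N"
      using p by (auto simp: mon_ideal_def polys_def in_keys_iff q split: if_splits)
    moreover have "p - q \<in> mon_ideal n N'"
      using p by (auto simp: mon_ideal_def polys_def in_keys_iff lookup_minus q split: if_splits)
    moreover have "p = q + (p - q)" by simp
    ultimately have "\<exists>x \<in> mon_ideal n N. \<exists>y \<in> mon_ideal n N'. p = x + y" by metis
    then show "p \<in> mon_ideal n N <+>\<^bsub>poly_ring TYPE('k) n\<^esub> mon_ideal n N'"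
      unfolding set_add_def' by (simp add: poly_ring_def)
  qed
qed

lemma mon_ideal_nontrivial:
  assumes "mon_ideal n N \<noteq> {0 :: 'k::field mpoly}"
  obtains A where "A \<in> N" "A \<subseteq> {1..n}"
proof -
  have "0 \<in> (mon_ideal n N :: 'k mpoly set)" by (simp add: mon_ideal_def polys_0)
  then obtain p :: "'k mpoly" where p: "p \<in> mon_ideal n N" "p \<noteq> 0" using assms by blast
  obtain m where "m \<in> Poly_Mapping.keys p" using keys_nonempty[OF p(2)] .
  then show thesis using p(1) that[of "Poly_Mapping.keys m"] by (auto simp: mon_ideal_def polys_def)
qed

text \<open>If exactly one of the two ideals is zero, their sum is the other one, of finite
  regularity, while the right-hand side of the first bound is minus infinity; hence the condition
  there. In that case the intersection is zero and both sides of the second bound are minus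
  infinity.\<close>

theorem theorem1p4:
  fixes n :: nat and X Y :: "nat set set"
  assumes "simplicial_complex n X" and "simplicial_complex n Y"
  shows
    "reg n (SR_ideal TYPE('k::field) n X <+>\<^bsub>poly_ring TYPE('k) n\<^esub> SR_ideal TYPE('k) n Y)
       = reg n (SR_ideal TYPE('k) n (X \<inter> Y))
     \<and> ((SR_ideal TYPE('k) n X = {0} \<longleftrightarrow> SR_ideal TYPE('k) n Y = {0}) \<longrightarrow>
         reg n (SR_ideal TYPE('k) n (X \<inter> Y))
           \<le> reg n (SR_ideal TYPE('k) n X) + reg n (SR_ideal TYPE('k) n Y) - 1)
     \<and> reg n (SR_ideal TYPE('k) n X \<inter> SR_ideal TYPE('k) n Y)
       = reg n (SR_ideal TYPE('k) n (X \<union> Y))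
     \<and> reg n (SR_ideal TYPE('k) n (X \<union> Y))
       \<le> reg n (SR_ideal TYPE('k) n X) + reg n (SR_ideal TYPE('k) n Y)"
proof -
  note X = assms(1) and Y = assms(2)
  have XY: "simplicial_complex n (X \<inter> Y)" "simplicial_complex n (X \<union> Y)"
    using X Y unfolding simplicial_complex_def by blast+
  have up_closed: "up_closed (- X)" "up_closed (- Y)" and ne: "{} \<notin> - X" "{} \<notin> - Y"
    using X Y unfolding simplicial_complex_def up_closed_def by blast+
  let ?I = "SR_ideal TYPE('k) n X" and ?J = "SR_ideal TYPE('k) n Y"
  note SR = SR_ideal_eq_mon_ideal[OF X, where 'k = 'k] SR_ideal_eq_mon_ideal[OF Y, where 'k = 'k]
    SR_ideal_eq_mon_ideal[OF XY(1), where 'k = 'k] SR_ideal_eq_mon_ideal[OF XY(2), where 'k = 'k]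
  have sum: "?I <+>\<^bsub>poly_ring TYPE('k) n\<^esub> ?J = SR_ideal TYPE('k) n (X \<inter> Y)"
    unfolding SR mon_ideal_sum[OF up_closed] by (simp add: Compl_Int)
  have int: "?I \<inter> ?J = SR_ideal TYPE('k) n (X \<union> Y)"
    unfolding SR mon_ideal_Int by (simp add: Compl_Un)
  have zero: "0 \<in> ?I" "0 \<in> ?J" by (auto simp: SR mon_ideal_def polys_0)
  have zero_sum: "{0} <+>\<^bsub>poly_ring TYPE('k) n\<^esub> {0} = {0 :: 'k mpoly}"
    by (auto simp: set_add_def' poly_ring_def)
  have bounds: "reg n (SR_ideal TYPE('k) n (X \<inter> Y)) \<le> reg n ?I + reg n ?J - 1 \<and>
      reg n (SR_ideal TYPE('k) n (X \<union> Y)) \<le> reg n ?I + reg n ?J" if nz: "?I \<noteq> {0}" "?J \<noteq> {0}"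
  proof -
    obtain A B where A: "A \<in> - X" "A \<subseteq> {1..n}" and B: "B \<in> - Y" "B \<subseteq> {1..n}"
      using nz unfolding SR by (metis mon_ideal_nontrivial)
    obtain r where r: "r \<ge> 1" "regular TYPE('k) {1..n} r (- X)" "reg n ?I = ereal (of_int r)"
      using reg_mon_ideal_eq[OF up_closed(1) ne(1) A, where 'k = 'k] unfolding SR by metis
    obtain s where s: "s \<ge> 1" "regular TYPE('k) {1..n} s (- Y)" "reg n ?J = ereal (of_int s)"
      using reg_mon_ideal_eq[OF up_closed(2) ne(2) B, where 'k = 'k] unfolding SR by metis
    have up_closed': "up_closed (- (X \<inter> Y))" "up_closed (- (X \<union> Y))"
      using up_closed unfolding up_closed_def by blast+
    have "regular TYPE('k) {1..n} (r + s - 1) (- (X \<inter> Y))"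
      using regular_Un[OF _ up_closed r(1) s(1) r(2) s(2)] by (simp add: Compl_Int)
    then have "reg n (SR_ideal TYPE('k) n (X \<inter> Y)) \<le> ereal (of_int (r + s - 1))"
      unfolding SR reg_mon_ideal[OF up_closed'(1)] by (intro INF_lower) simp
    moreover have "regular TYPE('k) {1..n} (r + s) (- (X \<union> Y))"
      using regular_Int[OF _ up_closed r(2) s(2)] by (simp add: Compl_Un)
    then have "reg n (SR_ideal TYPE('k) n (X \<union> Y)) \<le> ereal (of_int (r + s))"
      unfolding SR reg_mon_ideal[OF up_closed'(2)] by (intro INF_lower) simp
    ultimately show ?thesis by (simp add: r(3) s(3) one_ereal_def)
  qed
  have "reg n (SR_ideal TYPE('k) n (X \<inter> Y)) \<le> reg n ?I + reg n ?J - 1" if "?I = {0} \<longleftrightarrow> ?J = {0}"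
  proof (cases "?I = {0}")
    case True
    then have "SR_ideal TYPE('k) n (X \<inter> Y) = {0}" using that sum zero_sum by simp
    then show ?thesis by (simp add: reg_zero)
  qed (use that bounds in blast)
  moreover have "reg n (SR_ideal TYPE('k) n (X \<union> Y)) \<le> reg n ?I + reg n ?J"
  proof (cases "?I = {0} \<or> ?J = {0}")
    case True
    then have "SR_ideal TYPE('k) n (X \<union> Y) = {0}" using int zero by auto
    then show ?thesis by (simp add: reg_zero)
  qed (use bounds in blast)
  ultimately show ?thesis by (simp add: sum int)
qed

end
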